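(* For every $T>0$ there exists a real-valued function $\theta_0\in C^\infty(\mathbb{T})$ with zero average over $\mathbb{T}$ and with $\|\nabla\theta_0\|_\infty\le 10$, such that the (global, smooth) solution $\theta(x,y,t)$ of the two-dimensional Euler equation in vorticity form on $\mathbb{T}$, $$\dot\theta=\nabla\theta\cdot u,\qquad u=\nabla^\perp\zeta=(\zeta_y,-\zeta_x),\qquad \zeta=\Delta^{-1}\theta,\qquad \theta(x,y,0)=\theta_0(x,y),$$ satisfies $$\|\nabla\theta(\cdot,t)\|_\infty>0.1\exp(T/2)\qquad\text{for some } t<T.$$
   Context: $\mathbb{T}$ is the two-dimensional torus $(\mathbb{R}/2\pi\mathbb{Z})^2$; functions on it are identified with functions on $\mathbb{R}^2$ that are $2\pi$-periodic in both $x$ and $y$. A dot denotes the time derivative, and $\nabla$ is the gradient in $(x,y)$. For a function $\theta$ on $\mathbb{T}$ with zero average, $\Delta^{-1}\theta$ denotes the zero-average function with Fourier coefficients $\hat\theta(n_1,n_2)/(n_1^2+n_2^2)$ for $(n_1,n_2)\in\mathbb{Z}^2\setminus\{0\}$ (this is the sign convention used in the paper). The zero-average property is preserved by the evolution, so $\zeta$ is well defined at all times. It is a known fact that for every smooth zero-average $\theta_0$ there is a unique smooth solution for all $t\ge 0$; times $t$ are understood to satisfy $t\ge 0$. $\|\nabla\theta(\cdot,t)\|_\infty$ is the supremum over $\mathbb{T}$ of the Euclidean length of $\nabla\theta(\cdot,t)$. *)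

theory Defs
  imports "HOL-Analysis.Analysis"
begin

text \<open>
  Derivatives are taken relative to \<open>S\<close>.  On \<open>{0..} \<times> UNIV\<close> this gives
  one-sided derivatives in the first variable at the boundary; there, as on \<open>UNIV\<close>, the
  derivative at a point is unique, so the choice of \<open>f'\<close> is immaterial.
\<close>

primrec Ck_on :: "nat \<Rightarrow> 'a::real_normed_vector set \<Rightarrow> ('a \<Rightarrow> 'b::real_normed_vector) \<Rightarrow> bool" where
  "Ck_on 0 S f \<longleftrightarrow> continuous_on S f"
| "Ck_on (Suc k) S f \<longleftrightarrow>
     (\<exists>f'. (\<forall>p\<in>S. (f has_derivative f' p) (at p within S)) \<and> (\<forall>v. Ck_on k S (\<lambda>p. f' p v)))"

definition smooth_on :: "'a::real_normed_vector set \<Rightarrow> ('a \<Rightarrow> 'b::real_normed_vector) \<Rightarrow> bool" where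
  "smooth_on S f \<longleftrightarrow> (\<forall>k. Ck_on k S f)"

text \<open>
  Functions on the torus \<open>(\<real> / 2\<pi>\<int>)\<^sup>2\<close> are doubly periodic functions on the plane.
\<close>

definition periodic_2pi :: "(real \<times> real \<Rightarrow> 'b) \<Rightarrow> bool" where
  "periodic_2pi f \<longleftrightarrow> (\<forall>x y. f (x + 2 * pi, y) = f (x, y) \<and> f (x, y + 2 * pi) = f (x, y))"

definition smooth_torus :: "(real \<times> real \<Rightarrow> real) \<Rightarrow> bool" where
  "smooth_torus f \<longleftrightarrow> periodic_2pi f \<and> smooth_on UNIV f"

definition zero_average :: "(real \<times> real \<Rightarrow> real) \<Rightarrow> bool" where
  "zero_average f \<longleftrightarrow> integral (cbox (0, 0) (2 * pi, 2 * pi)) f = 0"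

definition fourier_coeff :: "(real \<times> real \<Rightarrow> real) \<Rightarrow> int \<Rightarrow> int \<Rightarrow> complex" where
  "fourier_coeff f n1 n2 =
     (1 / (2 * pi)\<^sup>2) *\<^sub>R integral (cbox (0, 0) (2 * pi, 2 * pi))
       (\<lambda>(x, y). complex_of_real (f (x, y)) * cis (- (of_int n1 * x + of_int n2 * y)))"

text \<open>
  \<open>is_inv_laplacian \<theta> \<zeta>\<close> says \<open>\<zeta> = \<Delta>\<^sup>-\<^sup>1 \<theta>\<close> in the sign convention with the positive multiplier
  \<open>1 / (n1\<^sup>2 + n2\<^sup>2)\<close>, so that \<open>\<zeta>\<^sub>x\<^sub>x + \<zeta>\<^sub>y\<^sub>y = - \<theta>\<close>.  It is intended for smooth \<open>\<theta>\<close> of zero average,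
  for which exactly one such \<open>\<zeta>\<close> exists; smoothness of \<open>\<zeta>\<close> only excludes other representatives
  with the same Fourier coefficients.
\<close>

definition is_inv_laplacian :: "(real \<times> real \<Rightarrow> real) \<Rightarrow> (real \<times> real \<Rightarrow> real) \<Rightarrow> bool" where
  "is_inv_laplacian \<theta> \<zeta> \<longleftrightarrow>
     smooth_torus \<zeta> \<and> zero_average \<zeta> \<and>
     (\<forall>n1 n2. (n1, n2) \<noteq> (0, 0) \<longrightarrow>
        fourier_coeff \<zeta> n1 n2 = fourier_coeff \<theta> n1 n2 / of_int (n1\<^sup>2 + n2\<^sup>2))"

definition partial_x :: "(real \<times> real \<Rightarrow> real) \<Rightarrow> real \<times> real \<Rightarrow> real" where
  "partial_x f p = deriv (\<lambda>s. f (s, snd p)) (fst p)"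

definition partial_y :: "(real \<times> real \<Rightarrow> real) \<Rightarrow> real \<times> real \<Rightarrow> real" where
  "partial_y f p = deriv (\<lambda>s. f (fst p, s)) (snd p)"

definition grad :: "(real \<times> real \<Rightarrow> real) \<Rightarrow> real \<times> real \<Rightarrow> real \<times> real" where
  "grad f p = (partial_x f p, partial_y f p)"

definition perp_grad :: "(real \<times> real \<Rightarrow> real) \<Rightarrow> real \<times> real \<Rightarrow> real \<times> real" where
  "perp_grad f p = (partial_y f p, - partial_x f p)"

definition grad_sup_norm :: "(real \<times> real \<Rightarrow> real) \<Rightarrow> real" where
  "grad_sup_norm f = (SUP p. norm (grad f p))"

text \<open>
  Global smooth solutions, with \<open>\<theta> t (x, y)\<close> for \<open>\<theta>(x, y, t)\<close>; the values at \<open>t < 0\<close> are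
  irrelevant.
\<close>

definition euler_solution :: "(real \<times> real \<Rightarrow> real) \<Rightarrow> (real \<Rightarrow> real \<times> real \<Rightarrow> real) \<Rightarrow> bool" where
  "euler_solution \<theta>0 \<theta> \<longleftrightarrow>
     smooth_on ({0..} \<times> UNIV) (\<lambda>(t, p). \<theta> t p) \<and>
     (\<forall>t\<ge>0. periodic_2pi (\<theta> t)) \<and>
     \<theta> 0 = \<theta>0 \<and>
     (\<exists>\<zeta>. \<forall>t\<ge>0. is_inv_laplacian (\<theta> t) (\<zeta> t) \<and>
        (\<forall>p. ((\<lambda>s. \<theta> s p) has_real_derivative grad (\<theta> t) p \<bullet> perp_grad (\<zeta> t) p) (at t within {0..})))"

end

theory Submission
  imports Defs
begin

text \<open>
  The vorticity \<open>2 sin x sin y\<close> is a steady state whose flow has a hyperbolic stagnation point at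
  \<open>(\<pi>, \<pi>)\<close>: nearby, \<open>\<theta>\<^sub>t = \<nabla>\<theta> \<cdot> u\<close> reads \<open>\<theta>\<^sub>t = a \<theta>\<^sub>a - b \<theta>\<^sub>b\<close> with \<open>(a, b) = (x - \<pi>, y - \<pi>)\<close>, so profiles
  become \<open>f (a e\<^sup>t, b e\<^sup>-\<^sup>t)\<close>.  It is perturbed by \<open>8 sin (k a) / k\<close> with \<open>k\<close> large.

  Suppose that \<open>\<bar>\<nabla>\<theta>\<bar> \<le> M\<close> up to time \<open>\<tau> = T / 2\<close>, and let \<open>\<psi>\<close> and \<open>\<xi>\<close> be the perturbations of the vorticity and
  of the stream function.  The kinetic energy \<open>\<integral>\<bar>\<nabla>\<xi>\<bar>\<^sup>2\<close> of the perturbation starts at size \<open>k\<^sup>-\<^sup>4\<close> and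
  satisfies \<open>E' \<le> 2 E\<close>, hence stays of that size; then \<open>\<integral>\<psi>\<^sup>2 = \<integral>\<nabla>\<xi> \<cdot> \<nabla>\<psi>\<close> is of size \<open>k\<^sup>-\<^sup>2\<close>.  Now \<open>\<psi>\<close> is tested against
  a bump \<open>\<phi>\<close> of width \<open>1 / k\<close> in \<open>a\<close> and \<open>1 / sqrt k\<close> in \<open>b\<close>, which is carried along by the linearised steady
  flow.  Up to lower order in \<open>k\<close>, the number \<open>\<integral>\<psi>\<phi>\<close> does not change in time, whereas integrating by parts in
  \<open>x\<close> at time \<open>\<tau>\<close> bounds it by a constant times \<open>(M + 2) e\<^sup>-\<^sup>\<tau>\<close> times its initial value.  So \<open>M + 2\<close> is at
  least a constant times \<open>e\<^sup>\<tau>\<close>.  Working with this weak form avoids the flow map and pointwise bounds on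
  the velocity gradient.
\<close>

text \<open>Why the bump is elongated: put k = n^4 and give it width n^(-s) in b. Its initial
  pairing with the ripple has size n^(-8-s). Two errors in the rate of change of the pairing compete
  with this, both estimated in L2. Advection by the perturbation velocity costs the norm of
  \<nabla>\<xi> times that of \<phi>, of size n^(-8) n^(-2-s/2). It is of lower order only for s <
  4, so a round bump of width 1/k would fail. Replacing the steady flow by its linearisation costs
  the norm of \<psi> times that of b^2 \<phi>, of size n^(-4) n^(-2s) n^(-2-s/2), and this requires
  s > 4/3. The choice s = 2 balances the two: both are n^(-11) against n^(-10). Taking k to be a
  fourth power makes these exponents, and those of the weights in Young's inequality, integers.
  Factors exp \<tau> are harmless, because n is chosen after T.\<close>

abbreviation Q2 :: "(real \<times> real) set" where
  "Q2 \<equiv> cbox (0, 0) (2 * pi, 2 * pi)"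

subsection \<open>Smooth functions and partial derivatives\<close>

lemma Ck_on_lincomb:
  fixes f g :: "'a::real_normed_vector \<Rightarrow> 'b::real_normed_vector"
  assumes "Ck_on k S f" "Ck_on k S g"
  shows "Ck_on k S (\<lambda>p. a *\<^sub>R f p + b *\<^sub>R g p)"
  using assms
proof (induction k arbitrary: f g)
  case 0
  then show ?case by (auto intro!: continuous_intros)
next
  case (Suc k)
  obtain f' where f': "\<And>p. p \<in> S \<Longrightarrow> (f has_derivative f' p) (at p within S)"
    "\<And>v. Ck_on k S (\<lambda>p. f' p v)" using Suc.prems(1) by auto
  obtain g' where g': "\<And>p. p \<in> S \<Longrightarrow> (g has_derivative g' p) (at p within S)"
    "\<And>v. Ck_on k S (\<lambda>p. g' p v)" using Suc.prems(2) by auto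
  show ?case unfolding Ck_on.simps
    by (rule exI[of _ "\<lambda>p v. a *\<^sub>R f' p v + b *\<^sub>R g' p v"])
      (auto intro!: derivative_eq_intros f' g' Suc.IH)
qed

text \<open>A directional derivative of a sine wave is a sine wave with the phase moved by
  \<open>pi / 2\<close>. With arbitrary amplitude and phase the family is closed under
  differentiation, so the induction goes through.\<close>

lemma Ck_on_wave:
  "Ck_on k UNIV (\<lambda>p::real \<times> real. c * sin (\<alpha> * fst p + \<beta> * snd p + \<gamma>))"
proof (induction k arbitrary: c \<gamma>)
  case 0
  show ?case by (auto intro!: continuous_intros)
next
  case (Suc k)
  have "Ck_on k UNIV (\<lambda>p. c * (\<alpha> * fst v + \<beta> * snd v) * cos (\<alpha> * fst p + \<beta> * snd p + \<gamma>))"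
    for v :: "real \<times> real"
    using Suc.IH[of "c * (\<alpha> * fst v + \<beta> * snd v)" "\<gamma> + pi / 2"]
    by (simp add: sin_add add.assoc[symmetric])
  moreover have "((\<lambda>p. c * sin (\<alpha> * fst p + \<beta> * snd p + \<gamma>)) has_derivative
      (\<lambda>v. c * (\<alpha> * fst v + \<beta> * snd v) * cos (\<alpha> * fst p + \<beta> * snd p + \<gamma>))) (at p)"
    for p :: "real \<times> real"
    by (auto intro!: derivative_eq_intros simp: algebra_simps)
  ultimately show ?case
    unfolding Ck_on.simps
    by (intro exI[of _ "\<lambda>p v. c * (\<alpha> * fst v + \<beta> * snd v) * cos (\<alpha> * fst p + \<beta> * snd p + \<gamma>)"]) simp
qed

lemma smooth_torus_lincomb:
  assumes "smooth_torus f" "smooth_torus g"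
  shows "smooth_torus (\<lambda>p. a * f p + b * g p)"
  using assms Ck_on_lincomb[of _ UNIV f g a b]
  by (auto simp: smooth_torus_def smooth_on_def periodic_2pi_def)

lemma smooth_torus_diff:
  assumes "smooth_torus f" "smooth_torus g"
  shows "smooth_torus (\<lambda>p. f p - g p)"
  using smooth_torus_lincomb[OF assms, of 1 "-1"] by simp

lemma smooth_torus_wave:
  "smooth_torus (\<lambda>p. c * sin (of_int m * fst p + of_int n * snd p + \<gamma>))"
proof -
  have *: "sin (z + of_int j * (2 * pi)) = sin z" for z :: real and j :: int
    using sin_int_2pin[of j] cos_int_2pin[of j] by (simp add: sin_add mult.commute)
  have "sin (of_int m * (x + 2 * pi) + of_int n * y + \<gamma>) = sin (of_int m * x + of_int n * y + \<gamma>)" for x y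
    using *[of "of_int m * x + of_int n * y + \<gamma>" m] by (simp add: algebra_simps)
  moreover have "sin (of_int m * x + of_int n * (y + 2 * pi) + \<gamma>) = sin (of_int m * x + of_int n * y + \<gamma>)" for x y
    using *[of "of_int m * x + of_int n * y + \<gamma>" n] by (simp add: algebra_simps)
  ultimately show ?thesis
    by (simp add: smooth_torus_def smooth_on_def periodic_2pi_def Ck_on_wave)
qed

lemma has_partial_derivatives:
  fixes f :: "real \<times> real \<Rightarrow> real"
  assumes "(f has_derivative f') (at (x, y))"
  shows "((\<lambda>s. f (s, y)) has_real_derivative f' (1, 0)) (at x)"
    and "((\<lambda>s. f (x, s)) has_real_derivative f' (0, 1)) (at y)"
proof -
  interpret f': bounded_linear f' using assms by (rule has_derivative_bounded_linear)
  have "((\<lambda>s. f (s, y)) has_derivative (\<lambda>h. f' (h, 0))) (at x)"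
    by (rule has_derivative_compose[of "\<lambda>s. (s, y)" "\<lambda>h. (h, 0)", OF _ assms])
      (rule has_derivative_Pair[OF has_derivative_ident has_derivative_const])
  moreover have "(\<lambda>h. f' (h, 0)) = (*) (f' (1, 0))"
  proof
    fix h show "f' (h, 0) = f' (1, 0) * h"
      using f'.scaleR[of h "(1, 0)"] by (simp add: mult.commute)
  qed
  ultimately show "((\<lambda>s. f (s, y)) has_real_derivative f' (1, 0)) (at x)"
    by (simp add: has_field_derivative_def)
  have "((\<lambda>s. f (x, s)) has_derivative (\<lambda>h. f' (0, h))) (at y)"
    by (rule has_derivative_compose[of "\<lambda>s. (x, s)" "\<lambda>h. (0, h)", OF _ assms])
      (rule has_derivative_Pair[OF has_derivative_const has_derivative_ident])
  moreover have "(\<lambda>h. f' (0, h)) = (*) (f' (0, 1))"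
  proof
    fix h show "f' (0, h) = f' (0, 1) * h"
      using f'.scaleR[of h "(0, 1)"] by (simp add: mult.commute)
  qed
  ultimately show "((\<lambda>s. f (x, s)) has_real_derivative f' (0, 1)) (at y)"
    by (simp add: has_field_derivative_def)
qed

lemma smooth_on_partials:
  fixes f :: "real \<times> real \<Rightarrow> real"
  assumes "smooth_on UNIV f"
  shows smooth_on_DERIV_x: "((\<lambda>s. f (s, y)) has_real_derivative partial_x f (x, y)) (at x)"
    and smooth_on_DERIV_y: "((\<lambda>s. f (x, s)) has_real_derivative partial_y f (x, y)) (at y)"
    and smooth_on_partial_x: "smooth_on UNIV (partial_x f)"
    and smooth_on_partial_y: "smooth_on UNIV (partial_y f)"
proof -
  have ck: "Ck_on (Suc k) UNIV f" for k using assms by (simp add: smooth_on_def)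
  have *: "((\<lambda>s. f (s, y)) has_real_derivative partial_x f (x, y)) (at x) \<and>
    ((\<lambda>s. f (x, s)) has_real_derivative partial_y f (x, y)) (at y) \<and>
    partial_x f (x, y) = f' (x, y) (1, 0) \<and> partial_y f (x, y) = f' (x, y) (0, 1)"
    if "\<forall>p. (f has_derivative f' p) (at p)" for x y f'
    using that has_partial_derivatives[of f "f' (x, y)" x y]
    by (auto simp: partial_x_def partial_y_def DERIV_imp_deriv)
  show "((\<lambda>s. f (s, y)) has_real_derivative partial_x f (x, y)) (at x)"
    "((\<lambda>s. f (x, s)) has_real_derivative partial_y f (x, y)) (at y)"
    using ck[of 0] * by auto
  \<comment> \<open>The derivative \<open>f'\<close> supplied for each \<open>k\<close> may depend
    on \<open>k\<close>. By \<open>*\<close> its values in the directions (1, 0) and (0, 1) are the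
    partial derivatives, which do not.\<close>
  have "Ck_on k UNIV (partial_x f) \<and> Ck_on k UNIV (partial_y f)" for k
  proof -
    obtain f' where f': "\<forall>p. (f has_derivative f' p) (at p)" "\<And>v. Ck_on k UNIV (\<lambda>p. f' p v)"
      using ck[of k] by auto
    have "partial_x f = (\<lambda>p. f' p (1, 0))" "partial_y f = (\<lambda>p. f' p (0, 1))"
      using *[OF f'(1)] by auto
    then show ?thesis using f'(2) by simp
  qed
  then show "smooth_on UNIV (partial_x f)" "smooth_on UNIV (partial_y f)"
    by (auto simp: smooth_on_def)
qed

lemma smooth_torus_DERIV:
  assumes "smooth_torus f"
  shows smooth_torus_DERIV_x: "((\<lambda>s. f (s, y)) has_real_derivative partial_x f (x, y)) (at x)"
    and smooth_torus_DERIV_y: "((\<lambda>s. f (x, s)) has_real_derivative partial_y f (x, y)) (at y)"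
  using assms by (simp_all add: smooth_torus_def smooth_on_DERIV_x smooth_on_DERIV_y)

lemma smooth_torus_continuous:
  assumes "smooth_torus f"
  shows "continuous_on S f"
proof -
  have "Ck_on 0 UNIV f" using assms unfolding smooth_torus_def smooth_on_def by blast
  then show ?thesis using continuous_on_subset by auto
qed

lemma smooth_torus_periodic:
  assumes "smooth_torus f"
  shows "f (x + 2 * pi, y) = f (x, y)" "f (x, y + 2 * pi) = f (x, y)"
    "f (2 * pi, y) = f (0, y)" "f (x, 2 * pi) = f (x, 0)"
proof -
  show *: "f (x + 2 * pi, y) = f (x, y)" "f (x, y + 2 * pi) = f (x, y)" for x y
    using assms by (auto simp: smooth_torus_def periodic_2pi_def)
  show "f (2 * pi, y) = f (0, y)" "f (x, 2 * pi) = f (x, 0)"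
    using *(1)[of 0 y] *(2)[of x 0] by auto
qed

lemma smooth_torus_partial_x: "smooth_torus f \<Longrightarrow> smooth_torus (partial_x f)"
  and smooth_torus_partial_y: "smooth_torus f \<Longrightarrow> smooth_torus (partial_y f)"
proof -
  assume f: "smooth_torus f"
  have "((\<lambda>s. f (s, y)) has_real_derivative partial_x f (x + 2 * pi, y)) (at x)" for x y
    using smooth_torus_DERIV_x[OF f, of y "x + 2 * pi"] DERIV_shift[of "\<lambda>s. f (s, y)" _ x "2 * pi"]
    by (simp add: smooth_torus_periodic[OF f])
  moreover have "((\<lambda>s. f (s, y)) has_real_derivative partial_x f (x, y + 2 * pi)) (at x)" for x y
    using smooth_torus_DERIV_x[OF f, of "y + 2 * pi" x] by (simp add: smooth_torus_periodic[OF f])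
  ultimately have "partial_x f (x + 2 * pi, y) = partial_x f (x, y)"
    "partial_x f (x, y + 2 * pi) = partial_x f (x, y)" for x y
    using smooth_torus_DERIV_x[OF f] DERIV_unique by blast+
  then show "smooth_torus (partial_x f)"
    using f by (simp add: smooth_torus_def periodic_2pi_def smooth_on_partial_x)
  have "((\<lambda>s. f (x, s)) has_real_derivative partial_y f (x, y + 2 * pi)) (at y)" for x y
    using smooth_torus_DERIV_y[OF f, of x "y + 2 * pi"] DERIV_shift[of "\<lambda>s. f (x, s)" _ y "2 * pi"]
    by (simp add: smooth_torus_periodic[OF f])
  moreover have "((\<lambda>s. f (x, s)) has_real_derivative partial_y f (x + 2 * pi, y)) (at y)" for x y
    using smooth_torus_DERIV_y[OF f, of "x + 2 * pi" y] by (simp add: smooth_torus_periodic[OF f])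
  ultimately have "partial_y f (x + 2 * pi, y) = partial_y f (x, y)"
    "partial_y f (x, y + 2 * pi) = partial_y f (x, y)" for x y
    using smooth_torus_DERIV_y[OF f] DERIV_unique by blast+
  then show "smooth_torus (partial_y f)"
    using f by (simp add: smooth_torus_def periodic_2pi_def smooth_on_partial_y)
qed

lemma smooth_torus_partial_diff:
  assumes "smooth_torus f" "smooth_torus g"
  shows "partial_x (\<lambda>p. f p - g p) = (\<lambda>p. partial_x f p - partial_x g p)"
    and "partial_y (\<lambda>p. f p - g p) = (\<lambda>p. partial_y f p - partial_y g p)"
proof -
  have "((\<lambda>s. f (s, y) - g (s, y)) has_real_derivative partial_x f (x, y) - partial_x g (x, y)) (at x)" for x y
    by (intro derivative_intros smooth_torus_DERIV_x assms)
  then show "partial_x (\<lambda>p. f p - g p) = (\<lambda>p. partial_x f p - partial_x g p)"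
    by (auto intro!: DERIV_imp_deriv simp: fun_eq_iff partial_x_def[of "\<lambda>p. f p - g p"])
  have "((\<lambda>s. f (x, s) - g (x, s)) has_real_derivative partial_y f (x, y) - partial_y g (x, y)) (at y)" for x y
    by (intro derivative_intros smooth_torus_DERIV_y assms)
  then show "partial_y (\<lambda>p. f p - g p) = (\<lambda>p. partial_y f p - partial_y g p)"
    by (auto intro!: DERIV_imp_deriv simp: fun_eq_iff partial_y_def[of "\<lambda>p. f p - g p"])
qed

definition laplacian :: "(real \<times> real \<Rightarrow> real) \<Rightarrow> real \<times> real \<Rightarrow> real" where
  "laplacian f p = partial_x (partial_x f) p + partial_y (partial_y f) p"

lemma laplacian_diff:
  assumes "smooth_torus f" "smooth_torus g"
  shows "laplacian (\<lambda>p. f p - g p) p = laplacian f p - laplacian g p"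
  using assms
  by (simp add: laplacian_def smooth_torus_partial_diff smooth_torus_partial_x smooth_torus_partial_y)

lemma smooth_torus_laplacian: "smooth_torus f \<Longrightarrow> smooth_torus (laplacian f)"
  using smooth_torus_lincomb[of "partial_x (partial_x f)" "partial_y (partial_y f)" 1 1]
  by (simp add: laplacian_def[abs_def] smooth_torus_partial_x smooth_torus_partial_y)

lemma periodic_2pi_reduce:
  assumes "periodic_2pi f"
  obtains q where "q \<in> Q2" "f q = f p"
proof -
  obtain x y where p: "p = (x, y)" by (cases p)
  have nx: "f (x + real n * (2 * pi), y) = f (x, y)" for n x y
  proof (induction n)
    case (Suc n)
    have "f (x + real n * (2 * pi) + 2 * pi, y) = f (x + real n * (2 * pi), y)"
      using assms by (simp add: periodic_2pi_def)
    with Suc show ?case by (simp add: algebra_simps)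
  qed simp
  have ny: "f (x, y + real n * (2 * pi)) = f (x, y)" for n x y
  proof (induction n)
    case (Suc n)
    have "f (x, y + real n * (2 * pi) + 2 * pi) = f (x, y + real n * (2 * pi))"
      using assms by (simp add: periodic_2pi_def)
    with Suc show ?case by (simp add: algebra_simps)
  qed simp
  have ix: "f (x + of_int j * (2 * pi), y) = f (x, y)" for j x y
  proof (cases "j \<ge> 0")
    case True then show ?thesis using nx[of x "nat j" y] by simp
  next
    case False then show ?thesis using nx[of "x + of_int j * (2 * pi)" "nat (- j)" y] by simp
  qed
  have iy: "f (x, y + of_int j * (2 * pi)) = f (x, y)" for j x y
  proof (cases "j \<ge> 0")
    case True then show ?thesis using ny[of x y "nat j"] by simp
  next
    case False then show ?thesis using ny[of x "y + of_int j * (2 * pi)" "nat (- j)"] by simp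
  qed
  have red: "0 \<le> z + of_int (- \<lfloor>z / (2 * pi)\<rfloor>) * (2 * pi) \<and>
      z + of_int (- \<lfloor>z / (2 * pi)\<rfloor>) * (2 * pi) \<le> 2 * pi" for z :: real
    using floor_divide_lower[of "2 * pi" z] floor_divide_upper[of "2 * pi" z] 
    by (simp add: algebra_simps)
  show ?thesis
  proof (rule that)
    show "(x + of_int (- \<lfloor>x / (2 * pi)\<rfloor>) * (2 * pi), y + of_int (- \<lfloor>y / (2 * pi)\<rfloor>) * (2 * pi)) \<in> Q2"
      using red[of x] red[of y] by (simp only: cbox_Pair_iff mem_box_real simp_thms)
    show "f (x + of_int (- \<lfloor>x / (2 * pi)\<rfloor>) * (2 * pi), y + of_int (- \<lfloor>y / (2 * pi)\<rfloor>) * (2 * pi)) = f p"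
      by (simp only: ix iy p)
  qed
qed

subsection \<open>Integration by parts\<close>

lemma continuous_on_prod_sections:
  fixes f :: "'a::topological_space \<times> 'b::topological_space \<Rightarrow> 'c::topological_space"
  assumes "continuous_on UNIV f"
  shows "continuous_on S (\<lambda>y. f (x, y))" "continuous_on T (\<lambda>x. f (x, y))"
  by (auto intro!: continuous_on_compose2[OF assms] continuous_intros)

text \<open>Only agreement of \<open>P\<close> on opposite edges is assumed, so that the statement
  also covers products with the bump, which is not periodic. The values lie in a Banach space
  because complex exponentials are integrated by parts as well.\<close>

lemma integral_partial_zero:
  fixes P R :: "real \<times> real \<Rightarrow> 'a::banach"
  assumes cont: "continuous_on UNIV R"
  shows integral_partial_x_zero:
    "(\<And>x y. ((\<lambda>s. P (s, y)) has_vector_derivative R (x, y)) (at x)) \<Longrightarrow>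
      (\<And>y. P (2 * pi, y) = P (0, y)) \<Longrightarrow> integral Q2 R = 0"
    and integral_partial_y_zero:
    "(\<And>x y. ((\<lambda>s. P (x, s)) has_vector_derivative R (x, y)) (at y)) \<Longrightarrow>
      (\<And>x. P (x, 2 * pi) = P (x, 0)) \<Longrightarrow> integral Q2 R = 0"
proof -
  have cQ: "continuous_on Q2 R" using cont continuous_on_subset by blast
  have iter: "integral Q2 R = integral {0..2 * pi} (\<lambda>x. integral {0..2 * pi} (\<lambda>y. R (x, y)))"
    using integral_prod_continuous[OF cQ] by simp
  {
    assume d: "\<And>x y. ((\<lambda>s. P (x, s)) has_vector_derivative R (x, y)) (at y)"
      and e: "\<And>x. P (x, 2 * pi) = P (x, 0)"
    have "((\<lambda>y. R (x, y)) has_integral (P (x, 2 * pi) - P (x, 0))) {0..2 * pi}" for x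
      by (rule fundamental_theorem_of_calculus) (auto intro: d has_vector_derivative_at_within)
    then have "integral {0..2 * pi} (\<lambda>y. R (x, y)) = 0" for x using e by (simp add: integral_unique)
    then show "integral Q2 R = 0" using iter by simp
  }
  assume d: "\<And>x y. ((\<lambda>s. P (s, y)) has_vector_derivative R (x, y)) (at x)"
    and e: "\<And>y. P (2 * pi, y) = P (0, y)"
  have "((\<lambda>x. R (x, y)) has_integral (P (2 * pi, y) - P (0, y))) {0..2 * pi}" for y
    by (rule fundamental_theorem_of_calculus) (auto intro: d has_vector_derivative_at_within)
  then have "integral {0..2 * pi} (\<lambda>x. R (x, y)) = 0" for y using e by (simp add: integral_unique)
  moreover have "integral {0..2 * pi} (\<lambda>x. integral {0..2 * pi} (\<lambda>y. R (x, y))) =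
      integral {0..2 * pi} (\<lambda>y. integral {0..2 * pi} (\<lambda>x. R (x, y)))"
    using integral_swap_continuous[of 0 0 "2 * pi" "2 * pi" "\<lambda>x y. R (x, y)"] cQ by simp
  ultimately show "integral Q2 R = 0" using iter by simp
qed

lemma integral_divergence_zero:
  fixes P Px R Ry :: "real \<times> real \<Rightarrow> real"
  assumes "continuous_on UNIV Px" "continuous_on UNIV Ry"
    and "\<And>x y. ((\<lambda>s. P (s, y)) has_real_derivative Px (x, y)) (at x)"
    and "\<And>x y. ((\<lambda>s. R (x, s)) has_real_derivative Ry (x, y)) (at y)"
    and "\<And>y. P (2 * pi, y) = P (0, y)" "\<And>x. R (x, 2 * pi) = R (x, 0)"
  shows "integral Q2 (\<lambda>p. Px p + Ry p) = 0"
proof -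
  have "integral Q2 Px = 0"
    using assms by (intro integral_partial_x_zero[of Px P])
      (auto simp: has_real_derivative_iff_has_vector_derivative[symmetric])
  moreover have "integral Q2 Ry = 0"
    using assms by (intro integral_partial_y_zero[of Ry R])
      (auto simp: has_real_derivative_iff_has_vector_derivative[symmetric])
  moreover have "Px integrable_on Q2" "Ry integrable_on Q2"
    using assms(1,2) continuous_on_subset by (auto intro!: integrable_continuous)
  ultimately show ?thesis by (simp add: integral_add)
qed

subsection \<open>Fourier coefficients\<close>

lemma fourier_coeff_eq:
  "fourier_coeff f m n = (1 / (2 * pi)\<^sup>2) *\<^sub>R
     integral Q2 (\<lambda>p. complex_of_real (f p) * cis (- (of_int m * fst p + of_int n * snd p)))"
  by (simp add: fourier_coeff_def case_prod_beta')

lemma cis_periodic_int: "cis (z + 2 * pi * of_int m) = cis z"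
  by (simp add: cis.ctr complex_eq_iff cos_add sin_add)

lemma fourier_coeff_lincomb:
  fixes f g :: "real \<times> real \<Rightarrow> real"
  assumes "continuous_on Q2 f" "continuous_on Q2 g"
  shows "fourier_coeff (\<lambda>p. a * f p + b * g p) m n = of_real a * fourier_coeff f m n + of_real b * fourier_coeff g m n"
proof -
  define e where "e p = cis (- (of_int m * fst p + of_int n * snd p))" for p :: "real \<times> real"
  have fce: "fourier_coeff h m n = (1 / (2 * pi)\<^sup>2) *\<^sub>R integral Q2 (\<lambda>p. of_real (h p) * e p)" for h
    by (simp add: fourier_coeff_eq e_def)
  have int: "(\<lambda>p. of_real (h p) * e p) integrable_on Q2" if "continuous_on Q2 h" for h :: "real \<times> real \<Rightarrow> real"
    unfolding e_def by (intro integrable_continuous continuous_intros that)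
  have "(\<lambda>p. of_real (a * f p + b * g p) * e p) =
      (\<lambda>p. of_real a * (of_real (f p) * e p) + of_real b * (of_real (g p) * e p))"
    by (simp add: algebra_simps)
  then have "integral Q2 (\<lambda>p. of_real (a * f p + b * g p) * e p) =
      of_real a * integral Q2 (\<lambda>p. of_real (f p) * e p) + of_real b * integral Q2 (\<lambda>p. of_real (g p) * e p)"
    using int[OF assms(1)] int[OF assms(2)]
    by (simp only: integral_add integral_mult_right integrable_on_mult_right)
  then show ?thesis unfolding fce by (simp only: scaleR_add_right mult_scaleR_right)
qed

lemma fourier_coeff_partial:
  assumes f: "smooth_torus f"
  shows fourier_coeff_partial_x: "fourier_coeff (partial_x f) m n = \<i> * of_int m * fourier_coeff f m n"
    and fourier_coeff_partial_y: "fourier_coeff (partial_y f) m n = \<i> * of_int n * fourier_coeff f m n"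
proof -
  define e where "e p = cis (- (of_int m * fst p + of_int n * snd p))" for p :: "real \<times> real"
  have fce: "fourier_coeff h m n = (1 / (2 * pi)\<^sup>2) *\<^sub>R integral Q2 (\<lambda>p. of_real (h p) * e p)" for h
    by (simp add: fourier_coeff_eq e_def)
  have e_per: "e (2 * pi, y) = e (0, y)" "e (x, 2 * pi) = e (x, 0)" for x y
    using cis_periodic_int[of "- (of_int n * y)" "- m"] cis_periodic_int[of "- (of_int m * x)" "- n"]
    by (simp_all add: e_def algebra_simps)
  have ce: "continuous_on S e" for S unfolding e_def by (intro continuous_intros)
  note cf = smooth_torus_continuous[OF f]
    smooth_torus_continuous[OF smooth_torus_partial_x[OF f]]
    smooth_torus_continuous[OF smooth_torus_partial_y[OF f]]
  have int: "(\<lambda>p. of_real (g p) * e p) integrable_on Q2" if "continuous_on Q2 g" for g :: "real \<times> real \<Rightarrow> real"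
    by (intro integrable_continuous continuous_intros that ce)
  have "integral Q2 (\<lambda>p. of_real (partial_x f p) * e p - \<i> * of_int m * (of_real (f p) * e p)) = 0"
  proof (rule integral_partial_x_zero[where P="\<lambda>p. of_real (f p) * e p"])
    show "((\<lambda>s. of_real (f (s, y)) * e (s, y)) has_vector_derivative
        of_real (partial_x f (x, y)) * e (x, y) - \<i> * of_int m * (of_real (f (x, y)) * e (x, y))) (at x)" for x y
    proof -
      have "((\<lambda>s. complex_of_real (f (s, y))) has_vector_derivative of_real (partial_x f (x, y))) (at x)"
        using smooth_torus_DERIV_x[OF f] by (rule has_vector_derivative_of_real)
      moreover have "((\<lambda>s. e (s, y)) has_vector_derivative - \<i> * of_int m * e (x, y)) (at x)"
        unfolding e_def has_vector_derivative_def
        by (auto intro!: derivative_eq_intros simp: scaleR_conv_of_real)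
      ultimately show ?thesis
        using has_vector_derivative_mult by (fastforce simp: algebra_simps)
    qed
  qed (auto intro!: continuous_intros cf ce simp: e_per smooth_torus_periodic(3)[OF f])
  then show "fourier_coeff (partial_x f) m n = \<i> * of_int m * fourier_coeff f m n"
    by (simp add: fce integral_diff int cf integrable_on_mult_right)
  have "integral Q2 (\<lambda>p. of_real (partial_y f p) * e p - \<i> * of_int n * (of_real (f p) * e p)) = 0"
  proof (rule integral_partial_y_zero[where P="\<lambda>p. of_real (f p) * e p"])
    show "((\<lambda>s. of_real (f (x, s)) * e (x, s)) has_vector_derivative
        of_real (partial_y f (x, y)) * e (x, y) - \<i> * of_int n * (of_real (f (x, y)) * e (x, y))) (at y)" for x y
    proof -
      have "((\<lambda>s. complex_of_real (f (x, s))) has_vector_derivative of_real (partial_y f (x, y))) (at y)"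
        using smooth_torus_DERIV_y[OF f] by (rule has_vector_derivative_of_real)
      moreover have "((\<lambda>s. e (x, s)) has_vector_derivative - \<i> * of_int n * e (x, y)) (at y)"
        unfolding e_def has_vector_derivative_def
        by (auto intro!: derivative_eq_intros simp: scaleR_conv_of_real)
      ultimately show ?thesis
        using has_vector_derivative_mult by (fastforce simp: algebra_simps)
    qed
  qed (auto intro!: continuous_intros cf ce simp: e_per smooth_torus_periodic(4)[OF f])
  then show "fourier_coeff (partial_y f) m n = \<i> * of_int n * fourier_coeff f m n"
    by (simp add: fce integral_diff int cf integrable_on_mult_right)
qed

text \<open>
  The powers \<open>K\<^sup>m\<close> concentrate on the small box, where \<open>K \<ge> a\<close>, relative to the complement of \<open>B\<close>, where \<open>K \<le> b < a\<close>.
\<close>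

lemma integral_nonneg_vanishing_powers:
  fixes f K :: "real \<times> real \<Rightarrow> real"
  assumes f: "continuous_on Q2 f" and K: "continuous_on Q2 K"
    and B': "cbox u' v' \<subseteq> B" "B \<subseteq> Q2" "measure lborel (cbox u' v') > 0"
    and Kab: "0 < b" "b < a" "\<And>p. p \<in> cbox u' v' \<Longrightarrow> a \<le> K p"
      "\<And>p. p \<in> Q2 - B \<Longrightarrow> K p \<le> b" "\<And>p. p \<in> Q2 \<Longrightarrow> 0 \<le> K p"
    and \<eta>: "\<eta> > 0" "\<And>p. p \<in> B \<Longrightarrow> \<eta> \<le> f p"
    and zero: "\<And>m. integral Q2 (\<lambda>p. f p * K p ^ m) = 0"
  shows False
proof -
  obtain M where M: "\<And>p. p \<in> Q2 \<Longrightarrow> \<bar>f p\<bar> \<le> M" "M \<ge> 0"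
  proof -
    have "bounded (f ` Q2)" by (intro compact_imp_bounded compact_continuous_image f compact_cbox)
    then obtain M where "\<forall>p\<in>Q2. \<bar>f p\<bar> \<le> M" by (auto simp: bounded_iff)
    then show ?thesis by (intro that[of "max 0 M"]) (meson max.coboundedI2, simp)
  qed
  \<comment> \<open>Outside \<open>B\<close> the product \<open>f * K ^ m\<close> has modulus at
    most \<open>M * b ^ m\<close>. Adding this constant makes the integrand nonnegative on the whole
    square, so its integral dominates the one over the small box. This yields a bound of
    \<open>a ^ m\<close> by a multiple of \<open>b ^ m\<close>, which fails for large
    \<open>m\<close>.\<close>
  define g where "g m p = f p * K p ^ m + M * b ^ m" for m p
  have g_int: "g m integrable_on S" if "S = Q2 \<or> S = cbox u' v'" for m S
  proof -
    have "continuous_on S f" "continuous_on S K" using that f K B' by (meson continuous_on_subset order.trans)+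
    then show ?thesis using that unfolding g_def by (auto intro!: integrable_continuous continuous_intros)
  qed
  have g_nonneg: "0 \<le> g m p" if "p \<in> Q2" for m p
  proof (cases "p \<in> B")
    case True
    then have "0 \<le> f p" using \<eta>(1) \<eta>(2)[of p] by simp
    then show ?thesis using Kab(1) Kab(5)[OF that] M(2) by (simp add: g_def)
  next
    case False
    have "\<bar>f p * K p ^ m\<bar> \<le> M * b ^ m"
      using M(1)[OF that] Kab(4)[of p] Kab(5)[OF that] False that
      by (auto simp: abs_mult intro!: mult_mono power_mono)
    then show ?thesis by (simp add: g_def)
  qed
  have g_lower: "\<eta> * a ^ m \<le> g m p" if "p \<in> cbox u' v'" for m p
  proof -
    have "p \<in> B" using that B'(1) by blast
    then have "0 \<le> f p" "\<eta> \<le> f p" using \<eta>(1) \<eta>(2)[of p] by auto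
    then have "\<eta> * a ^ m \<le> f p * K p ^ m"
      using Kab(1,2) Kab(3)[OF that] by (intro mult_mono power_mono) auto
    moreover have "0 \<le> M * b ^ m" using M Kab by simp
    ultimately show ?thesis by (simp add: g_def)
  qed
  have main: "measure lborel (cbox u' v') * \<eta> * a ^ m \<le> (2 * pi)\<^sup>2 * M * b ^ m" for m
  proof -
    have "measure lborel (cbox u' v') * (\<eta> * a ^ m) = integral (cbox u' v') (\<lambda>_. \<eta> * a ^ m)" by simp
    also have "\<dots> \<le> integral (cbox u' v') (g m)"
      using g_lower g_int by (intro integral_le) auto
    also have "\<dots> \<le> integral Q2 (g m)"
      using g_int g_nonneg B' by (intro integral_subset_le) auto
    also have "\<dots> = integral Q2 (\<lambda>p. f p * K p ^ m) + integral Q2 (\<lambda>_. M * b ^ m)"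
      unfolding g_def by (intro integral_add integrable_continuous continuous_intros f K)
    also have "\<dots> = (2 * pi)\<^sup>2 * M * b ^ m"
      by (simp add: zero content_Pair power2_eq_square)
    finally show ?thesis by (simp add: mult.assoc)
  qed
  have "(\<lambda>m. (2 * pi)\<^sup>2 * M * (b / a) ^ m) \<longlonglongrightarrow> (2 * pi)\<^sup>2 * M * 0"
    using Kab by (intro tendsto_mult tendsto_const LIMSEQ_realpow_zero) auto
  moreover have "measure lborel (cbox u' v') * \<eta> \<le> (2 * pi)\<^sup>2 * M * (b / a) ^ m" for m
    using main[of m] Kab by (simp add: power_divide field_simps)
  ultimately have "measure lborel (cbox u' v') * \<eta> \<le> 0"
    by (metis (no_types, lifting) LIMSEQ_le_const mult_zero_right)
  then show False using B' \<eta> by (simp add: mult_le_0_iff)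
qed

text \<open>Powers of the kernel are trigonometric polynomials. A factor \<open>1 + cos\<close>
  shifts frequencies by one step in either direction, so the induction must carry orthogonality to
  all exponentials \<open>W m n\<close> at once; the conclusion is the case
  \<open>W 0 0\<close>.\<close>

lemma fourier_kernel_orthogonal:
  assumes f: "continuous_on UNIV f" and fc: "\<And>m n. fourier_coeff f m n = 0"
  shows "integral Q2 (\<lambda>p. f p * ((1 + cos (fst p - x0)) / 2 * ((1 + cos (snd p - y0)) / 2)) ^ j) = 0"
proof -
  define W where "W m n p = cis (of_int m * fst p + of_int n * snd p)" for m n and p :: "real \<times> real"
  define Z where "Z g \<longleftrightarrow> continuous_on Q2 g \<and>
    (\<forall>m n. integral Q2 (\<lambda>p. complex_of_real (f p) * g p * W m n p) = 0)" for g
  have cW: "continuous_on S (W m n)" for m n S unfolding W_def by (intro continuous_intros)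
  have cf: "continuous_on Q2 f" using f continuous_on_subset by blast
  have step: "Z (\<lambda>p. g p * of_real ((1 + cos (of_int m * fst p + of_int n * snd p - z)) / 2))" if g: "Z g" for g m n z
    unfolding Z_def
  proof safe
    have cg: "continuous_on Q2 g" using g by (simp add: Z_def)
    then show "continuous_on Q2 (\<lambda>p. g p * of_real ((1 + cos (of_int m * fst p + of_int n * snd p - z)) / 2))"
      by (intro continuous_intros) auto
    fix i j
    have eq: "of_real ((1 + cos (of_int m * fst p + of_int n * snd p - z)) / 2) * W i j p =
       (1 / 2) * W i j p + (cis (- z) / 4) * W (i + m) (j + n) p + (cis z / 4) * W (i - m) (j - n) p" for p
    proof -
      define u where "u = of_int m * fst p + of_int n * snd p"
      have "complex_of_real (cos (u - z)) = (cis (u - z) + cis (z - u)) / 2"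
        by (simp add: complex_eq_iff cos_diff sin_diff)
      also have "cis (u - z) = cis (- z) * cis u" by (simp add: cis_mult)
      also have "cis (z - u) = cis z * cis (- u)" by (simp add: cis_mult)
      finally have c: "complex_of_real (cos (u - z)) = (cis (- z) * cis u + cis z * cis (- u)) / 2" .
      have "W (i + m) (j + n) p = cis u * W i j p" "W (i - m) (j - n) p = cis (- u) * W i j p"
        by (simp_all add: W_def cis_mult u_def algebra_simps)
      then show ?thesis unfolding u_def[symmetric] by (simp add: c field_simps)
    qed
    have i: "(\<lambda>p. complex_of_real (f p) * g p * W m n p) integrable_on Q2" for m n
      by (intro integrable_continuous continuous_intros cf cg cW)
    have zero: "integral Q2 (\<lambda>p. complex_of_real (f p) * g p * W m n p) = 0" for m n
      using g by (simp add: Z_def)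
    have "(\<lambda>p. complex_of_real (f p) * (g p * of_real ((1 + cos (of_int m * fst p + of_int n * snd p - z)) / 2)) * W i j p) =
       (\<lambda>p. (1 / 2) * (complex_of_real (f p) * g p * W i j p)
         + (cis (- z) / 4) * (complex_of_real (f p) * g p * W (i + m) (j + n) p)
         + (cis z / 4) * (complex_of_real (f p) * g p * W (i - m) (j - n) p))" (is "?l = ?r")
    proof
      fix p
      have "?l p = complex_of_real (f p) * g p * (of_real ((1 + cos (of_int m * fst p + of_int n * snd p - z)) / 2) * W i j p)"
        by (simp only: mult_ac)
      also have "\<dots> = ?r p" unfolding eq by (simp only: distrib_left mult_ac)
      finally show "?l p = ?r p" .
    qed
    then show "integral Q2 (\<lambda>p. complex_of_real (f p) * (g p * of_real ((1 + cos (of_int m * fst p + of_int n * snd p - z)) / 2)) * W i j p) = 0"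
      using i zero by (simp only: integral_add integral_mult_right integrable_add integrable_on_mult_right) simp
  qed
  have "Z (\<lambda>p. of_real (((1 + cos (fst p - x0)) / 2 * ((1 + cos (snd p - y0)) / 2)) ^ j))" for j
  proof (induction j)
    case 0
    have "integral Q2 (\<lambda>p. complex_of_real (f p) * W m n p) = 0" for m n
      using fc[of "- m" "- n"] by (simp add: fourier_coeff_eq W_def add.commute)
    then show ?case by (simp add: Z_def)
  next
    case (Suc j)
    from step[OF step[OF Suc, of 1 0 x0], of 0 1 y0] show ?case
      by (simp add: mult_ac)
  qed
  then have "integral Q2 (\<lambda>p. complex_of_real (f p) * of_real (((1 + cos (fst p - x0)) / 2 * ((1 + cos (snd p - y0)) / 2)) ^ j) * W 0 0 p) = 0"
    unfolding Z_def by blast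
  then have "integral Q2 (\<lambda>p. complex_of_real (f p * ((1 + cos (fst p - x0)) / 2 * ((1 + cos (snd p - y0)) / 2)) ^ j)) = 0"
    by (simp add: W_def)
  moreover have "(\<lambda>p. f p * ((1 + cos (fst p - x0)) / 2 * ((1 + cos (snd p - y0)) / 2)) ^ j) integrable_on Q2"
    by (intro integrable_continuous continuous_intros cf) auto
  ultimately show ?thesis
    using integral_linear[OF _ bounded_linear_of_real[where 'a=complex]] by (fastforce simp: o_def)
qed

text \<open>The upper limit \<open>2 * pi - d\<close> matters: two points of the square may differ
  by nearly a full period, where the cosine returns to 1.\<close>

lemma cos_le_cos_of_far:
  assumes "0 \<le> d" "d \<le> pi" "d \<le> \<bar>z\<bar>" "\<bar>z\<bar> \<le> 2 * pi - d"
  shows "cos z \<le> cos d"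
proof (cases "\<bar>z\<bar> \<le> pi")
  case True
  then have "cos \<bar>z\<bar> \<le> cos d" using assms by (intro cos_monotone_0_pi_le) auto
  then show ?thesis by simp
next
  case False
  then have "cos (2 * pi - \<bar>z\<bar>) \<le> cos d" using assms by (intro cos_monotone_0_pi_le) auto
  then show ?thesis by simp
qed

lemma mem_box_Pair: "(x, y) \<in> box (a, c) (b, d) \<longleftrightarrow> (x \<in> {a<..<b} \<and> y \<in> {c<..<d})" for a b c d x y :: real
  by (auto simp: box_def Basis_prod_def)

text \<open>If \<open>f\<close> were positive at the point, a kernel peaked there, raised to high
  powers, would give a positive integral, contrary to \<open>fourier_kernel_orthogonal\<close>. The
  one-sided claim suffices, since it is applied to \<open>f\<close> and to
  \<open>- f\<close>.\<close>

lemma nonpos_at_interior_if_fourier_coeffs_zero: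
  assumes f: "continuous_on UNIV f" and fc: "\<And>m n. fourier_coeff f m n = 0"
    and x0: "0 < x0" "x0 < 2 * pi" and y0: "0 < y0" "y0 < 2 * pi"
  shows "f (x0, y0) \<le> 0"
proof (rule ccontr)
  assume "\<not> f (x0, y0) \<le> 0"
  then have pos: "f (x0, y0) > 0" by simp
  have "continuous (at (x0, y0)) f" using f by (simp add: continuous_on_eq_continuous_at)
  then obtain r where r: "r > 0" "\<And>p. dist p (x0, y0) < r \<Longrightarrow> dist (f p) (f (x0, y0)) < f (x0, y0) / 2"
    using pos unfolding continuous_at_eps_delta by (metis half_gt_zero)
  \<comment> \<open>Below \<open>r / 2\<close>, so that the box of half-width \<open>d\<close> lies
    in the ball where \<open>f\<close> exceeds half its central value. Below the distances to the
    edges, so that the box lies in the square and no point of the square is near a periodic copy of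
    the peak.\<close>
  define d where "d = Min {r / 3, x0 / 2, (2 * pi - x0) / 2, y0 / 2, (2 * pi - y0) / 2, 1}"
  have d: "0 < d" "d < r / 2" "d < x0" "d < 2 * pi - x0" "d < y0" "d < 2 * pi - y0" "d \<le> 1"
    using r x0 y0 unfolding d_def by (auto simp: min_def)
  define b where "b = (1 + cos d) / 2"
  have "cos d < 1" using d cos_monotone_0_pi[of 0 d] pi_gt3 by simp
  moreover have "cos d > 0" using d pi_gt3 by (intro cos_gt_zero) auto
  ultimately have b: "0 < b" "b < 1" by (auto simp: b_def)
  \<comment> \<open>Off the large box only one of the two cosine factors is known to be at most
    \<open>b\<close>, the other being at most 1; on the small box both are at least
    \<open>(1 + cos e) / 2\<close>. Hence \<open>e\<close> has to make the square of the latter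
    exceed \<open>b\<close>.\<close>
  have "((\<lambda>e::real. ((1 + cos e) / 2)\<^sup>2) \<longlongrightarrow> ((1 + cos 0) / 2)\<^sup>2) (at_right 0)"
    by (intro tendsto_intros) auto
  then have "\<forall>\<^sub>F e in at_right 0. ((1 + cos e) / 2)\<^sup>2 > b"
    using b by (intro order_tendstoD(1)[where y="((1 + cos 0) / 2)\<^sup>2"]) auto
  moreover have "\<forall>\<^sub>F e in at_right 0. e \<in> {0<..<d}" using d by (intro eventually_at_right_real) auto
  ultimately have "\<forall>\<^sub>F e in at_right 0. ((1 + cos e) / 2)\<^sup>2 > b \<and> e \<in> {0<..<d}"
    by (rule eventually_conj)
  then obtain e where "((1 + cos e) / 2)\<^sup>2 > b \<and> e \<in> {0<..<d}"
    using eventually_happens'[OF trivial_limit_at_right_real] by blast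
  then have e: "0 < e" "e < d" "((1 + cos e) / 2)\<^sup>2 > b" by auto
  define B where "B = cbox (x0 - d, y0 - d) (x0 + d, y0 + d)"
  define K where "K p = (1 + cos (fst p - x0)) / 2 * ((1 + cos (snd p - y0)) / 2)" for p :: "real \<times> real"
  have half1: "0 \<le> (1 + cos z) / 2" for z :: real
    using cos_double_cos[of "z / 2"] by simp
  have half2: "(1 + cos z) / 2 \<le> 1" for z :: real
    using cos_double_sin[of "z / 2"] by simp
  note half = half1 half2
  show False
  proof (rule integral_nonneg_vanishing_powers[of f K "(x0 - e, y0 - e)" "(x0 + e, y0 + e)" B b "((1 + cos e) / 2)\<^sup>2" "f (x0, y0) / 2"])
    show "continuous_on Q2 f" using f continuous_on_subset by blast
    show "continuous_on Q2 K" unfolding K_def by (intro continuous_intros) auto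
    show "cbox (x0 - e, y0 - e) (x0 + e, y0 + e) \<subseteq> B" using e by (auto simp: B_def)
    show "B \<subseteq> Q2" using d by (auto simp: B_def)
    show "measure lborel (cbox (x0 - e, y0 - e) (x0 + e, y0 + e)) > 0" using e by (simp add: content_Pair)
    show "((1 + cos e) / 2)\<^sup>2 \<le> K p" if "p \<in> cbox (x0 - e, y0 - e) (x0 + e, y0 + e)" for p
    proof -
      have "cos e \<le> cos z" if "\<bar>z\<bar> \<le> e" for z :: real
      proof -
        have "cos e \<le> cos \<bar>z\<bar>" using that e d pi_gt3 by (intro cos_monotone_0_pi_le) auto
        then show ?thesis by simp
      qed
      moreover have "\<bar>fst p - x0\<bar> \<le> e" "\<bar>snd p - y0\<bar> \<le> e" using that by (cases p; auto)+
      ultimately show ?thesis unfolding K_def power2_eq_square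
        using half by (intro mult_mono) auto
    qed
    show "K p \<le> b" if "p \<in> Q2 - B" for p
    proof -
      obtain x y where p: "p = (x, y)" by (cases p)
      have "(1 + cos (x - x0)) / 2 \<le> b \<or> (1 + cos (y - y0)) / 2 \<le> b"
      proof (cases "d \<le> \<bar>x - x0\<bar>")
        case True
        then have "cos (x - x0) \<le> cos d" using d that p pi_gt3 by (intro cos_le_cos_of_far) auto
        then show ?thesis by (simp add: b_def)
      next
        case False
        then have "d \<le> \<bar>y - y0\<bar>" using that p by (auto simp: B_def)
        then have "cos (y - y0) \<le> cos d" using d that p pi_gt3 by (intro cos_le_cos_of_far) auto
        then show ?thesis by (simp add: b_def)
      qed
      then show ?thesis
        using half[of "x - x0"] half[of "y - y0"] mult_left_le[of "(1 + cos (y - y0)) / 2" "(1 + cos (x - x0)) / 2"]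
          mult_left_le[of "(1 + cos (x - x0)) / 2" "(1 + cos (y - y0)) / 2"]
        by (auto simp: K_def p mult.commute)
    qed
    show "f (x0, y0) / 2 \<le> f p" if "p \<in> B" for p
    proof -
      obtain x y where p: "p = (x, y)" by (cases p)
      have "dist p (x0, y0) \<le> \<bar>x - x0\<bar> + \<bar>y - y0\<bar>"
        unfolding p dist_Pair_Pair dist_real_def by (rule sqrt_sum_squares_le_sum_abs[THEN order.trans]) simp
      also have "\<dots> \<le> d + d" using that p by (intro add_mono) (auto simp: B_def)
      finally have "dist p (x0, y0) < r" using d by simp
      from r(2)[OF this] show ?thesis by (simp add: dist_real_def abs_if split: if_splits)
    qed
    show "integral Q2 (\<lambda>p. f p * K p ^ m) = 0" for m
      unfolding K_def by (rule fourier_kernel_orthogonal[OF f fc])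
  qed (use b e half pos in \<open>auto simp: K_def\<close>)
qed

text \<open>The kernel argument works in the interior of the square; continuity then covers its
  edges, and periodicity the rest of the plane.\<close>

lemma fourier_coeffs_zero_imp_zero:
  assumes f: "continuous_on UNIV f" "periodic_2pi f" and fc: "\<And>m n. fourier_coeff f m n = 0"
  shows "f p = 0"
proof -
  have "fourier_coeff (\<lambda>p. - f p) m n = 0" for m n
    using fc[of m n] by (simp add: fourier_coeff_eq)
  moreover have "continuous_on UNIV (\<lambda>p. - f p)" by (intro continuous_intros f)
  ultimately have interior: "f p = 0" if "p \<in> box (0, 0) (2 * pi, 2 * pi)" for p
    using nonpos_at_interior_if_fourier_coeffs_zero[OF f(1) fc, of "fst p" "snd p"]
      nonpos_at_interior_if_fourier_coeffs_zero[of "\<lambda>p. - f p" "fst p" "snd p"] that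
    by (cases p) (simp add: mem_box_Pair)
  obtain q where q: "q \<in> Q2" "f q = f p" using periodic_2pi_reduce[OF f(2)] .
  have "closure (box (0, 0) (2 * pi, 2 * pi)) = Q2"
    using mem_box_Pair[of pi pi 0 0 "2 * pi" "2 * pi"] by (intro closure_box) auto
  moreover have "f q = 0" if "q \<in> closure (box (0, 0) (2 * pi, 2 * pi))"
    by (rule continuous_constant_on_closure[OF _ _ that]) (use interior continuous_on_subset[OF f(1) subset_UNIV] in auto)
  ultimately show ?thesis using q by simp
qed

text \<open>Schwarz's theorem by Fourier uniqueness: either order of differentiation multiplies the
  coefficient by \<open>\<i> * m\<close> and \<open>\<i> * n\<close>.\<close>

lemma partial_xy_commute:
  assumes f: "smooth_torus f"
  shows "partial_x (partial_y f) p = partial_y (partial_x f) p"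
proof -
  note [simp] = smooth_torus_partial_x smooth_torus_partial_y f
  have s: "smooth_torus (\<lambda>p. partial_x (partial_y f) p - partial_y (partial_x f) p)"
    by (intro smooth_torus_diff) auto
  have "fourier_coeff (\<lambda>p. partial_x (partial_y f) p - partial_y (partial_x f) p) m n =
      fourier_coeff (partial_x (partial_y f)) m n - fourier_coeff (partial_y (partial_x f)) m n" for m n
    using fourier_coeff_lincomb[of "partial_x (partial_y f)" "partial_y (partial_x f)" 1 "-1" m n]
    by (simp add: smooth_torus_continuous)
  also have "\<dots> m n = 0" for m n by (simp add: fourier_coeff_partial_x fourier_coeff_partial_y)
  finally have "partial_x (partial_y f) p - partial_y (partial_x f) p = 0"
    using s by (intro fourier_coeffs_zero_imp_zero[of "\<lambda>p. partial_x (partial_y f) p - partial_y (partial_x f) p"])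
      (auto simp: smooth_torus_def smooth_torus_continuous)
  then show ?thesis by simp
qed

text \<open>Turns the Fourier description of the stream function into the pointwise equation used in
  every later integration by parts. At frequency (0, 0), where the multiplier is undefined, the
  coefficient of the Laplacian vanishes as that of a derivative, and the coefficient of \<theta>
  vanishes by its zero average.\<close>

lemma laplacian_inv_laplacian:
  assumes z: "is_inv_laplacian \<theta> \<zeta>" and \<theta>: "continuous_on UNIV \<theta>" "periodic_2pi \<theta>" "zero_average \<theta>"
  shows "laplacian \<zeta> p = - \<theta> p"
proof -
  have s: "smooth_torus \<zeta>" "zero_average \<zeta>"
    and fz: "\<And>m n. (m, n) \<noteq> (0, 0) \<Longrightarrow> fourier_coeff \<zeta> m n = fourier_coeff \<theta> m n / of_int (m\<^sup>2 + n\<^sup>2)"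
    using z by (auto simp: is_inv_laplacian_def)
  note [simp] = smooth_torus_partial_x smooth_torus_partial_y s
  have sl: "smooth_torus (laplacian \<zeta>)" by (simp add: smooth_torus_laplacian)
  have c\<theta>: "continuous_on Q2 \<theta>" using \<theta> continuous_on_subset by blast
  have "fourier_coeff (\<lambda>p. laplacian \<zeta> p + \<theta> p) m n =
      fourier_coeff (partial_x (partial_x \<zeta>)) m n + fourier_coeff (partial_y (partial_y \<zeta>)) m n + fourier_coeff \<theta> m n" for m n
    using fourier_coeff_lincomb[of "partial_x (partial_x \<zeta>)" "partial_y (partial_y \<zeta>)" 1 1 m n]
      fourier_coeff_lincomb[of "laplacian \<zeta>" \<theta> 1 1 m n] c\<theta> sl
    by (simp add: smooth_torus_continuous laplacian_def[abs_def])
  also have "\<dots> m n = 0" for m n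
  proof (cases "(m, n) = (0, 0)")
    case True
    have "integral Q2 (\<lambda>p. complex_of_real (\<theta> p)) = of_real (integral Q2 \<theta>)"
      using integral_linear[OF integrable_continuous[OF c\<theta>] bounded_linear_of_real[where 'a=complex]]
      by (simp add: o_def)
    then show ?thesis using True \<theta>(3)
      by (simp add: fourier_coeff_partial_x fourier_coeff_partial_y fourier_coeff_eq[of \<theta>] zero_average_def)
  next
    case False
    then have nz: "m\<^sup>2 + n\<^sup>2 \<noteq> 0" by (auto simp: sum_power2_eq_zero_iff)
    then have nz': "complex_of_int m * complex_of_int m + complex_of_int n * complex_of_int n \<noteq> 0"
      by (metis of_int_add of_int_eq_0_iff of_int_mult power2_eq_square)
    have "\<i> * c * (\<i> * c * z) = - (c * c * z)" for c z :: complex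
      by (simp add: algebra_simps)
    then show ?thesis using fz[OF False] nz'
      by (simp add: fourier_coeff_partial_x fourier_coeff_partial_y power2_eq_square divide_simps) (simp add: algebra_simps)
  qed
  finally have "fourier_coeff (\<lambda>p. laplacian \<zeta> p + \<theta> p) m n = 0" for m n .
  moreover have "continuous_on UNIV (\<lambda>p. laplacian \<zeta> p + \<theta> p)"
    by (intro continuous_on_add \<theta>(1) smooth_torus_continuous sl)
  moreover have "periodic_2pi (\<lambda>p. laplacian \<zeta> p + \<theta> p)"
    using sl \<theta>(2) by (simp add: smooth_torus_def periodic_2pi_def)
  ultimately have "laplacian \<zeta> p + \<theta> p = 0"
    using fourier_coeffs_zero_imp_zero[of "\<lambda>p. laplacian \<zeta> p + \<theta> p"] by blast
  then show ?thesis by simp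
qed

subsection \<open>The energy of a stream function\<close>

definition energy :: "(real \<times> real \<Rightarrow> real) \<Rightarrow> real" where
  "energy f = integral Q2 (\<lambda>p. (partial_x f p)\<^sup>2 + (partial_y f p)\<^sup>2)"

lemmas smooth_torus_simps = smooth_torus_partial_x smooth_torus_partial_y smooth_torus_laplacian
  smooth_torus_diff smooth_torus_continuous

lemma smooth_torus_continuous_comp:
  assumes "smooth_torus f" "continuous_on S g"
  shows "continuous_on S (\<lambda>x. f (g x))"
  by (rule continuous_on_compose2[OF smooth_torus_continuous[OF assms(1)] assms(2) subset_UNIV])

lemma measure_Q2: "measure lborel Q2 = 4 * pi\<^sup>2"
  by (simp add: content_Pair power2_eq_square)

text \<open>Holds for every \<open>f\<close>, since a non-integrable integrand has integral 0 by
  convention.\<close>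

lemma energy_nonneg: "0 \<le> energy f"
  unfolding energy_def by (cases "(\<lambda>p. (partial_x f p)\<^sup>2 + (partial_y f p)\<^sup>2) integrable_on Q2")
    (auto intro: integral_nonneg simp: not_integrable_integral)

lemma integral_le_continuous:
  fixes f g :: "real \<times> real \<Rightarrow> real"
  assumes "continuous_on Q2 f" "continuous_on Q2 g" "\<And>p. p \<in> Q2 \<Longrightarrow> f p \<le> g p"
  shows "integral Q2 f \<le> integral Q2 g"
  using assms by (intro integral_le integrable_continuous)

lemma integral_add_continuous:
  fixes f g :: "real \<times> real \<Rightarrow> real"
  assumes "continuous_on Q2 f" "continuous_on Q2 g"
  shows "integral Q2 (\<lambda>p. f p + g p) = integral Q2 f + integral Q2 g"
  using assms by (intro integral_add integrable_continuous)

lemma green_identity: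
  assumes "smooth_torus f" "smooth_torus g"
  shows "integral Q2 (\<lambda>p. f p * laplacian g p) =
    - integral Q2 (\<lambda>p. partial_x f p * partial_x g p + partial_y f p * partial_y g p)"
proof -
  note [simp] = smooth_torus_simps assms
  note [derivative_intros] = smooth_torus_DERIV_x[OF assms(1)] smooth_torus_DERIV_y[OF assms(1)]
    smooth_torus_DERIV_x[of "partial_x g"] smooth_torus_DERIV_y[of "partial_y g"]
  have "integral Q2 (\<lambda>p. (partial_x f p * partial_x g p + f p * partial_x (partial_x g) p)
     + (partial_y f p * partial_y g p + f p * partial_y (partial_y g) p)) = 0"
    by (rule integral_divergence_zero[where P="\<lambda>p. f p * partial_x g p" and R="\<lambda>p. f p * partial_y g p"])
      (auto intro!: continuous_intros derivative_eq_intros simp: smooth_torus_periodic)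
  also have "(\<lambda>p. (partial_x f p * partial_x g p + f p * partial_x (partial_x g) p)
     + (partial_y f p * partial_y g p + f p * partial_y (partial_y g) p)) =
     (\<lambda>p. f p * laplacian g p + (partial_x f p * partial_x g p + partial_y f p * partial_y g p))"
    by (simp add: laplacian_def fun_eq_iff algebra_simps)
  finally show ?thesis
    by (subst (asm) integral_add) (auto intro!: integrable_continuous continuous_intros)
qed

text \<open>Polarisation of the quadratic form at \<open>g\<close>, with the cross term moved onto
  the Laplacians by Green's identity. It compares energies when only the vorticities can be
  compared; if the Laplacians agree, the cross term vanishes.\<close>

lemma energy_add:
  assumes "smooth_torus f" "smooth_torus g"
  shows "energy f = energy g - 2 * integral Q2 (\<lambda>p. g p * (laplacian f p - laplacian g p))
    + energy (\<lambda>p. f p - g p)"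
proof -
  note [simp] = smooth_torus_simps assms
  define d where "d p = f p - g p" for p
  have d[simp]: "smooth_torus d" unfolding d_def by simp
  have fx: "partial_x f p = partial_x g p + partial_x d p"
    and fy: "partial_y f p = partial_y g p + partial_y d p" for p
    unfolding d_def by (simp_all add: smooth_torus_partial_diff)
  define u v w where "u p = (partial_x g p)\<^sup>2 + (partial_y g p)\<^sup>2"
    and "v p = partial_x g p * partial_x d p + partial_y g p * partial_y d p"
    and "w p = (partial_x d p)\<^sup>2 + (partial_y d p)\<^sup>2" for p
  have c: "continuous_on Q2 u" "continuous_on Q2 v" "continuous_on Q2 w"
    unfolding u_def v_def w_def by (intro continuous_intros; simp)+
  have "energy f = integral Q2 (\<lambda>p. u p + 2 * v p + w p)"
    unfolding energy_def fx fy u_def v_def w_def by (simp add: power2_sum algebra_simps)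
  also have "\<dots> = integral Q2 u + 2 * integral Q2 v + integral Q2 w"
    using c by (simp add: integral_add_continuous continuous_on_add continuous_on_mult_left)
  finally have "energy f = energy g + 2 * integral Q2 (\<lambda>p. partial_x g p * partial_x d p + partial_y g p * partial_y d p) + energy d"
    by (simp only: energy_def u_def[abs_def] v_def[abs_def] w_def[abs_def])
  also have "integral Q2 (\<lambda>p. partial_x g p * partial_x d p + partial_y g p * partial_y d p) =
      - integral Q2 (\<lambda>p. g p * laplacian d p)"
    by (simp add: green_identity)
  also have "laplacian d = (\<lambda>p. laplacian f p - laplacian g p)"
    unfolding d_def by (rule ext) (simp add: laplacian_diff)
  finally show ?thesis by (simp add: d_def[abs_def])
qed

section \<open>Poincare inequality in L1 and elliptic bounds for the energy\<close>

lemma abs_diff_le_integral_deriv: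
  fixes g :: "real \<Rightarrow> real"
  assumes d: "\<And>s. (g has_real_derivative g' s) (at s)" and c: "continuous_on UNIV g'"
    and "a \<in> {0..L}" "b \<in> {0..L}"
  shows "\<bar>g b - g a\<bar> \<le> integral {0..L} (\<lambda>s. \<bar>g' s\<bar>)"
proof -
  have i: "(\<lambda>s. \<bar>g' s\<bar>) integrable_on {u..v}" for u v
    by (rule integrable_continuous_real[OF continuous_on_subset[OF continuous_on_rabs[OF c] subset_UNIV]])
  have *: "\<bar>g v - g u\<bar> \<le> integral {0..L} (\<lambda>s. \<bar>g' s\<bar>)" if "0 \<le> u" "u \<le> v" "v \<le> L" for u v
  proof -
    have "(g has_vector_derivative g' s) (at s within {u..v})" for s
      using d[of s] has_real_derivative_iff_has_vector_derivative has_vector_derivative_at_within by blast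
    then have "(g' has_integral (g v - g u)) {u..v}"
      using fundamental_theorem_of_calculus[OF that(2)] by blast
    then have "\<bar>g v - g u\<bar> = norm (integral {u..v} g')"
      by (simp only: integral_unique real_norm_def)
    also have "\<dots> \<le> integral {u..v} (\<lambda>s. \<bar>g' s\<bar>)"
      by (rule integral_norm_bound_integral[OF integrable_continuous_real[OF continuous_on_subset[OF c subset_UNIV]] i]) simp
    also have "\<dots> \<le> integral {0..L} (\<lambda>s. \<bar>g' s\<bar>)"
      using that by (intro integral_subset_le[OF _ i i]) auto
    finally show ?thesis .
  qed
  show ?thesis
    using *[of a b] *[of b a] assms(3,4) by (cases "a \<le> b") (auto simp: abs_minus_commute)
qed

text \<open>Zero average makes \<open>f (x, y)\<close> the mean of its differences with all other
  values. Each difference is split along a horizontal and then a vertical segment, and bounded by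
  the integral of the derivative over the full line. Integrating over both points gives the
  claim.\<close>

lemma poincare_L1:
  assumes f: "smooth_torus f" and avg: "zero_average f"
  shows "integral Q2 (\<lambda>p. \<bar>f p\<bar>) \<le> 2 * pi * integral Q2 (\<lambda>p. \<bar>partial_x f p\<bar> + \<bar>partial_y f p\<bar>)"
proof -
  note [simp] = smooth_torus_simps f
  let ?I = "{0..2 * pi}"
  define A where "A y = integral ?I (\<lambda>s. \<bar>partial_x f (s, y)\<bar>)" for y
  define C where "C x = integral ?I (\<lambda>s. \<bar>partial_y f (x, s)\<bar>)" for x
  have cA: "continuous_on S A" for S
    unfolding A_def[abs_def] interval_cbox
    by (rule integral_continuous_on_param)
      (auto simp: case_prod_beta' intro!: continuous_intros smooth_torus_continuous_comp[OF smooth_torus_partial_x[OF f]])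
  have cC: "continuous_on S C" for S
    unfolding C_def[abs_def] interval_cbox
    by (rule integral_continuous_on_param)
      (auto simp: case_prod_beta' intro!: continuous_intros smooth_torus_continuous_comp[OF smooth_torus_partial_y[OF f]])
  have cA2: "continuous_on Q2 (\<lambda>p. A (snd p))" and cC2: "continuous_on Q2 (\<lambda>p. C (fst p))"
    by (auto intro!: continuous_on_compose2[OF cA[of UNIV]] continuous_on_compose2[OF cC[of UNIV]] continuous_intros)
  have iA: "integral ?I A = integral Q2 (\<lambda>p. \<bar>partial_x f p\<bar>)"
  proof -
    have "integral Q2 (\<lambda>p. \<bar>partial_x f p\<bar>) = integral ?I (\<lambda>x. integral ?I (\<lambda>y. \<bar>partial_x f (x, y)\<bar>))"
      using integral_prod_continuous[of 0 0 "2 * pi" "2 * pi" "\<lambda>p. \<bar>partial_x f p\<bar>"]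
      by (simp add: continuous_on_rabs)
    also have "\<dots> = integral ?I (\<lambda>y. integral ?I (\<lambda>x. \<bar>partial_x f (x, y)\<bar>))"
      using integral_swap_continuous[of 0 0 "2 * pi" "2 * pi" "\<lambda>x y. \<bar>partial_x f (x, y)\<bar>"]
      by (simp add: continuous_on_rabs)
    finally show ?thesis by (simp add: A_def[abs_def])
  qed
  have iC: "integral ?I C = integral Q2 (\<lambda>p. \<bar>partial_y f p\<bar>)"
    using integral_prod_continuous[of 0 0 "2 * pi" "2 * pi" "\<lambda>p. \<bar>partial_y f p\<bar>"]
    by (simp add: continuous_on_rabs C_def[abs_def])
  have iC2: "integral Q2 (\<lambda>p. C (fst p)) = 2 * pi * integral ?I C"
    using integral_prod_continuous[OF cC2] by (simp add: mult.commute)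
  have iA2: "integral Q2 (\<lambda>p. A (snd p)) = 2 * pi * integral ?I A"
    using integral_prod_continuous[OF cA2] by (simp add: mult.commute)
  have pt: "4 * pi\<^sup>2 * \<bar>f (x, y)\<bar> \<le> 4 * pi\<^sup>2 * A y + 2 * pi * integral ?I C" if "x \<in> ?I" "y \<in> ?I" for x y
  proof -
    have "4 * pi\<^sup>2 * f (x, y) = integral Q2 (\<lambda>p. f (x, y)) - integral Q2 f"
      using avg by (simp add: zero_average_def measure_Q2[simplified] content_Pair power2_eq_square)
    also have "\<dots> = integral Q2 (\<lambda>p. f (x, y) - f p)"
      by (intro integral_diff[symmetric] integrable_continuous) auto
    finally have "4 * pi\<^sup>2 * \<bar>f (x, y)\<bar> = norm (integral Q2 (\<lambda>p. f (x, y) - f p))"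
      by (metis abs_mult abs_of_nonneg real_norm_def zero_le_mult_iff zero_le_numeral zero_le_power2)
    also have "\<dots> \<le> integral Q2 (\<lambda>p. A y + C (fst p))"
    proof (rule integral_norm_bound_integral)
      show "(\<lambda>p. f (x, y) - f p) integrable_on Q2" "(\<lambda>p. A y + C (fst p)) integrable_on Q2"
        by (auto intro!: integrable_continuous continuous_intros cC2)
      fix p assume p: "p \<in> Q2"
      obtain x' y' where p': "p = (x', y')" by (cases p)
      have "\<bar>f (x, y) - f (x', y)\<bar> \<le> A y"
        unfolding A_def using p p' that
        by (intro abs_diff_le_integral_deriv[of "\<lambda>s. f (s, y)"] smooth_torus_DERIV_x continuous_on_prod_sections) auto
      moreover have "\<bar>f (x', y) - f (x', y')\<bar> \<le> C x'"
        unfolding C_def using p p' that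
        by (intro abs_diff_le_integral_deriv[of "\<lambda>s. f (x', s)"] smooth_torus_DERIV_y continuous_on_prod_sections) auto
      ultimately show "norm (f (x, y) - f p) \<le> A y + C (fst p)" by (simp add: p')
    qed
    also have "\<dots> = integral Q2 (\<lambda>p. A y) + integral Q2 (\<lambda>p. C (fst p))"
      by (intro integral_add integrable_continuous cC2) auto
    also have "\<dots> = 4 * pi\<^sup>2 * A y + 2 * pi * integral ?I C"
      using iC2 by (simp add: content_Pair power2_eq_square)
    finally show ?thesis .
  qed
  have "4 * pi\<^sup>2 * integral Q2 (\<lambda>p. \<bar>f p\<bar>) = integral Q2 (\<lambda>p. 4 * pi\<^sup>2 * \<bar>f p\<bar>)" by simp
  also have "\<dots> \<le> integral Q2 (\<lambda>p. 4 * pi\<^sup>2 * A (snd p) + 2 * pi * integral ?I C)"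
    using pt by (intro integral_le_continuous) (auto intro!: continuous_intros cA2)
  also have "\<dots> = 4 * pi\<^sup>2 * integral Q2 (\<lambda>p. A (snd p)) + 4 * pi\<^sup>2 * (2 * pi * integral ?I C)"
    by (subst integral_add) (auto intro!: integrable_continuous continuous_intros cA2 simp: content_Pair power2_eq_square)
  also have "\<dots> = 4 * pi\<^sup>2 * (2 * pi * (integral ?I A + integral ?I C))"
    unfolding iA2 by (simp add: algebra_simps)
  also have "integral ?I A + integral ?I C = integral Q2 (\<lambda>p. \<bar>partial_x f p\<bar> + \<bar>partial_y f p\<bar>)"
    unfolding iA iC by (intro integral_add[symmetric] integrable_continuous continuous_intros) auto
  finally show ?thesis by simp
qed

text \<open>Plays the role of the Cauchy-Schwarz inequality: Young's inequality with a free weight.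
  For \<open>\<mu>\<close> of the order of the inverse square root of the energy, the right side is
  of the order of its square root.\<close>

lemma integral_grad_L1_le_energy:
  assumes f: "smooth_torus f" and \<mu>: "\<mu> > 0"
  shows "integral Q2 (\<lambda>p. \<bar>partial_x f p\<bar> + \<bar>partial_y f p\<bar>) \<le> \<mu> / 2 * energy f + 4 * pi\<^sup>2 / \<mu>"
proof -
  note [simp] = smooth_torus_simps f
  have young: "\<bar>a\<bar> \<le> \<mu> / 2 * a\<^sup>2 + 1 / (2 * \<mu>)" for a :: real
  proof -
    have "0 \<le> (\<mu> * \<bar>a\<bar> - 1)\<^sup>2 / (2 * \<mu>)" using \<mu> by simp
    also have "\<dots> = \<mu> / 2 * a\<^sup>2 + 1 / (2 * \<mu>) - \<bar>a\<bar>"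
      using \<mu> by (simp add: power2_diff field_simps power2_eq_square)
    finally show ?thesis by simp
  qed
  have "integral Q2 (\<lambda>p. \<bar>partial_x f p\<bar> + \<bar>partial_y f p\<bar>) \<le>
      integral Q2 (\<lambda>p. \<mu> / 2 * ((partial_x f p)\<^sup>2 + (partial_y f p)\<^sup>2) + 1 / \<mu>)"
  proof (rule integral_le_continuous)
    fix p
    show "\<bar>partial_x f p\<bar> + \<bar>partial_y f p\<bar> \<le> \<mu> / 2 * ((partial_x f p)\<^sup>2 + (partial_y f p)\<^sup>2) + 1 / \<mu>"
      using young[of "partial_x f p"] young[of "partial_y f p"] \<mu> by (simp add: algebra_simps)
  qed (auto intro!: continuous_intros)
  also have "\<dots> = integral Q2 (\<lambda>p. \<mu> / 2 * ((partial_x f p)\<^sup>2 + (partial_y f p)\<^sup>2)) + integral Q2 (\<lambda>p. 1 / \<mu>)"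
    by (intro integral_add integrable_continuous continuous_intros) auto
  also have "\<dots> = \<mu> / 2 * energy f + 4 * pi\<^sup>2 / \<mu>"
    by (simp add: energy_def content_Pair power2_eq_square)
  finally show ?thesis .
qed

lemma energy_le_laplacian_sup:
  assumes f: "smooth_torus f" "zero_average f" and c: "c > 0" "\<And>p. p \<in> Q2 \<Longrightarrow> \<bar>laplacian f p\<bar> \<le> c"
  shows "energy f \<le> 32 * pi ^ 4 * c\<^sup>2"
proof -
  note [simp] = smooth_torus_simps f
  have "energy f = - integral Q2 (\<lambda>p. f p * laplacian f p)"
    by (simp add: green_identity energy_def power2_eq_square)
  also have "\<dots> \<le> norm (integral Q2 (\<lambda>p. f p * laplacian f p))" by simp
  also have "\<dots> \<le> integral Q2 (\<lambda>p. c * \<bar>f p\<bar>)"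
    by (rule integral_norm_bound_integral)
      (auto intro!: integrable_continuous continuous_intros mult_right_mono c simp: abs_mult mult.commute[of _ "\<bar>laplacian f _\<bar>"])
  also have "\<dots> = c * integral Q2 (\<lambda>p. \<bar>f p\<bar>)" by simp
  \<comment> \<open>The weight \<open>1 / (2 * pi * c)\<close> makes the energy on the right appear
    with factor 1/2, so that it can be absorbed on the left.\<close>
  also have "\<dots> \<le> c * (2 * pi * (1 / (2 * pi * c) / 2 * energy f + 4 * pi\<^sup>2 / (1 / (2 * pi * c))))"
    using c poincare_L1[OF f] integral_grad_L1_le_energy[OF f(1), of "1 / (2 * pi * c)"]
    by (intro mult_left_mono order.trans[OF poincare_L1[OF f]]) auto
  also have "\<dots> = energy f / 2 + 16 * pi ^ 4 * c\<^sup>2"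
    using c by (simp add: field_simps power2_eq_square power4_eq_xxxx)
  finally show ?thesis by simp
qed

section \<open>Time derivative of the energy of a perturbation\<close>

lemma has_real_derivative_zero_quadratic:
  fixes D :: "real \<Rightarrow> real"
  assumes "\<And>s. s \<in> S \<Longrightarrow> \<bar>D s\<bar> \<le> K * (s - t)\<^sup>2" and "t \<in> S"
  shows "(D has_real_derivative 0) (at t within S)"
proof -
  have "D t = 0" using assms(1)[OF assms(2)] by simp
  have "((\<lambda>s. K * \<bar>s - t\<bar>) \<longlongrightarrow> K * \<bar>t - t\<bar>) (at t within S)" by (intro tendsto_intros)
  then have "((\<lambda>s. K * \<bar>s - t\<bar>) \<longlongrightarrow> 0) (at t within S)" by simp
  moreover have "norm ((D s - D t) / (s - t)) \<le> K * \<bar>s - t\<bar>" if "s \<in> S" "s \<noteq> t" for s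
    using assms(1)[OF that(1)] that(2) \<open>D t = 0\<close>
    by (simp add: abs_divide divide_le_eq power2_eq_square abs_mult[symmetric] mult.assoc)
  ultimately have "((\<lambda>s. (D s - D t) / (s - t)) \<longlongrightarrow> 0) (at t within S)"
    by (elim Lim_null_comparison[rotated]) (auto simp: eventually_at_filter)
  then show ?thesis by (simp add: has_field_derivative_iff)
qed

lemma leibniz_Q2:
  fixes F F' :: "real \<Rightarrow> real \<times> real \<Rightarrow> real"
  assumes "\<And>s p. s \<in> {0..\<tau>} \<Longrightarrow> ((\<lambda>s. F s p) has_real_derivative F' s p) (at s within {0..\<tau>})"
    and "\<And>s. s \<in> {0..\<tau>} \<Longrightarrow> continuous_on Q2 (F s)"
    and "continuous_on ({0..\<tau>} \<times> Q2) (\<lambda>(s, p). F' s p)" and "t \<in> {0..\<tau>}"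
  shows "((\<lambda>s. integral Q2 (F s)) has_real_derivative integral Q2 (F' t)) (at t within {0..\<tau>})"
  using assms by (intro leibniz_rule_field_derivative) (auto intro!: integrable_continuous)

text \<open>
  Nothing is known about the regularity of the stream function in time.  But expanding the quadratic form
  at \<open>\<xi> t\<close> leaves the remainder \<open>energy (\<xi> s - \<xi> t)\<close>, which is \<open>O((s - t)\<^sup>2)\<close> because it is controlled by
  the sup norm of \<open>\<psi> s - \<psi> t\<close>.
\<close>

lemma energy_has_derivative:
  fixes \<xi> \<psi> \<psi>' :: "real \<Rightarrow> real \<times> real \<Rightarrow> real"
  assumes \<xi>: "\<And>t. t \<in> {0..\<tau>} \<Longrightarrow> smooth_torus (\<xi> t)" "\<And>t. t \<in> {0..\<tau>} \<Longrightarrow> zero_average (\<xi> t)"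
    and lap: "\<And>t p. t \<in> {0..\<tau>} \<Longrightarrow> laplacian (\<xi> t) p = - \<psi> t p"
    and \<psi>': "\<And>t p. t \<in> {0..\<tau>} \<Longrightarrow> ((\<lambda>s. \<psi> s p) has_real_derivative \<psi>' t p) (at t within {0..\<tau>})"
    and cont: "continuous_on ({0..\<tau>} \<times> Q2) (\<lambda>(t, p). \<psi>' t p)"
    and t: "t \<in> {0..\<tau>}"
  shows "((\<lambda>s. energy (\<xi> s)) has_real_derivative 2 * integral Q2 (\<lambda>p. \<xi> t p * \<psi>' t p)) (at t within {0..\<tau>})"
proof -
  note [simp] = smooth_torus_simps \<xi>(1)[OF t]
  have \<psi>_eq: "\<psi> s = (\<lambda>p. - laplacian (\<xi> s) p)" if "s \<in> {0..\<tau>}" for s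
    using lap[OF that] by (simp add: fun_eq_iff)
  have c\<psi>: "continuous_on S (\<psi> s)" if "s \<in> {0..\<tau>}" for s S
    unfolding \<psi>_eq[OF that]
    by (intro continuous_on_minus smooth_torus_continuous smooth_torus_laplacian \<xi>(1) that)
  obtain B where B: "B > 0" "\<And>s p. s \<in> {0..\<tau>} \<Longrightarrow> p \<in> Q2 \<Longrightarrow> \<bar>\<psi>' s p\<bar> \<le> B"
  proof -
    have "bounded ((\<lambda>(t, p). \<psi>' t p) ` ({0..\<tau>} \<times> Q2))"
      by (intro compact_imp_bounded compact_continuous_image cont compact_Times compact_cbox compact_Icc)
    then obtain b where b: "b > 0" "\<forall>z\<in>(\<lambda>(t, p). \<psi>' t p) ` ({0..\<tau>} \<times> Q2). norm z \<le> b"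
      unfolding bounded_pos by blast
    show thesis by (rule that[OF b(1)]) (use b(2) in force)
  qed
  have lip: "\<bar>\<psi> s p - \<psi> t p\<bar> \<le> B * \<bar>s - t\<bar>" if "s \<in> {0..\<tau>}" "p \<in> Q2" for s p
  proof -
    have "norm (\<psi> s p - \<psi> t p) \<le> B * norm (s - t)"
      by (rule field_differentiable_bound[where S="{0..\<tau>}" and f'="\<lambda>s. \<psi>' s p"])
        (use \<psi>' B(2)[OF _ that(2)] that(1) t in auto)
    then show ?thesis by simp
  qed
  define G where "G s = integral Q2 (\<lambda>p. \<xi> t p * \<psi> s p)" for s
  define D where "D s = energy (\<lambda>p. \<xi> s p - \<xi> t p)" for s
  have split: "energy (\<xi> s) = energy (\<xi> t) + 2 * (G s - G t) + D s" if s: "s \<in> {0..\<tau>}" for s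
  proof -
    have "integral Q2 (\<lambda>p. \<xi> t p * (laplacian (\<xi> s) p - laplacian (\<xi> t) p)) =
        integral Q2 (\<lambda>p. \<xi> t p * \<psi> t p - \<xi> t p * \<psi> s p)"
      by (intro arg_cong[where f="integral Q2"] ext)
        (simp only: lap[OF s] lap[OF t], simp add: right_diff_distrib)
    also have "\<dots> = G t - G s"
      unfolding G_def by (intro integral_diff integrable_continuous continuous_on_mult c\<psi> s t smooth_torus_continuous \<xi>)
    finally show ?thesis using energy_add[OF \<xi>(1)[OF s] \<xi>(1)[OF t]] by (simp add: D_def)
  qed
  have D: "\<bar>D s\<bar> \<le> 32 * pi ^ 4 * B\<^sup>2 * (s - t)\<^sup>2" if s: "s \<in> {0..\<tau>}" for s
  proof (cases "s = t")
    case True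
    then show ?thesis
      by (simp add: D_def energy_def smooth_torus_partial_diff[OF \<xi>(1)[OF t] \<xi>(1)[OF t], simplified])
  next
    case False
    have "zero_average (\<lambda>p. \<xi> s p - \<xi> t p)"
      using \<xi>(2)[OF s] \<xi>(2)[OF t]
        integral_diff[OF integrable_continuous[OF smooth_torus_continuous[OF \<xi>(1)[OF s]]]
          integrable_continuous[OF smooth_torus_continuous[OF \<xi>(1)[OF t]]]]
      by (simp add: zero_average_def)
    then have "energy (\<lambda>p. \<xi> s p - \<xi> t p) \<le> 32 * pi ^ 4 * (B * \<bar>s - t\<bar>)\<^sup>2"
      using False s B(1) lip[OF s]
      by (intro energy_le_laplacian_sup)
        (simp_all add: laplacian_diff \<xi>(1) lap[OF s] lap[OF t] abs_minus_commute del: atLeastAtMost_iff)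
    then show ?thesis by (simp add: D_def energy_nonneg power_mult_distrib mult.assoc)
  qed
  have G': "(G has_real_derivative integral Q2 (\<lambda>p. \<xi> t p * \<psi>' t p)) (at t within {0..\<tau>})"
    unfolding G_def
  proof (rule leibniz_Q2[where F="\<lambda>s p. \<xi> t p * \<psi> s p" and F'="\<lambda>s p. \<xi> t p * \<psi>' s p"])
    show "continuous_on ({0..\<tau>} \<times> Q2) (\<lambda>(s, p). \<xi> t p * \<psi>' s p)"
      using cont by (auto simp: case_prod_beta' intro!: continuous_intros smooth_torus_continuous_comp)
    show "((\<lambda>s. \<xi> t p * \<psi> s p) has_real_derivative \<xi> t p * \<psi>' s p) (at s within {0..\<tau>})"
      if "s \<in> {0..\<tau>}" for s p
      using \<psi>'[OF that] by (rule DERIV_cmult)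
    show "continuous_on Q2 (\<lambda>p. \<xi> t p * \<psi> s p)" if "s \<in> {0..\<tau>}" for s
      by (intro continuous_intros c\<psi> that) simp
  qed (rule t)
  have "((\<lambda>s. energy (\<xi> t) + 2 * (G s - G t) + D s) has_real_derivative
      2 * integral Q2 (\<lambda>p. \<xi> t p * \<psi>' t p)) (at t within {0..\<tau>})"
    by (auto intro!: derivative_eq_intros G' has_real_derivative_zero_quadratic[OF D t])
  then show ?thesis
    by (rule has_field_derivative_transform_within[OF _ zero_less_one t]) (simp add: split)
qed

text \<open>
  With \<open>w = sin x sin y\<close> and \<open>{f, g} = f\<^sub>x g\<^sub>y - f\<^sub>y g\<^sub>x\<close>, the integrand on the left is \<open>\<xi> {2 w - l, w + \<xi>}\<close>.
  Brackets \<open>{f, g}\<close> integrate to zero, which removes all terms but \<open>l {\<xi>, w}\<close>; the latter is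
  \<open>div (\<nabla>\<xi> {\<xi>, w}) - {\<bar>\<nabla>\<xi>\<bar>\<^sup>2 / 2, w} - (\<xi>\<^sub>x\<^sup>2 - \<xi>\<^sub>y\<^sup>2) w\<^sub>x\<^sub>y\<close>.  The fields \<open>P\<close>, \<open>R\<close> below collect
  the resulting divergence.
\<close>

lemma perturbation_energy_identity:
  assumes \<xi>: "smooth_torus \<xi>"
  defines "l \<equiv> laplacian \<xi>"
  shows "integral Q2 (\<lambda>(x, y). \<xi> (x, y) *
      ((2 * cos x * sin y - partial_x l (x, y)) * (sin x * cos y + partial_y \<xi> (x, y))
       - (2 * sin x * cos y - partial_y l (x, y)) * (cos x * sin y + partial_x \<xi> (x, y)))) =
    - integral Q2 (\<lambda>(x, y). ((partial_x \<xi> (x, y))\<^sup>2 - (partial_y \<xi> (x, y))\<^sup>2) * (cos x * cos y))"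
proof -
  define ax ay where "ax = partial_x \<xi>" and "ay = partial_y \<xi>"
  define axx axy ayy where "axx = partial_x ax" and "axy = partial_y ax" and "ayy = partial_y ay"
  define lx ly where "lx = partial_x l" and "ly = partial_y l"
  have ayx: "partial_x ay = axy"
    using partial_xy_commute[OF \<xi>] by (simp add: fun_eq_iff axy_def ay_def ax_def)
  have s: "smooth_torus ax" "smooth_torus ay" "smooth_torus axx" "smooth_torus axy" "smooth_torus ayy"
    "smooth_torus l" "smooth_torus lx" "smooth_torus ly"
    unfolding ax_def ay_def axx_def axy_def ayy_def lx_def ly_def l_def
    using \<xi> by (simp_all add: smooth_torus_simps)
  have dx: "((\<lambda>s. \<xi> (s, y)) has_real_derivative ax (x, y)) (at x)"
    "((\<lambda>s. ax (s, y)) has_real_derivative axx (x, y)) (at x)"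
    "((\<lambda>s. ay (s, y)) has_real_derivative axy (x, y)) (at x)"
    "((\<lambda>s. l (s, y)) has_real_derivative lx (x, y)) (at x)" for x y
    using smooth_torus_DERIV_x[OF \<xi>, of y x] smooth_torus_DERIV_x[OF s(1), of y x]
      smooth_torus_DERIV_x[OF s(2), of y x] smooth_torus_DERIV_x[OF s(6), of y x]
    by (simp_all add: ax_def axx_def lx_def ayx)
  have dy: "((\<lambda>s. \<xi> (x, s)) has_real_derivative ay (x, y)) (at y)"
    "((\<lambda>s. ax (x, s)) has_real_derivative axy (x, y)) (at y)"
    "((\<lambda>s. ay (x, s)) has_real_derivative ayy (x, y)) (at y)"
    "((\<lambda>s. l (x, s)) has_real_derivative ly (x, y)) (at y)" for x y
    using smooth_torus_DERIV_y[OF \<xi>, of x y] smooth_torus_DERIV_y[OF s(1), of x y]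
      smooth_torus_DERIV_y[OF s(2), of x y] smooth_torus_DERIV_y[OF s(6), of x y]
    by (simp_all add: ay_def axy_def ayy_def ly_def)
  have per: "f (2 * pi, y) = f (0, y)" "f (x, 2 * pi) = f (x, 0)"
    if "smooth_torus f" for f x y using smooth_torus_periodic[OF that] by auto
  note cont = smooth_torus_continuous[OF \<xi>] smooth_torus_continuous[OF s(1)] smooth_torus_continuous[OF s(2)]
    smooth_torus_continuous[OF s(3)] smooth_torus_continuous[OF s(4)] smooth_torus_continuous[OF s(5)]
    smooth_torus_continuous[OF s(6)] smooth_torus_continuous[OF s(7)] smooth_torus_continuous[OF s(8)]
  let ?wx = "\<lambda>p. cos (fst p) * sin (snd p)" and ?wy = "\<lambda>p. sin (fst p) * cos (snd p)"
  let ?wxy = "\<lambda>p. cos (fst p) * cos (snd p)" and ?ws = "\<lambda>p. - (sin (fst p) * sin (snd p))"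
  let ?b = "\<lambda>p. ax p * ?wy p - ay p * ?wx p" and ?n = "\<lambda>p. (ax p)\<^sup>2 + (ay p)\<^sup>2"
  define P where "P p = - (\<xi> p)\<^sup>2 * ?wy p - l p * \<xi> p * ay p - \<xi> p * l p * ?wy p + ax p * ?b p - (1 / 2) * (?n p * ?wy p)" for p
  define R where "R p = (\<xi> p)\<^sup>2 * ?wx p + l p * \<xi> p * ax p + \<xi> p * l p * ?wx p + ay p * ?b p + (1 / 2) * (?n p * ?wx p)" for p
  define Px where "Px p = - (2 * \<xi> p * ax p * ?wy p + (\<xi> p)\<^sup>2 * ?wxy p)
     - (lx p * \<xi> p * ay p + l p * ax p * ay p + l p * \<xi> p * axy p)
     - (ax p * l p * ?wy p + \<xi> p * lx p * ?wy p + \<xi> p * l p * ?wxy p)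
     + axx p * ?b p + ax p * (axx p * ?wy p + ax p * ?wxy p - axy p * ?wx p - ay p * ?ws p)
     - ((2 * ax p * axx p + 2 * ay p * axy p) * ?wy p + ?n p * ?wxy p) / 2" for p
  define Ry where "Ry p = 2 * \<xi> p * ay p * ?wx p + (\<xi> p)\<^sup>2 * ?wxy p
     + (ly p * \<xi> p * ax p + l p * ay p * ax p + l p * \<xi> p * axy p)
     + (ay p * l p * ?wx p + \<xi> p * ly p * ?wx p + \<xi> p * l p * ?wxy p)
     + ayy p * ?b p + ay p * (axy p * ?wy p + ax p * ?ws p - ayy p * ?wx p - ay p * ?wxy p)
     + ((2 * ax p * axy p + 2 * ay p * ayy p) * ?wx p + ?n p * ?wxy p) / 2" for p
  have "integral Q2 (\<lambda>p. Px p + Ry p) = 0"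
  proof (rule integral_divergence_zero)
    show "continuous_on UNIV Px" "continuous_on UNIV Ry"
      unfolding Px_def Ry_def by (intro continuous_intros cont; simp)+
    show "((\<lambda>s. P (s, y)) has_real_derivative Px (x, y)) (at x)" for x y
      unfolding P_def Px_def fst_conv snd_conv
      by (rule derivative_eq_intros dx refl)+ (simp add: field_simps power2_eq_square)
    show "((\<lambda>s. R (x, s)) has_real_derivative Ry (x, y)) (at y)" for x y
      unfolding R_def Ry_def fst_conv snd_conv
      by (rule derivative_eq_intros dy refl)+ (simp add: field_simps power2_eq_square)
    show "P (2 * pi, y) = P (0, y)" for y
      unfolding P_def by (simp add: per \<xi> s)
    show "R (x, 2 * pi) = R (x, 0)" for x
      unfolding R_def by (simp add: per \<xi> s)
  qed
  also have "(\<lambda>p. Px p + Ry p) = (\<lambda>p. \<xi> p * ((2 * ?wx p - lx p) * (?wy p + ay p)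
       - (2 * ?wy p - ly p) * (?wx p + ax p)) + ((ax p)\<^sup>2 - (ay p)\<^sup>2) * ?wxy p)"
  proof
    fix p
    have l: "l p = axx p + ayy p"
      by (simp add: l_def laplacian_def axx_def ayy_def ax_def ay_def)
    show "Px p + Ry p = \<xi> p * ((2 * ?wx p - lx p) * (?wy p + ay p)
       - (2 * ?wy p - ly p) * (?wx p + ax p)) + ((ax p)\<^sup>2 - (ay p)\<^sup>2) * ?wxy p"
      unfolding Px_def Ry_def l by (simp add: field_simps power2_eq_square)
  qed
  finally have "integral Q2 (\<lambda>p. \<xi> p * ((2 * ?wx p - lx p) * (?wy p + ay p)
       - (2 * ?wy p - ly p) * (?wx p + ax p))) + integral Q2 (\<lambda>p. ((ax p)\<^sup>2 - (ay p)\<^sup>2) * ?wxy p) = 0"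
    by (subst (asm) integral_add) (auto intro!: integrable_continuous continuous_intros cont)
  then show ?thesis
    by (simp add: case_prod_beta' ax_def ay_def lx_def ly_def mult.assoc)
qed

text \<open>The strain \<open>cos x * cos y\<close> of the steady flow is at most 1 in modulus. The
  nonlinear terms have cancelled, so the growth rate does not depend on the size of
  \<nabla>\<theta>.\<close>

lemma perturbation_energy_rate:
  assumes \<xi>: "smooth_torus \<xi>"
  shows "integral Q2 (\<lambda>(x, y). \<xi> (x, y) *
      ((2 * cos x * sin y - partial_x (laplacian \<xi>) (x, y)) * (sin x * cos y + partial_y \<xi> (x, y))
       - (2 * sin x * cos y - partial_y (laplacian \<xi>) (x, y)) * (cos x * sin y + partial_x \<xi> (x, y)))) \<le> energy \<xi>"
proof -
  note [simp] = smooth_torus_simps \<xi>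
  have "\<bar>(a\<^sup>2 - b\<^sup>2) * (cos x * cos y)\<bar> \<le> a\<^sup>2 + b\<^sup>2" for a b x y :: real
  proof -
    have "\<bar>a\<^sup>2 - b\<^sup>2\<bar> * (\<bar>cos x\<bar> * \<bar>cos y\<bar>) \<le> (a\<^sup>2 + b\<^sup>2) * (1 * 1)"
      by (intro mult_mono abs_leI) auto
    then show ?thesis by (simp add: abs_mult)
  qed
  then have "norm (integral Q2 (\<lambda>p. ((partial_x \<xi> p)\<^sup>2 - (partial_y \<xi> p)\<^sup>2) * (cos (fst p) * cos (snd p)))) \<le> energy \<xi>"
    unfolding energy_def
    by (intro integral_norm_bound_integral) (auto intro!: integrable_continuous continuous_intros)
  then show ?thesis
    unfolding perturbation_energy_identity[OF \<xi>] by (simp add: case_prod_beta')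
qed

subsection \<open>Solutions of the Euler equation\<close>

lemma Ck_on_slice:
  fixes F :: "'a::real_normed_vector \<times> 'b::real_normed_vector \<Rightarrow> 'c::real_normed_vector"
  assumes "Ck_on k (A \<times> UNIV) F" "t \<in> A"
  shows "Ck_on k UNIV (\<lambda>p. F (t, p))"
  using assms(1)
proof (induction k arbitrary: F)
  case 0
  then show ?case using assms(2)
    by (auto intro!: continuous_on_compose2[where g=F and t="A \<times> UNIV"] continuous_intros)
next
  case (Suc k)
  obtain F' where F': "\<And>z. z \<in> A \<times> UNIV \<Longrightarrow> (F has_derivative F' z) (at z within A \<times> UNIV)"
    "\<And>v. Ck_on k (A \<times> UNIV) (\<lambda>z. F' z v)" using Suc.prems by auto
  have "((\<lambda>p. F (t, p)) has_derivative (\<lambda>v. F' (t, p) (0, v))) (at p)" for p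
  proof (rule has_derivative_in_compose2[where g=F and t="A \<times> UNIV" and f="Pair t"])
    show "(Pair t has_derivative Pair 0) (at p)"
      by (rule has_derivative_Pair[OF has_derivative_const has_derivative_ident])
  qed (use F' assms(2) in auto)
  moreover have "Ck_on k UNIV (\<lambda>p. F' (t, p) (0, v))" for v
    using Suc.IH[OF F'(2)] .
  ultimately show ?case
    unfolding Ck_on.simps by (intro exI[of _ "\<lambda>p v. F' (t, p) (0, v)"]) simp
qed

text \<open>The equation itself gives a time derivative point by point only. Differentiation under
  the integral requires joint continuity in time and space, which comes from smoothness in all
  variables; uniqueness of derivatives later identifies the two.\<close>

lemma smooth_on_time_derivative:
  fixes \<theta> :: "real \<Rightarrow> real \<times> real \<Rightarrow> real"
  assumes "smooth_on ({0..} \<times> UNIV) (\<lambda>(t, p). \<theta> t p)"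
  obtains \<theta>' where "\<And>t p. t \<ge> 0 \<Longrightarrow> ((\<lambda>s. \<theta> s p) has_real_derivative \<theta>' t p) (at t within {0..})"
    and "continuous_on ({0..} \<times> UNIV) (\<lambda>(t, p). \<theta>' t p)"
proof -
  have "Ck_on (Suc 0) ({0..} \<times> UNIV) (\<lambda>(t, p). \<theta> t p)" using assms by (auto simp: smooth_on_def simp del: Ck_on.simps)
  then obtain F' where F': "\<And>z. z \<in> {0..} \<times> UNIV \<Longrightarrow> ((\<lambda>(t, p). \<theta> t p) has_derivative F' z) (at z within {0..} \<times> UNIV)"
    "\<And>v. continuous_on ({0..} \<times> UNIV) (\<lambda>z. F' z v)" by auto
  show ?thesis
  proof (rule that[of "\<lambda>t p. F' (t, p) (1, 0)"])
    show "continuous_on ({0..} \<times> UNIV) (\<lambda>(t, p). F' (t, p) (1, 0))"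
      using F'(2)[of "(1, 0)"] by (simp add: case_prod_beta')
    fix t :: real and p assume t: "t \<ge> 0"
    have "((\<lambda>s. (\<lambda>(t, p). \<theta> t p) (s, p)) has_derivative (\<lambda>h. F' (t, p) (h, 0))) (at t within {0..})"
    proof (rule has_derivative_in_compose2[where g="\<lambda>(t, p). \<theta> t p" and t="{0..} \<times> UNIV" and f="\<lambda>s. (s, p)"])
      show "((\<lambda>s. (s, p)) has_derivative (\<lambda>h. (h, 0))) (at t within {0..})"
        by (rule has_derivative_Pair[OF has_derivative_ident has_derivative_const])
    qed (use F' t in auto)
    moreover have "F' (t, p) (h, 0) = h *\<^sub>R F' (t, p) (1, 0)" for h
      using linear_cmul[OF has_derivative_linear[OF F'(1)[of "(t, p)"]], of h "(1, 0)"] t by simp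
    then have "(\<lambda>h. F' (t, p) (h, 0)) = (*) (F' (t, p) (1, 0))"
      unfolding fun_eq_iff by (metis mult.commute real_scaleR_def)
    ultimately show "((\<lambda>s. \<theta> s p) has_real_derivative F' (t, p) (1, 0)) (at t within {0..})"
      by (simp add: has_field_derivative_def)
  qed
qed

lemma at_within_Ici_neq_bot: "(t::real) \<ge> 0 \<Longrightarrow> at t within {0..} \<noteq> bot"
  by (metis at_le at_within_Icc_at_right bot.extremum_unique dual_order.refl atLeastatMost_subset_iff
      trivial_limit_at_right_real at_within_Ici_at_right atLeast_subset_iff)

text \<open>The velocity is divergence-free, so \<open>\<theta>'\<close> is the divergence of
  \<theta> times the velocity and the mean is conserved. This makes
  \<open>laplacian_inv_laplacian\<close> applicable at every time and not only at time 0.\<close>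

lemma euler_solution_zero_average:
  assumes \<theta>: "\<And>t. t \<ge> 0 \<Longrightarrow> smooth_torus (\<theta> t)" and \<zeta>: "\<And>t. t \<ge> 0 \<Longrightarrow> smooth_torus (\<zeta> t)"
    and d: "\<And>t p. t \<ge> 0 \<Longrightarrow> ((\<lambda>s. \<theta> s p) has_real_derivative \<theta>' t p) (at t within {0..})"
    and c: "continuous_on ({0..} \<times> UNIV) (\<lambda>(t, p). \<theta>' t p)"
    and eq: "\<And>t p. t \<ge> 0 \<Longrightarrow> \<theta>' t p = partial_x (\<theta> t) p * partial_y (\<zeta> t) p - partial_y (\<theta> t) p * partial_x (\<zeta> t) p"
    and "zero_average (\<theta> 0)" and t: "t \<ge> 0"
  shows "zero_average (\<theta> t)"
proof -
  have zero: "integral Q2 (\<theta>' s) = 0" if s: "s \<ge> 0" for s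
  proof -
    note [simp] = smooth_torus_simps \<theta>[OF s] \<zeta>[OF s]
    note [derivative_intros] = smooth_torus_DERIV_x[OF \<theta>[OF s]] smooth_torus_DERIV_y[OF \<theta>[OF s]]
      smooth_torus_DERIV_x[of "partial_y (\<zeta> s)"] smooth_torus_DERIV_y[of "partial_x (\<zeta> s)"]
    have "integral Q2 (\<lambda>p. (partial_x (\<theta> s) p * partial_y (\<zeta> s) p + \<theta> s p * partial_x (partial_y (\<zeta> s)) p)
        + (- (partial_y (\<theta> s) p * partial_x (\<zeta> s) p + \<theta> s p * partial_y (partial_x (\<zeta> s)) p))) = 0"
      by (rule integral_divergence_zero[where P="\<lambda>p. \<theta> s p * partial_y (\<zeta> s) p" and R="\<lambda>p. - (\<theta> s p * partial_x (\<zeta> s) p)"])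
        (auto intro!: continuous_intros derivative_eq_intros simp: smooth_torus_periodic)
    then show ?thesis
      by (simp add: eq[OF s] partial_xy_commute[of "\<zeta> s"] cong: integral_cong)
  qed
  have "((\<lambda>s. integral Q2 (\<theta> s)) has_real_derivative 0) (at s within {0..t})" if s: "s \<in> {0..t}" for s
  proof -
    have "((\<lambda>s. integral Q2 (\<theta> s)) has_real_derivative integral Q2 (\<theta>' s)) (at s within {0..t})"
    proof (rule leibniz_Q2[of t \<theta> \<theta>', OF _ _ _ s])
      show "((\<lambda>s. \<theta> s p) has_real_derivative \<theta>' s p) (at s within {0..t})" if "s \<in> {0..t}" for s p
        using d[of s p] that by (auto intro: DERIV_subset)
      show "continuous_on ({0..t} \<times> Q2) (\<lambda>(s, p). \<theta>' s p)"
        by (rule continuous_on_subset[OF c]) auto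
    qed (use \<theta> smooth_torus_continuous in auto)
    then show ?thesis using zero s by simp
  qed
  then obtain C where "\<And>s. s \<in> {0..t} \<Longrightarrow> integral Q2 (\<theta> s) = C"
    using has_field_derivative_zero_constant[of "{0..t}" "\<lambda>s. integral Q2 (\<theta> s)"] by auto
  then show ?thesis using assms(6) t unfolding zero_average_def by (metis atLeastAtMost_iff order_refl)
qed

lemma euler_solutionE:
  assumes sol: "euler_solution \<theta>0 \<theta>" and avg: "zero_average \<theta>0"
  obtains \<zeta> \<theta>' where "\<And>t. t \<ge> 0 \<Longrightarrow> smooth_torus (\<theta> t)"
    and "continuous_on ({0..} \<times> UNIV) (\<lambda>(t, p). \<theta> t p)"
    and "\<And>t. t \<ge> 0 \<Longrightarrow> smooth_torus (\<zeta> t)" and "\<And>t. t \<ge> 0 \<Longrightarrow> zero_average (\<zeta> t)"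
    and "\<And>t p. t \<ge> 0 \<Longrightarrow> laplacian (\<zeta> t) p = - \<theta> t p"
    and "\<And>t p. t \<ge> 0 \<Longrightarrow> ((\<lambda>s. \<theta> s p) has_real_derivative \<theta>' t p) (at t within {0..})"
    and "continuous_on ({0..} \<times> UNIV) (\<lambda>(t, p). \<theta>' t p)"
    and "\<And>t p. t \<ge> 0 \<Longrightarrow> \<theta>' t p = partial_x (\<theta> t) p * partial_y (\<zeta> t) p - partial_y (\<theta> t) p * partial_x (\<zeta> t) p"
proof -
  have sm: "smooth_on ({0..} \<times> UNIV) (\<lambda>(t, p). \<theta> t p)" and ini: "\<theta> 0 = \<theta>0"
    and per: "\<And>t. t \<ge> 0 \<Longrightarrow> periodic_2pi (\<theta> t)"
    using sol unfolding euler_solution_def by blast+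
  obtain \<zeta> where "\<forall>t\<ge>0. is_inv_laplacian (\<theta> t) (\<zeta> t) \<and>
      (\<forall>p. ((\<lambda>s. \<theta> s p) has_real_derivative grad (\<theta> t) p \<bullet> perp_grad (\<zeta> t) p) (at t within {0..}))"
    using sol unfolding euler_solution_def by blast
  then have \<zeta>: "\<And>t. t \<ge> 0 \<Longrightarrow> is_inv_laplacian (\<theta> t) (\<zeta> t)"
    and eq: "\<And>t p. t \<ge> 0 \<Longrightarrow> ((\<lambda>s. \<theta> s p) has_real_derivative grad (\<theta> t) p \<bullet> perp_grad (\<zeta> t) p) (at t within {0..})"
    by blast+
  obtain \<theta>' where d: "\<And>t p. t \<ge> 0 \<Longrightarrow> ((\<lambda>s. \<theta> s p) has_real_derivative \<theta>' t p) (at t within {0..})"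
    and c: "continuous_on ({0..} \<times> UNIV) (\<lambda>(t, p). \<theta>' t p)" using smooth_on_time_derivative[OF sm] by blast
  have st: "smooth_torus (\<theta> t)" if t: "t \<ge> 0" for t
    unfolding smooth_torus_def smooth_on_def
  proof safe
    show "Ck_on k UNIV (\<theta> t)" for k
      using Ck_on_slice[of k "{0..}" "\<lambda>(t, p). \<theta> t p" t] sm t by (simp add: smooth_on_def)
  qed (rule per[OF t])
  have sz: "smooth_torus (\<zeta> t)" "zero_average (\<zeta> t)" if "t \<ge> 0" for t
    using \<zeta>[OF that] by (auto simp: is_inv_laplacian_def)
  have eq': "\<theta>' t p = partial_x (\<theta> t) p * partial_y (\<zeta> t) p - partial_y (\<theta> t) p * partial_x (\<zeta> t) p" if t: "t \<ge> 0" for t p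
    using has_field_derivative_unique[OF d[OF t] eq[OF t] at_within_Ici_neq_bot[OF t]]
    by (simp add: grad_def perp_grad_def)
  have "Ck_on 0 ({0..} \<times> UNIV) (\<lambda>(t, p). \<theta> t p)"
    using sm unfolding smooth_on_def by blast
  then have ct: "continuous_on ({0..} \<times> UNIV) (\<lambda>(t, p). \<theta> t p)" by simp
  have avg_t: "zero_average (\<theta> t)" if "t \<ge> 0" for t
    using euler_solution_zero_average[OF st sz(1) d c eq' _ that] avg ini by simp
  show ?thesis
  proof (rule that[OF st ct sz(1) sz(2) _ d c eq'])
    show "laplacian (\<zeta> t) p = - \<theta> t p" if "t \<ge> 0" for t p
      using laplacian_inv_laplacian[OF \<zeta>[OF that]] st[OF that] avg_t[OF that] per[OF that]
      by (simp add: smooth_torus_continuous)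
  qed
qed

text \<open>The supremum bounds the values only once they are known to be bounded above; compactness
  of the square and periodicity supply this.\<close>

lemma grad_sup_norm_bound:
  assumes f: "smooth_torus f"
  shows "\<bar>partial_x f p\<bar> \<le> grad_sup_norm f" "\<bar>partial_y f p\<bar> \<le> grad_sup_norm f"
proof -
  note [simp] = smooth_torus_simps f
  have "continuous_on Q2 (\<lambda>p. norm (grad f p))"
    unfolding grad_def by (intro continuous_intros; simp)
  then have "bounded ((\<lambda>p. norm (grad f p)) ` Q2)"
    by (intro compact_imp_bounded compact_continuous_image compact_cbox)
  then obtain B where B: "\<And>p. p \<in> Q2 \<Longrightarrow> norm (grad f p) \<le> B"
    unfolding bounded_iff by fastforce
  have per: "periodic_2pi (grad f)"
    by (simp add: periodic_2pi_def grad_def smooth_torus_periodic)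
  have "norm (grad f p) \<le> B" for p
    using periodic_2pi_reduce[OF per, of p] B by metis
  then have "bdd_above (range (\<lambda>p. norm (grad f p)))" by (auto intro!: bdd_aboveI)
  then have *: "norm (grad f p) \<le> grad_sup_norm f" for p
    unfolding grad_sup_norm_def by (intro cSUP_upper) auto
  have "\<bar>partial_x f p\<bar> \<le> norm (grad f p)" "\<bar>partial_y f p\<bar> \<le> norm (grad f p)"
    by (auto simp: grad_def norm_Pair intro: order.trans[OF real_le_rsqrt])
  then show "\<bar>partial_x f p\<bar> \<le> grad_sup_norm f" "\<bar>partial_y f p\<bar> \<le> grad_sup_norm f"
    using * order.trans by blast+
qed

subsection \<open>A localised test function\<close>

text \<open>A truncated parabola. Its square is already continuously differentiable, which is enough
  for a single integration by parts, and its moments are integrals of polynomials.\<close>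

definition hat :: "real \<Rightarrow> real" where
  "hat x = max 0 (1 - x\<^sup>2)"

lemma hat_nonneg [simp]: "0 \<le> hat x"
  by (simp add: hat_def)

lemma hat_le_1 [simp]: "hat x \<le> 1"
  by (simp add: hat_def)

lemma hat_eq: "\<bar>x\<bar> \<le> 1 \<Longrightarrow> hat x = 1 - x\<^sup>2"
  by (simp add: hat_def abs_square_le_1)

lemma hat_eq_0: "1 \<le> \<bar>x\<bar> \<Longrightarrow> hat x = 0"
  using abs_le_square_iff[of 1 x] by (simp add: hat_def)

lemma hat_square_le: "(hat x)\<^sup>2 \<le> hat x"
  using mult_left_le[OF hat_le_1 hat_nonneg, of x x] by (simp add: power2_eq_square)

lemma continuous_on_hat [continuous_intros]:
  "continuous_on S f \<Longrightarrow> continuous_on S (\<lambda>x. hat (f x))"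
  unfolding hat_def by (intro continuous_intros)

text \<open>From exponent 2 on, the kink of the positive part is smoothed out: near 0 the function
  is O(y^2) and so has derivative 0 there.\<close>

lemma DERIV_pos_part_power:
  "((\<lambda>y. (max 0 y) ^ (m + 2)) has_real_derivative of_nat (m + 2) * (max 0 y) ^ (m + 1)) (at y)"
proof -
  consider "y > 0" | "y < 0" | "y = 0" by linarith
  then show ?thesis
  proof cases
    case 1
    have "((\<lambda>y. y ^ (m + 2)) has_real_derivative of_nat (m + 2) * (max 0 y) ^ (m + 1)) (at y)"
      using DERIV_pow[of "m + 2" y] 1 by (simp add: max_def)
    then show ?thesis
      by (rule has_field_derivative_transform_within_open[where S="{0<..}"]) (use 1 in \<open>auto simp: max_def\<close>)
  next
    case 2
    have "((\<lambda>y. 0) has_real_derivative of_nat (m + 2) * (max 0 y) ^ (m + 1)) (at y)"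
      using 2 by (simp add: max_def)
    then show ?thesis
      by (rule has_field_derivative_transform_within_open[where S="{..<0}"]) (use 2 in \<open>auto simp: max_def\<close>)
  next
    case 3
    have "((\<lambda>y::real. (max 0 y) ^ (m + 2)) has_real_derivative 0) (at 0 within {-1<..<1})"
    proof (rule has_real_derivative_zero_quadratic[where K=1])
      fix s :: real assume "s \<in> {-1<..<1}"
      then have "(max 0 s) ^ m \<le> 1" by (intro power_le_one) auto
      then have "(max 0 s) ^ m * (max 0 s)\<^sup>2 \<le> 1 * s\<^sup>2"
        by (intro mult_mono) (auto simp: max_def)
      then show "\<bar>(max 0 s) ^ (m + 2)\<bar> \<le> 1 * (s - 0)\<^sup>2"
        by (simp only: power_add) simp
    qed simp
    then have "((\<lambda>y::real. (max 0 y) ^ (m + 2)) has_real_derivative 0) (at 0)"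
      by (subst (asm) at_within_open) auto
    then show ?thesis using 3 by simp
  qed
qed

lemma DERIV_hat_power:
  assumes "(f has_real_derivative f') (at x)"
  shows "((\<lambda>x. (hat (f x)) ^ (m + 2)) has_real_derivative
    - (2 * of_nat (m + 2) * f x * (hat (f x)) ^ (m + 1) * f')) (at x)"
proof -
  have "((\<lambda>x. 1 - (f x)\<^sup>2) has_real_derivative - (2 * f x * f')) (at x)"
    by (auto intro!: derivative_eq_intros assms)
  from DERIV_chain2[OF DERIV_pos_part_power[of m] this] show ?thesis
    unfolding hat_def by (rule DERIV_cong) (simp add: algebra_simps)
qed

lemma DERIV_hat_square:
  assumes "(f has_real_derivative f') (at x)"
  shows "((\<lambda>x. (hat (f x))\<^sup>2) has_real_derivative - (4 * f x * hat (f x) * f')) (at x)"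
  using DERIV_hat_power[OF assms, of 0] by (simp add: power2_eq_square)

lemma DERIV_hat_cube:
  assumes "(f has_real_derivative f') (at x)"
  shows "((\<lambda>x. (hat (f x)) ^ 3) has_real_derivative - (6 * f x * (hat (f x))\<^sup>2 * f')) (at x)"
  using DERIV_hat_power[OF assms, of 1] by (simp add: numeral_eq_Suc)

text \<open>\<open>f\<close> is a polynomial \<open>q\<close>, with primitive \<open>F\<close>, cut
  off outside [-1, 1]. For \<open>c \<ge> 1\<close> the support of the rescaled function lies within
  one period, so nothing is lost at the edges.\<close>

lemma has_integral_scaled_bump:
  fixes f F q :: "real \<Rightarrow> real"
  assumes F: "\<And>z. (F has_real_derivative q z) (at z)"
    and f: "\<And>z. \<bar>z\<bar> \<le> 1 \<Longrightarrow> f z = q z" "\<And>z. \<bar>z\<bar> > 1 \<Longrightarrow> f z = 0" and c: "c \<ge> 1"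
  shows "integral {0..2 * pi} (\<lambda>x. f (c * (x - pi))) = (F 1 - F (- 1)) / c"
proof -
  let ?I = "{pi - 1 / c..pi + 1 / c}"
  have I: "x \<in> ?I \<longleftrightarrow> \<bar>c * (x - pi)\<bar> \<le> 1" for x
  proof -
    have "\<bar>c * (x - pi)\<bar> \<le> 1 \<longleftrightarrow> \<bar>x - pi\<bar> \<le> 1 / c"
      using c by (simp only: abs_mult pos_le_divide_eq mult.commute) (simp add: mult.commute)
    also have "\<dots> \<longleftrightarrow> x \<in> ?I" by auto
    finally show ?thesis ..
  qed
  have d: "((\<lambda>x. F (c * (x - pi)) / c) has_real_derivative q (c * (x - pi))) (at x)" for x
    using c by (auto intro!: derivative_eq_intros DERIV_chain2[OF F])
  have "((\<lambda>x. q (c * (x - pi))) has_integral (F (c * (pi + 1 / c - pi)) / c - F (c * (pi - 1 / c - pi)) / c)) ?I"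
  proof (rule fundamental_theorem_of_calculus)
    show "((\<lambda>x. F (c * (x - pi)) / c) has_vector_derivative q (c * (x - pi))) (at x within ?I)" for x
      using d[of x] has_real_derivative_iff_has_vector_derivative has_vector_derivative_at_within by blast
  qed (use c in auto)
  then have "((\<lambda>x. q (c * (x - pi))) has_integral (F 1 - F (- 1)) / c) ?I"
    using c by (simp add: diff_divide_distrib)
  then have "((\<lambda>x. f (c * (x - pi))) has_integral (F 1 - F (- 1)) / c) ?I"
    by (rule has_integral_eq[rotated]) (use I f(1) in auto)
  then have "((\<lambda>x. f (c * (x - pi))) has_integral (F 1 - F (- 1)) / c) {0..2 * pi}"
  proof (rule has_integral_on_superset)
    show "f (c * (x - pi)) = 0" if "x \<notin> ?I" for x
      using that I[of x] f(2)[of "c * (x - pi)"] by linarith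
    have "1 / c \<le> 1" using c by simp
    then show "?I \<subseteq> {0..2 * pi}" using pi_gt3 by auto
  qed
  then show ?thesis by (rule integral_unique)
qed

text \<open>The numbers 16/15 here, and 32/35 and 16/105 below, are the integrals over [-1, 1] of (1
  - z^2)^2, (1 - z^2)^3 and z^2 (1 - z^2)^2.\<close>

lemma integral_hat_square:
  "c \<ge> 1 \<Longrightarrow> integral {0..2 * pi} (\<lambda>x. (hat (c * (x - pi)))\<^sup>2) = 16 / (15 * c)"
  by (subst has_integral_scaled_bump[where F="\<lambda>z. z - 2 * z ^ 3 / 3 + z ^ 5 / 5" and q="\<lambda>z. 1 - 2 * z\<^sup>2 + z ^ 4" and f="\<lambda>z. (hat z)\<^sup>2"])
    (auto intro!: derivative_eq_intros simp: hat_eq hat_eq_0 power2_eq_square field_simps eval_nat_numeral)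

lemma integral_hat_cube:
  "c \<ge> 1 \<Longrightarrow> integral {0..2 * pi} (\<lambda>x. (hat (c * (x - pi))) ^ 3) = 32 / (35 * c)"
  by (subst has_integral_scaled_bump[where F="\<lambda>z. z - z ^ 3 + 3 * z ^ 5 / 5 - z ^ 7 / 7" and q="\<lambda>z. 1 - 3 * z\<^sup>2 + 3 * z ^ 4 - z ^ 6" and f="\<lambda>z. (hat z) ^ 3"])
    (auto intro!: derivative_eq_intros simp: hat_eq hat_eq_0 power2_eq_square field_simps eval_nat_numeral)

lemma integral_square_hat_square:
  "c \<ge> 1 \<Longrightarrow> integral {0..2 * pi} (\<lambda>x. (c * (x - pi))\<^sup>2 * (hat (c * (x - pi)))\<^sup>2) = 16 / (105 * c)"
  by (subst has_integral_scaled_bump[where F="\<lambda>z. z ^ 3 / 3 - 2 * z ^ 5 / 5 + z ^ 7 / 7" and q="\<lambda>z. z\<^sup>2 - 2 * z ^ 4 + z ^ 6" and f="\<lambda>z. z\<^sup>2 * (hat z)\<^sup>2"])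
    (auto intro!: derivative_eq_intros simp: hat_eq hat_eq_0 power2_eq_square field_simps eval_nat_numeral)

lemma integral_Q2_product:
  fixes p q :: "real \<Rightarrow> real"
  assumes "continuous_on UNIV p" "continuous_on UNIV q"
  shows "integral Q2 (\<lambda>z. p (fst z) * q (snd z)) = integral {0..2 * pi} p * integral {0..2 * pi} q"
proof -
  have "continuous_on Q2 (\<lambda>z. p (fst z) * q (snd z))"
    by (intro continuous_intros continuous_on_compose2[OF assms(1)] continuous_on_compose2[OF assms(2)]) auto
  from integral_prod_continuous[OF this] show ?thesis by simp
qed

section \<open>Elementary bounds for sine and cosine near the stagnation point\<close>

lemma one_minus_cos_le: "1 - cos b \<le> b\<^sup>2 / 2" for b :: real
proof -
  have "(sin (b / 2))\<^sup>2 \<le> (b / 2)\<^sup>2"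
    using abs_sin_x_le_abs_x[of "b / 2"] by (simp only: abs_le_square_iff)
  then show ?thesis using cos_double_sin[of "b / 2"] by (simp add: power_divide)
qed

lemma abs_diff_sin_le: "\<bar>a - sin a\<bar> \<le> \<bar>a\<bar> * a\<^sup>2 / 2" for a :: real
proof -
  have pos: "\<bar>a - sin a\<bar> \<le> \<bar>a\<bar> * a\<^sup>2 / 2" if a: "a > 0" for a :: real
  proof -
    have "\<exists>z. 0 < z \<and> z < a \<and> (a - sin a) - (0 - sin 0) = (a - 0) * (1 - cos z)"
      using a by (intro MVT2[of 0 a "\<lambda>x. x - sin x" "\<lambda>x. 1 - cos x"]) (auto intro!: derivative_eq_intros)
    then obtain z where z: "0 < z" "z < a" "a - sin a = a * (1 - cos z)" by auto
    have "z\<^sup>2 \<le> a\<^sup>2" using z by (intro power_mono) auto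
    then have "1 - cos z \<le> a\<^sup>2 / 2" using one_minus_cos_le[of z] by simp
    moreover have "0 \<le> 1 - cos z" by simp
    ultimately have "\<bar>a * (1 - cos z)\<bar> \<le> a * (a\<^sup>2 / 2)"
      using a by (simp add: abs_mult mult_left_mono)
    then show ?thesis using z a by simp
  qed
  consider "a > 0" | "a < 0" | "a = 0" by linarith
  then show ?thesis
    using pos[of a] pos[of "- a"] by cases (auto simp: abs_minus_commute)
qed

lemma abs_diff_sin_cos_le: "\<bar>a - sin a * cos b\<bar> \<le> \<bar>a\<bar> * (a\<^sup>2 + b\<^sup>2) / 2" for a b :: real
proof -
  have "a - sin a * cos b = (a - sin a) + sin a * (1 - cos b)" by (simp add: algebra_simps)
  also have "\<bar>\<dots>\<bar> \<le> \<bar>a - sin a\<bar> + \<bar>sin a\<bar> * (1 - cos b)"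
    by (rule order.trans[OF abs_triangle_ineq]) (simp add: abs_mult)
  also have "\<dots> \<le> \<bar>a\<bar> * a\<^sup>2 / 2 + \<bar>a\<bar> * (b\<^sup>2 / 2)"
    by (intro add_mono mult_mono abs_diff_sin_le abs_sin_x_le_abs_x one_minus_cos_le) auto
  finally show ?thesis by (simp add: algebra_simps)
qed

lemma mult_sin_ge: "z * sin z \<ge> z\<^sup>2 / 2" if "\<bar>z\<bar> \<le> 1" for z :: real
proof -
  have "z * (z - sin z) \<le> \<bar>z\<bar> * \<bar>z - sin z\<bar>" by (simp flip: abs_mult)
  also have "\<dots> \<le> \<bar>z\<bar> * (\<bar>z\<bar> * z\<^sup>2 / 2)" by (intro mult_left_mono abs_diff_sin_le) auto
  also have "\<dots> = z\<^sup>2 * z\<^sup>2 / 2" by (simp add: power2_eq_square)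
  also have "\<dots> \<le> z\<^sup>2 / 2"
    using mult_left_mono[of "z\<^sup>2" 1 "z\<^sup>2"] that by (simp add: abs_square_le_1)
  finally show ?thesis by (simp add: algebra_simps power2_eq_square)
qed

text \<open>Odd in \<open>X\<close>, like the sine that it is to detect, and up to the factor
  \<open>- 1 / (6 * c)\<close> the x-derivative of \<open>(hat X) ^ 3 * (hat Y)\<^sup>2\<close>.
  Hence it has an explicit primitive in x that is again localised.\<close>

definition bump :: "real \<Rightarrow> real \<Rightarrow> real \<times> real \<Rightarrow> real" where
  "bump c d p = (let X = c * (fst p - pi); Y = d * (snd p - pi) in X * (hat X)\<^sup>2 * (hat Y)\<^sup>2)"

definition bump_x :: "real \<Rightarrow> real \<Rightarrow> real \<times> real \<Rightarrow> real" where
  "bump_x c d p = (let X = c * (fst p - pi); Y = d * (snd p - pi)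
     in c * ((hat X)\<^sup>2 - 4 * X\<^sup>2 * hat X) * (hat Y)\<^sup>2)"

definition bump_y :: "real \<Rightarrow> real \<Rightarrow> real \<times> real \<Rightarrow> real" where
  "bump_y c d p = (let X = c * (fst p - pi); Y = d * (snd p - pi)
     in - (4 * d * Y * hat Y * X * (hat X)\<^sup>2))"

text \<open>
  The derivative in \<open>t\<close> when \<open>c\<close> grows like \<open>exp t\<close> and \<open>d\<close> decays like \<open>exp (- t)\<close>, see \<open>DERIV_bump_t\<close>.
\<close>

definition bump_t :: "real \<Rightarrow> real \<Rightarrow> real \<times> real \<Rightarrow> real" where
  "bump_t c d p = (let X = c * (fst p - pi); Y = d * (snd p - pi)
     in X * ((hat X)\<^sup>2 - 4 * X\<^sup>2 * hat X) * (hat Y)\<^sup>2 + 4 * Y\<^sup>2 * hat Y * X * (hat X)\<^sup>2)"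

lemma DERIV_bump_x: "((\<lambda>s. bump c d (s, y)) has_real_derivative bump_x c d (x, y)) (at x)"
proof -
  have "((\<lambda>s. c * (s - pi)) has_real_derivative c) (at x)" by (auto intro!: derivative_eq_intros)
  from DERIV_cmult_right[OF DERIV_mult[OF this DERIV_hat_square[OF this]], of "(hat (d * (y - pi)))\<^sup>2"]
  show ?thesis
    unfolding bump_def bump_x_def Let_def fst_conv snd_conv
    by (rule DERIV_cong) (simp add: algebra_simps power2_eq_square)
qed

lemma DERIV_bump_y: "((\<lambda>s. bump c d (x, s)) has_real_derivative bump_y c d (x, y)) (at y)"
proof -
  have "((\<lambda>s. d * (s - pi)) has_real_derivative d) (at y)" by (auto intro!: derivative_eq_intros)
  from DERIV_cmult[OF DERIV_hat_square[OF this], of "c * (x - pi) * (hat (c * (x - pi)))\<^sup>2"]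
  show ?thesis
    unfolding bump_def bump_y_def Let_def fst_conv snd_conv
    by (rule DERIV_cong) (simp add: algebra_simps)
qed

lemma DERIV_bump_t:
  "((\<lambda>t. bump (c * exp t) (d * exp (- t)) p) has_real_derivative bump_t (c * exp t) (d * exp (- t)) p) (at t)"
proof -
  have X: "((\<lambda>t. c * exp t * (fst p - pi)) has_real_derivative c * exp t * (fst p - pi)) (at t)"
    by (auto intro!: derivative_eq_intros)
  have Y: "((\<lambda>t. d * exp (- t) * (snd p - pi)) has_real_derivative - (d * exp (- t) * (snd p - pi))) (at t)"
    by (auto intro!: derivative_eq_intros)
  from DERIV_mult[OF DERIV_mult[OF X DERIV_hat_square[OF X]] DERIV_hat_square[OF Y]] show ?thesis
    unfolding bump_def bump_t_def Let_def
    by (rule DERIV_cong) (simp add: algebra_simps power2_eq_square)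
qed

lemma continuous_on_bump [continuous_intros]:
  assumes "continuous_on S c" "continuous_on S d" "continuous_on S p"
  shows "continuous_on S (\<lambda>z. bump (c z) (d z) (p z))"
    "continuous_on S (\<lambda>z. bump_x (c z) (d z) (p z))"
    "continuous_on S (\<lambda>z. bump_y (c z) (d z) (p z))"
    "continuous_on S (\<lambda>z. bump_t (c z) (d z) (p z))"
  unfolding bump_def bump_x_def bump_y_def bump_t_def Let_def
  by (intro continuous_intros assms)+

text \<open>Measures how far the dilation a, -b is from the true steady velocity. The difference is
  cubic in the distance to the stagnation point, and the derivative of the bump costs one factor
  \<open>c\<close> or \<open>d\<close>, so a square of the widths remains. The profile
  \<open>hat * hat\<close> is kept on the right so that the L2 norm of the residual also carries the
  small area of the support.\<close>

lemma bump_transport_residual: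
  assumes c: "c > 0" and d: "d > 0"
  shows "\<bar>bump_t c d (x, y) - (bump_x c d (x, y) * (sin x * cos y) - bump_y c d (x, y) * (cos x * sin y))\<bar>
    \<le> 4 * (1 / c\<^sup>2 + 1 / d\<^sup>2) * (hat (c * (x - pi)) * hat (d * (y - pi)))" (is "\<bar>?R\<bar> \<le> _")
proof -
  define a b where "a = x - pi" and "b = y - pi"
  define X Y where "X = c * a" and "Y = d * b"
  \<comment> \<open>A shift of both arguments by \<open>pi\<close> changes two signs in each
    product, so the stagnation point may be placed at the origin.\<close>
  have trig: "sin x * cos y = sin a * cos b" "cos x * sin y = cos a * sin b"
    by (simp_all add: a_def b_def sin_diff cos_diff)
  define f1 where "f1 = (hat X)\<^sup>2 - 4 * X\<^sup>2 * hat X"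
  have R: "?R = c * (a - sin a * cos b) * f1 * (hat Y)\<^sup>2 + d * (b - sin b * cos a) * (4 * Y * hat Y) * (X * (hat X)\<^sup>2)"
    unfolding trig by (simp add: bump_t_def bump_x_def bump_y_def Let_def a_def[symmetric] b_def[symmetric]
        X_def[symmetric] Y_def[symmetric] f1_def) (simp add: X_def Y_def algebra_simps power2_eq_square)
  show ?thesis
  proof (cases "\<bar>X\<bar> < 1 \<and> \<bar>Y\<bar> < 1")
    case False
    then have "hat X = 0 \<or> hat Y = 0" using hat_eq_0 by force
    then show ?thesis unfolding R using c d by (auto simp: f1_def)
  next
    case True
    define r where "r = (a\<^sup>2 + b\<^sup>2) / 2"
    have X2: "X\<^sup>2 \<le> 1" and Y2: "Y\<^sup>2 \<le> 1" using True by (auto simp: abs_square_le_1)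
    have ab: "a\<^sup>2 \<le> 1 / c\<^sup>2" "b\<^sup>2 \<le> 1 / d\<^sup>2"
      using X2 Y2 c d by (simp_all add: X_def Y_def power_mult_distrib field_simps)
    have r0: "0 \<le> r" by (simp add: r_def)
    have 1: "\<bar>c * (a - sin a * cos b)\<bar> \<le> r"
    proof -
      have "\<bar>c * (a - sin a * cos b)\<bar> \<le> c * (\<bar>a\<bar> * (a\<^sup>2 + b\<^sup>2) / 2)"
        using c abs_diff_sin_cos_le[of a b] by (simp add: abs_mult mult_left_mono)
      also have "\<dots> = \<bar>X\<bar> * r" using c by (simp add: X_def r_def abs_mult)
      also have "\<dots> \<le> 1 * r" using True r0 by (intro mult_right_mono) auto
      finally show ?thesis by simp
    qed
    have 2: "\<bar>d * (b - sin b * cos a)\<bar> \<le> r"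
    proof -
      have "\<bar>d * (b - sin b * cos a)\<bar> \<le> d * (\<bar>b\<bar> * (b\<^sup>2 + a\<^sup>2) / 2)"
        using d abs_diff_sin_cos_le[of b a] by (simp add: abs_mult mult_left_mono)
      also have "\<dots> = \<bar>Y\<bar> * r" using d by (simp add: Y_def r_def abs_mult add.commute)
      also have "\<dots> \<le> 1 * r" using True r0 by (intro mult_right_mono) auto
      finally show ?thesis by simp
    qed
    have 3: "\<bar>f1\<bar> \<le> 4 * hat X"
    proof -
      have "f1 = hat X * (hat X - 4 * X\<^sup>2)" by (simp add: f1_def algebra_simps power2_eq_square)
      moreover have "\<bar>hat X - 4 * X\<^sup>2\<bar> \<le> 4"
        using X2 hat_nonneg[of X] hat_le_1[of X] zero_le_power2[of X] unfolding abs_le_iff by linarith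
      ultimately show ?thesis by (simp add: abs_mult mult_left_mono mult.commute)
    qed
    have 4: "\<bar>4 * Y * hat Y\<bar> \<le> 4 * hat Y"
      using True mult_right_mono[of "\<bar>Y\<bar>" 1 "hat Y"] by (simp add: abs_mult)
    have 5: "\<bar>X * (hat X)\<^sup>2\<bar> \<le> hat X"
      using True mult_mono[of "\<bar>X\<bar>" 1 "(hat X)\<^sup>2" "hat X"] hat_square_le[of X] by (simp add: abs_mult)
    have "\<bar>?R\<bar> \<le> \<bar>c * (a - sin a * cos b)\<bar> * \<bar>f1\<bar> * (hat Y)\<^sup>2 + \<bar>d * (b - sin b * cos a)\<bar> * \<bar>4 * Y * hat Y\<bar> * \<bar>X * (hat X)\<^sup>2\<bar>"
      unfolding R by (rule order.trans[OF abs_triangle_ineq]) (simp add: abs_mult)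
    also have "\<dots> \<le> r * (4 * hat X) * hat Y + r * (4 * hat Y) * hat X"
      using r0 by (intro add_mono mult_mono 1 2 3 4 5 hat_square_le) auto
    also have "\<dots> = 4 * (a\<^sup>2 + b\<^sup>2) * (hat X * hat Y)" by (simp add: r_def algebra_simps)
    also have "\<dots> \<le> 4 * (1 / c\<^sup>2 + 1 / d\<^sup>2) * (hat X * hat Y)"
      using ab by (intro mult_right_mono) auto
    finally show ?thesis by (simp add: X_def Y_def a_def b_def)
  qed
qed

lemma abs_bump_le: "\<bar>bump c d p\<bar> \<le> hat (c * (fst p - pi)) * hat (d * (snd p - pi))"
proof -
  have *: "\<bar>X * (hat X)\<^sup>2\<bar> \<le> hat X" for X
  proof (cases "\<bar>X\<bar> \<le> 1")
    case True
    then show ?thesis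
      using mult_mono[of "\<bar>X\<bar>" 1 "(hat X)\<^sup>2" "hat X"] hat_square_le[of X] by (simp add: abs_mult)
  qed (simp add: hat_eq_0)
  show ?thesis
    unfolding bump_def Let_def abs_mult[of _ "(hat (d * (snd p - pi)))\<^sup>2"]
    using * by (intro mult_mono) (auto intro: hat_square_le)
qed

lemma integral_hat_hat_square:
  assumes "c \<ge> 1" "d \<ge> 1"
  shows "integral Q2 (\<lambda>p. (hat (c * (fst p - pi)) * hat (d * (snd p - pi)))\<^sup>2) = 256 / (225 * (c * d))"
  using integral_Q2_product[of "\<lambda>x. (hat (c * (x - pi)))\<^sup>2" "\<lambda>y. (hat (d * (y - pi)))\<^sup>2"] assms
  by (simp add: power_mult_distrib integral_hat_square continuous_intros)

text \<open>Integration by parts in x replaces the bump by its primitive and gains a factor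
  \<open>1 / c\<close>. Under transport \<open>c * d\<close> is constant while \<open>c\<close>
  grows like \<open>exp t\<close>: this gain is the source of \<open>exp (- \<tau>)\<close> in the
  final estimate. The constant is (1/6) (32/35) (16/15).\<close>

lemma integral_bump_le:
  assumes f: "smooth_torus f" and G: "\<And>p. \<bar>partial_x f p\<bar> \<le> G" and c: "c \<ge> 1" and d: "d \<ge> 1"
  shows "\<bar>integral Q2 (\<lambda>p. f p * bump c d p)\<bar> \<le> G * (256 / (1575 * (c\<^sup>2 * d)))"
proof -
  note [simp] = smooth_torus_simps f
  define B where "B p = (hat (c * (fst p - pi))) ^ 3 * ((hat (d * (snd p - pi)))\<^sup>2 / (6 * c))" for p
  have cB: "continuous_on S B" for S unfolding B_def using c by (intro continuous_intros) auto
  have B0: "0 \<le> B p" for p using c by (simp add: B_def)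
  have dB: "((\<lambda>s. B (s, y)) has_real_derivative - bump c d (x, y)) (at x)" for x y
  proof -
    have "((\<lambda>s. c * (s - pi)) has_real_derivative c) (at x)" by (auto intro!: derivative_eq_intros)
    from DERIV_cmult_right[OF DERIV_hat_cube[OF this], of "(hat (d * (y - pi)))\<^sup>2 / (6 * c)"]
    show ?thesis
      unfolding B_def bump_def Let_def fst_conv snd_conv
      by (rule DERIV_cong) (use c in \<open>simp add: divide_simps\<close>)
  qed
  have "integral Q2 (\<lambda>p. partial_x f p * B p - f p * bump c d p) = 0"
  proof (rule integral_partial_x_zero[where P="\<lambda>p. f p * B p"])
    show "continuous_on UNIV (\<lambda>p. partial_x f p * B p - f p * bump c d p)"
      by (intro continuous_intros cB) auto
    show "((\<lambda>s. f (s, y) * B (s, y)) has_vector_derivative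
        partial_x f (x, y) * B (x, y) - f (x, y) * bump c d (x, y)) (at x)" for x y
      unfolding has_real_derivative_iff_has_vector_derivative[symmetric]
      by (rule derivative_eq_intros dB smooth_torus_DERIV_x[OF f] refl)+ (simp add: algebra_simps)
    \<comment> \<open>\<open>B\<close> is not periodic, but at the two edges the argument of
      \<open>hat\<close> differs only in sign, and \<open>hat\<close> is even.\<close>
    show "f (2 * pi, y) * B (2 * pi, y) = f (0, y) * B (0, y)" for y
      by (simp add: B_def hat_def smooth_torus_periodic[OF f])
  qed
  moreover have "integral Q2 (\<lambda>p. partial_x f p * B p - f p * bump c d p) =
      integral Q2 (\<lambda>p. partial_x f p * B p) - integral Q2 (\<lambda>p. f p * bump c d p)"
    by (intro integral_diff integrable_continuous continuous_intros cB) auto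
  ultimately have "\<bar>integral Q2 (\<lambda>p. f p * bump c d p)\<bar> = norm (integral Q2 (\<lambda>p. partial_x f p * B p))" by simp
  also have "\<dots> \<le> integral Q2 (\<lambda>p. G * B p)"
    by (rule integral_norm_bound_integral)
      (auto intro!: integrable_continuous continuous_intros cB mult_right_mono G B0 simp: abs_mult B0)
  also have "\<dots> = G / (6 * c) * integral Q2 (\<lambda>p. (hat (c * (fst p - pi))) ^ 3 * (hat (d * (snd p - pi)))\<^sup>2)"
    by (subst integral_mult_right[symmetric]) (simp add: B_def mult_ac)
  also have "\<dots> = G / (6 * c) * (32 / (35 * c) * (16 / (15 * d)))"
    using integral_Q2_product[of "\<lambda>x. (hat (c * (x - pi))) ^ 3" "\<lambda>y. (hat (d * (y - pi)))\<^sup>2"] c d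
    by (simp add: integral_hat_square integral_hat_cube continuous_intros)
  also have "\<dots> = G * (256 / (1575 * (c\<^sup>2 * d)))" by (simp add: power2_eq_square)
  finally show ?thesis .
qed

text \<open>The frequency of the sine is the inverse width of the bump, so both have the sign of
  \<open>X\<close> on the whole support and nothing cancels. The constant is (1/2) (16/105) (16/15),
  with 1/2 from \<open>mult_sin_ge\<close>.\<close>

lemma integral_sin_bump_ge:
  assumes c: "c \<ge> 1" and d: "d \<ge> 1"
  shows "integral Q2 (\<lambda>p. sin (c * (fst p - pi)) * bump c d p) \<ge> 128 / (1575 * (c * d))"
proof -
  have "128 / (1575 * (c * d)) = 1 / 2 * (16 / (105 * c) * (16 / (15 * d)))" by simp
  also have "\<dots> = 1 / 2 * integral Q2 (\<lambda>p. (c * (fst p - pi))\<^sup>2 * (hat (c * (fst p - pi)))\<^sup>2 * (hat (d * (snd p - pi)))\<^sup>2)"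
    using integral_Q2_product[of "\<lambda>x. (c * (x - pi))\<^sup>2 * (hat (c * (x - pi)))\<^sup>2" "\<lambda>y. (hat (d * (y - pi)))\<^sup>2"] c d
    by (simp add: integral_hat_square integral_square_hat_square continuous_intros)
  also have "\<dots> = integral Q2 (\<lambda>p. (c * (fst p - pi))\<^sup>2 / 2 * ((hat (c * (fst p - pi)))\<^sup>2 * (hat (d * (snd p - pi)))\<^sup>2))"
    by (subst integral_mult_right[symmetric]) (simp add: mult_ac)
  also have "\<dots> \<le> integral Q2 (\<lambda>p. sin (c * (fst p - pi)) * bump c d p)"
  proof (rule integral_le_continuous)
    fix p :: "real \<times> real"
    have *: "X\<^sup>2 / 2 * ((hat X)\<^sup>2 * Z) \<le> sin X * (X * (hat X)\<^sup>2 * Z)" if "0 \<le> Z" for X Z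
    proof (cases "\<bar>X\<bar> \<le> 1")
      case True
      then show ?thesis using mult_right_mono[OF mult_sin_ge[of X], of "(hat X)\<^sup>2 * Z"] that
        by (simp add: mult_ac)
    qed (simp add: hat_eq_0)
    show "(c * (fst p - pi))\<^sup>2 / 2 * ((hat (c * (fst p - pi)))\<^sup>2 * (hat (d * (snd p - pi)))\<^sup>2)
        \<le> sin (c * (fst p - pi)) * bump c d p"
      unfolding bump_def Let_def by (rule *) simp
  qed (auto intro!: continuous_intros)
  finally show ?thesis .
qed

text \<open>
  The bump is not periodic; the boundary terms vanish since the steady flow is tangent to the boundary of the square.
\<close>

lemma integral_bump_transport:
  assumes f: "smooth_torus f"
  shows "integral Q2 (\<lambda>(x, y). (partial_x f (x, y) * (sin x * cos y) - partial_y f (x, y) * (cos x * sin y)) * bump c d (x, y)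
    + f (x, y) * (bump_x c d (x, y) * (sin x * cos y) - bump_y c d (x, y) * (cos x * sin y))) = 0"
proof -
  note cf = smooth_torus_continuous[OF f] smooth_torus_continuous[OF smooth_torus_partial_x[OF f]]
    smooth_torus_continuous[OF smooth_torus_partial_y[OF f]]
  let ?wx = "\<lambda>p. cos (fst p) * sin (snd p)" and ?wy = "\<lambda>p. sin (fst p) * cos (snd p)"
  let ?wxy = "\<lambda>p. cos (fst p) * cos (snd p)"
  have "integral Q2 (\<lambda>p. (partial_x f p * bump c d p * ?wy p + f p * bump_x c d p * ?wy p + f p * bump c d p * ?wxy p)
     + - (partial_y f p * bump c d p * ?wx p + f p * bump_y c d p * ?wx p + f p * bump c d p * ?wxy p)) = 0"
  proof (rule integral_divergence_zero[where P="\<lambda>p. f p * bump c d p * ?wy p" and R="\<lambda>p. - (f p * bump c d p * ?wx p)"])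
    show "((\<lambda>s. f (s, y) * bump c d (s, y) * ?wy (s, y)) has_real_derivative
        partial_x f (x, y) * bump c d (x, y) * ?wy (x, y) + f (x, y) * bump_x c d (x, y) * ?wy (x, y)
        + f (x, y) * bump c d (x, y) * ?wxy (x, y)) (at x)" for x y
      unfolding fst_conv snd_conv
      by (rule derivative_eq_intros smooth_torus_DERIV_x[OF f] DERIV_bump_x refl)+ (simp add: algebra_simps)
    show "((\<lambda>s. - (f (x, s) * bump c d (x, s) * ?wx (x, s))) has_real_derivative
        - (partial_y f (x, y) * bump c d (x, y) * ?wx (x, y) + f (x, y) * bump_y c d (x, y) * ?wx (x, y)
        + f (x, y) * bump c d (x, y) * ?wxy (x, y))) (at y)" for x y
      unfolding fst_conv snd_conv
      by (rule derivative_eq_intros smooth_torus_DERIV_y[OF f] DERIV_bump_y refl)+ (simp add: algebra_simps)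
  qed (auto intro!: continuous_intros cf)
  then show ?thesis by (simp add: case_prod_beta' algebra_simps)
qed

subsection \<open>The perturbed cellular flow\<close>

lemma partial_x_eqI:
  "(\<And>x y. ((\<lambda>s. f (s, y)) has_real_derivative g (x, y)) (at x)) \<Longrightarrow> partial_x f = g"
  by (auto simp: fun_eq_iff partial_x_def intro!: DERIV_imp_deriv)

lemma partial_y_eqI:
  "(\<And>x y. ((\<lambda>s. f (x, s)) has_real_derivative g (x, y)) (at y)) \<Longrightarrow> partial_y f = g"
  by (auto simp: fun_eq_iff partial_y_def intro!: DERIV_imp_deriv)

text \<open>The amplitude is a parameter because one profile serves twice: \<open>cell 2\<close> is
  the steady vorticity and \<open>cell 1\<close> its stream function.\<close>

definition cell :: "real \<Rightarrow> real \<times> real \<Rightarrow> real" where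
  "cell a p = a * (sin (fst p) * sin (snd p))"

text \<open>The product of sines is rewritten as a difference of cosines, that is, of waves with
  phase \<open>pi / 2\<close>, since smoothness has been shown for linear combinations of
  waves.\<close>

lemma smooth_torus_cell: "smooth_torus (cell a)"
proof -
  have "cell a = (\<lambda>p. a / 2 * (1 * sin (of_int 1 * fst p + of_int (- 1) * snd p + pi / 2))
      + (- a / 2) * (1 * sin (of_int 1 * fst p + of_int 1 * snd p + pi / 2)))"
    by (simp add: cell_def fun_eq_iff sin_add cos_add sin_diff cos_diff algebra_simps)
  then show ?thesis by (simp only: smooth_torus_lincomb smooth_torus_wave)
qed

lemma partial_cell:
  "partial_x (cell a) = (\<lambda>p. a * (cos (fst p) * sin (snd p)))"
  "partial_y (cell a) = (\<lambda>p. a * (sin (fst p) * cos (snd p)))"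
  by (rule partial_x_eqI partial_y_eqI; auto simp: cell_def intro!: derivative_eq_intros)+

lemma laplacian_cell: "laplacian (cell a) p = - cell (2 * a) p"
proof -
  have "partial_x (partial_x (cell a)) = (\<lambda>p. - cell a p)"
    unfolding partial_cell by (rule partial_x_eqI) (auto simp: cell_def intro!: derivative_eq_intros)
  moreover have "partial_y (partial_y (cell a)) = (\<lambda>p. - cell a p)"
    unfolding partial_cell by (rule partial_y_eqI) (auto simp: cell_def intro!: derivative_eq_intros)
  ultimately show ?thesis by (simp add: laplacian_def cell_def)
qed

lemma zero_average_cell: "zero_average (cell a)"
  unfolding zero_average_def
proof (rule integral_partial_x_zero[where P="\<lambda>p. - a * (cos (fst p) * sin (snd p))"])
  show "continuous_on UNIV (cell a)" unfolding cell_def by (intro continuous_intros)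
  show "((\<lambda>s. - a * (cos (fst (s, y)) * sin (snd (s, y)))) has_vector_derivative cell a (x, y)) (at x)" for x y
    unfolding has_real_derivative_iff_has_vector_derivative[symmetric]
    by (auto simp: cell_def intro!: derivative_eq_intros)
qed simp

definition ripple :: "nat \<Rightarrow> real \<Rightarrow> real \<times> real \<Rightarrow> real" where
  "ripple k a p = a * sin (of_nat k * (fst p - pi))"

lemma smooth_torus_ripple: "smooth_torus (ripple k a)"
  using smooth_torus_wave[of a "int k" 0 "- (of_nat k * pi)"]
  by (simp add: ripple_def[abs_def] right_diff_distrib)

lemma partial_ripple:
  "partial_x (ripple k a) = (\<lambda>p. a * of_nat k * cos (of_nat k * (fst p - pi)))"
  "partial_y (ripple k a) = (\<lambda>p. 0)"
  by (rule partial_x_eqI partial_y_eqI; auto simp: ripple_def intro!: derivative_eq_intros)+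

lemma laplacian_ripple: "laplacian (ripple k a) p = - ripple k (a * (of_nat k)\<^sup>2) p"
proof -
  have "partial_x (partial_x (ripple k a)) = (\<lambda>p. - ripple k (a * (of_nat k)\<^sup>2) p)"
    unfolding partial_ripple
    by (rule partial_x_eqI) (auto simp: ripple_def power2_eq_square intro!: derivative_eq_intros)
  moreover have "partial_y (partial_y (ripple k a)) = (\<lambda>p. 0)"
    unfolding partial_ripple by (rule partial_y_eqI) auto
  ultimately show ?thesis by (simp add: laplacian_def)
qed

lemma zero_average_ripple: "zero_average (ripple k a)"
proof (cases "k = 0")
  case True
  then show ?thesis by (simp add: zero_average_def ripple_def[abs_def])
next
  case False
  show ?thesis
    unfolding zero_average_def
  proof (rule integral_partial_x_zero)
    show "continuous_on UNIV (ripple k a)" by (rule smooth_torus_continuous[OF smooth_torus_ripple])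
    show "((\<lambda>s. (\<lambda>p. - a / of_nat k * cos (of_nat k * (fst p - pi))) (s, y)) has_vector_derivative ripple k a (x, y)) (at x)" for x y
      unfolding has_real_derivative_iff_has_vector_derivative[symmetric]
      using False by (auto simp: ripple_def intro!: derivative_eq_intros)
    show "(\<lambda>p. - a / of_nat k * cos (of_nat k * (fst p - pi))) (2 * pi, y) = (\<lambda>p. - a / of_nat k * cos (of_nat k * (fst p - pi))) (0, y)" for y :: real
      by simp
  qed
qed

lemma energy_ripple_le: "energy (ripple k a) \<le> 4 * pi\<^sup>2 * (a * of_nat k)\<^sup>2"
proof -
  have "energy (ripple k a) \<le> integral Q2 (\<lambda>p. (a * of_nat k)\<^sup>2)"
    unfolding energy_def partial_ripple
  proof (rule integral_le_continuous)
    fix p :: "real \<times> real"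
    have "(cos (of_nat k * (fst p - pi)))\<^sup>2 \<le> 1" by (simp add: abs_square_le_1)
    then show "(a * of_nat k * cos (of_nat k * (fst p - pi)))\<^sup>2 + 0\<^sup>2 \<le> (a * of_nat k)\<^sup>2"
      using mult_left_mono[of _ 1 "(a * of_nat k)\<^sup>2"] by (simp add: power_mult_distrib)
  qed (intro continuous_intros)+
  then show ?thesis by (simp add: content_Pair power2_eq_square mult_ac)
qed

text \<open>The gradient has length at most 2 for the cell and at most 8 for the ripple, whatever
  the value of \<open>k\<close>. This exhausts the permitted bound 10 and makes the signal as large
  as possible.\<close>

definition initial_vorticity :: "nat \<Rightarrow> real \<times> real \<Rightarrow> real" where
  "initial_vorticity k p = cell 2 p + ripple k (8 / of_nat k) p"

lemma initial_vorticity: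
  shows smooth_torus_initial_vorticity: "smooth_torus (initial_vorticity k)"
    and zero_average_initial_vorticity: "zero_average (initial_vorticity k)"
    and grad_sup_norm_initial_vorticity: "grad_sup_norm (initial_vorticity k) \<le> 10"
proof -
  show "smooth_torus (initial_vorticity k)"
    using smooth_torus_lincomb[OF smooth_torus_cell smooth_torus_ripple, of 1 2 1 k]
    by (simp add: initial_vorticity_def[abs_def])
  show "zero_average (initial_vorticity k)"
    using zero_average_cell zero_average_ripple
    by (simp add: zero_average_def initial_vorticity_def[abs_def] integral_add_continuous
        smooth_torus_continuous smooth_torus_cell smooth_torus_ripple)
  let ?b = "\<lambda>p. 8 / of_nat k * of_nat k * cos (of_nat k * (fst p - pi))"
  have px: "partial_x (initial_vorticity k) = (\<lambda>p. 2 * (cos (fst p) * sin (snd p)) + ?b p)"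
    by (rule partial_x_eqI) (auto simp: initial_vorticity_def cell_def ripple_def intro!: derivative_eq_intros)
  have py: "partial_y (initial_vorticity k) = (\<lambda>p. 2 * (sin (fst p) * cos (snd p)))"
    by (rule partial_y_eqI) (auto simp: initial_vorticity_def cell_def ripple_def intro!: derivative_eq_intros)
  show "grad_sup_norm (initial_vorticity k) \<le> 10"
    unfolding grad_sup_norm_def
  proof (rule cSUP_least)
    fix p :: "real \<times> real"
    \<comment> \<open>For \<open>k = 0\<close> the amplitude is a division by zero, whose value is
      0.\<close>
    have b: "\<bar>?b p\<bar> \<le> 8" by (cases "k = 0") (auto simp: abs_mult)
    have "(2 * (cos (fst p) * sin (snd p)))\<^sup>2 + (2 * (sin (fst p) * cos (snd p)))\<^sup>2
        = 4 * ((cos (fst p))\<^sup>2 * (sin (snd p))\<^sup>2 + (sin (fst p))\<^sup>2 * (cos (snd p))\<^sup>2)"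
      by (simp add: power_mult_distrib)
    also have "\<dots> \<le> 4 * ((cos (fst p))\<^sup>2 * 1 + (sin (fst p))\<^sup>2 * 1)"
      by (intro mult_left_mono add_mono) (auto simp: abs_square_le_1)
    also have "\<dots> = 2\<^sup>2" by simp
    finally have a: "norm (2 * (cos (fst p) * sin (snd p)), 2 * (sin (fst p) * cos (snd p))) \<le> 2"
      unfolding norm_Pair real_norm_def power2_abs by (intro real_le_lsqrt) simp_all
    have "grad (initial_vorticity k) p = (2 * (cos (fst p) * sin (snd p)), 2 * (sin (fst p) * cos (snd p))) + (?b p, 0)"
      by (simp add: grad_def px py)
    also have "norm \<dots> \<le> 2 + 8"
      using b by (intro norm_triangle_le add_mono a) (simp add: norm_Pair)
    finally show "norm (grad (initial_vorticity k) p) \<le> 10" by simp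
  qed simp
qed

section \<open>Evolution of the perturbation while the gradient stays bounded by
  \<open>M\<close>\<close>

locale perturbed_flow =
  fixes \<theta> \<zeta> \<theta>' :: "real \<Rightarrow> real \<times> real \<Rightarrow> real" and \<tau> M :: real and n :: nat
  assumes \<tau>: "\<tau> > 0" and n: "n > 0"
    and smooth_\<theta>: "\<And>t. t \<in> {0..\<tau>} \<Longrightarrow> smooth_torus (\<theta> t)"
    and smooth_\<zeta>: "\<And>t. t \<in> {0..\<tau>} \<Longrightarrow> smooth_torus (\<zeta> t)"
    and avg_\<zeta>: "\<And>t. t \<in> {0..\<tau>} \<Longrightarrow> zero_average (\<zeta> t)"
    and lap_\<zeta>: "\<And>t p. t \<in> {0..\<tau>} \<Longrightarrow> laplacian (\<zeta> t) p = - \<theta> t p"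
    and cont_\<theta>: "continuous_on ({0..\<tau>} \<times> UNIV) (\<lambda>(t, p). \<theta> t p)"
    and cont_\<theta>': "continuous_on ({0..\<tau>} \<times> UNIV) (\<lambda>(t, p). \<theta>' t p)"
    and \<theta>': "\<And>t p. t \<in> {0..\<tau>} \<Longrightarrow> ((\<lambda>s. \<theta> s p) has_real_derivative \<theta>' t p) (at t within {0..\<tau>})"
    and \<theta>'_eq: "\<And>t p. t \<in> {0..\<tau>} \<Longrightarrow>
      \<theta>' t p = partial_x (\<theta> t) p * partial_y (\<zeta> t) p - partial_y (\<theta> t) p * partial_x (\<zeta> t) p"
    and init: "\<theta> 0 = initial_vorticity (n ^ 4)"
    and M: "\<And>t p. t \<in> {0..\<tau>} \<Longrightarrow> \<bar>partial_x (\<theta> t) p\<bar> \<le> M" "\<And>t p. t \<in> {0..\<tau>} \<Longrightarrow> \<bar>partial_y (\<theta> t) p\<bar> \<le> M"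
begin

definition \<psi> :: "real \<Rightarrow> real \<times> real \<Rightarrow> real" where
  "\<psi> t p = \<theta> t p - cell 2 p"

definition \<xi> :: "real \<Rightarrow> real \<times> real \<Rightarrow> real" where
  "\<xi> t p = \<zeta> t p - cell 1 p"

lemma M_nonneg: "0 \<le> M"
  using M(1)[of 0 "(0, 0)"] \<tau> by (auto intro: order.trans[OF abs_ge_zero])

lemma smooth_\<psi>: "t \<in> {0..\<tau>} \<Longrightarrow> smooth_torus (\<psi> t)"
  unfolding \<psi>_def[abs_def] by (intro smooth_torus_diff smooth_\<theta> smooth_torus_cell)

lemma smooth_\<xi>: "t \<in> {0..\<tau>} \<Longrightarrow> smooth_torus (\<xi> t)"
  unfolding \<xi>_def[abs_def] by (intro smooth_torus_diff smooth_\<zeta> smooth_torus_cell)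

lemma avg_\<xi>: "t \<in> {0..\<tau>} \<Longrightarrow> zero_average (\<xi> t)"
  using avg_\<zeta>[of t] zero_average_cell[of 1]
    integral_diff[OF integrable_continuous[OF smooth_torus_continuous[OF smooth_\<zeta>[of t]]]
      integrable_continuous[OF smooth_torus_continuous[OF smooth_torus_cell[of 1]]]]
  by (simp add: zero_average_def \<xi>_def[abs_def])

lemma lap_\<xi>: "t \<in> {0..\<tau>} \<Longrightarrow> laplacian (\<xi> t) p = - \<psi> t p"
  unfolding \<xi>_def[abs_def] \<psi>_def
  by (simp add: laplacian_diff smooth_\<zeta> smooth_torus_cell lap_\<zeta> laplacian_cell del: atLeastAtMost_iff)

lemma partial_\<psi>:
  assumes "t \<in> {0..\<tau>}"
  shows "partial_x (\<psi> t) p = partial_x (\<theta> t) p - 2 * (cos (fst p) * sin (snd p))"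
    and "partial_y (\<psi> t) p = partial_y (\<theta> t) p - 2 * (sin (fst p) * cos (snd p))"
  unfolding \<psi>_def[abs_def] smooth_torus_partial_diff[OF smooth_\<theta>[OF assms] smooth_torus_cell] partial_cell
  by simp_all

lemma partial_\<xi>:
  assumes "t \<in> {0..\<tau>}"
  shows "partial_x (\<zeta> t) p = cos (fst p) * sin (snd p) + partial_x (\<xi> t) p"
    and "partial_y (\<zeta> t) p = sin (fst p) * cos (snd p) + partial_y (\<xi> t) p"
  unfolding \<xi>_def[abs_def] smooth_torus_partial_diff[OF smooth_\<zeta>[OF assms] smooth_torus_cell] partial_cell
  by simp_all

lemma partial_\<psi>_bound:
  assumes "t \<in> {0..\<tau>}"
  shows "\<bar>partial_x (\<psi> t) p\<bar> \<le> M + 2" "\<bar>partial_y (\<psi> t) p\<bar> \<le> M + 2"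
proof -
  have *: "\<bar>2 * (a * b)\<bar> \<le> 2" if "\<bar>a\<bar> \<le> 1" "\<bar>b\<bar> \<le> 1" for a b :: real
    using mult_mono[OF that] by (simp add: abs_mult)
  show "\<bar>partial_x (\<psi> t) p\<bar> \<le> M + 2"
    unfolding partial_\<psi>[OF assms]
    using abs_triangle_ineq4[of "partial_x (\<theta> t) p" "2 * (cos (fst p) * sin (snd p))"]
      M(1)[OF assms, of p] *[of "cos (fst p)" "sin (snd p)"] by simp
  show "\<bar>partial_y (\<psi> t) p\<bar> \<le> M + 2"
    unfolding partial_\<psi>[OF assms]
    using abs_triangle_ineq4[of "partial_y (\<theta> t) p" "2 * (sin (fst p) * cos (snd p))"]
      M(2)[OF assms, of p] *[of "sin (fst p)" "cos (snd p)"] by simp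
qed

lemma DERIV_\<psi>: "t \<in> {0..\<tau>} \<Longrightarrow> ((\<lambda>s. \<psi> s p) has_real_derivative \<theta>' t p) (at t within {0..\<tau>})"
  unfolding \<psi>_def using DERIV_diff[OF \<theta>' DERIV_const] by fastforce

text \<open>A ripple of amplitude 8 / k^3 with k = n^4 has the same Laplacian as
  \<open>\<xi> 0\<close>. By \<open>energy_add\<close> its energy is that of \<open>\<xi> 0\<close>
  plus the energy of the difference, so the bound follows without identifying the two
  functions.\<close>

lemma energy_\<xi>_initial: "energy (\<xi> 0) \<le> 256 * pi\<^sup>2 / of_nat n ^ 16"
proof -
  let ?r = "ripple (n ^ 4) (8 / of_nat n ^ 12)"
  have 0: "0 \<in> {0..\<tau>}" using \<tau> by simp
  have "laplacian ?r p = laplacian (\<xi> 0) p" for p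
  proof -
    have "laplacian (\<xi> 0) p = - ripple (n ^ 4) (8 / of_nat (n ^ 4)) p"
      using lap_\<xi>[OF 0] by (simp add: \<psi>_def init initial_vorticity_def)
    moreover have "8 / real n ^ 12 * (real (n ^ 4))\<^sup>2 = 8 / real (n ^ 4)"
      using n by (simp add: field_simps flip: power_mult power_add)
    ultimately show ?thesis by (simp add: laplacian_ripple)
  qed
  then have "energy ?r = energy (\<xi> 0) + energy (\<lambda>p. ?r p - \<xi> 0 p)"
    using energy_add[OF smooth_torus_ripple smooth_\<xi>[OF 0], of "n ^ 4" "8 / of_nat n ^ 12"] by simp
  then have "energy (\<xi> 0) \<le> energy ?r" using energy_nonneg[of "\<lambda>p. ?r p - \<xi> 0 p"] by simp
  also have "\<dots> \<le> 4 * pi\<^sup>2 * (8 / of_nat n ^ 12 * of_nat (n ^ 4))\<^sup>2" by (rule energy_ripple_le)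
  also have "\<dots> = 256 * pi\<^sup>2 / of_nat n ^ 16"
    using n by (simp add: field_simps power2_eq_square flip: power_mult power_add)
  finally show ?thesis .
qed

lemma energy_\<xi>_rate:
  assumes t: "t \<in> {0..\<tau>}"
  shows "integral Q2 (\<lambda>p. \<xi> t p * \<theta>' t p) \<le> energy (\<xi> t)"
proof -
  have eq: "\<theta> t = (\<lambda>p. cell 2 p - laplacian (\<xi> t) p)"
    using lap_\<xi>[OF t] by (simp add: \<psi>_def)
  have sl: "smooth_torus (laplacian (\<xi> t))" by (intro smooth_torus_laplacian smooth_\<xi> t)
  have "partial_x (\<theta> t) p = 2 * cos (fst p) * sin (snd p) - partial_x (laplacian (\<xi> t)) p"
    "partial_y (\<theta> t) p = 2 * sin (fst p) * cos (snd p) - partial_y (laplacian (\<xi> t)) p" for p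
    unfolding eq smooth_torus_partial_diff[OF smooth_torus_cell sl] partial_cell by simp_all
  then show ?thesis
    using perturbation_energy_rate[OF smooth_\<xi>[OF t]]
    by (simp add: \<theta>'_eq[OF t] partial_\<xi>[OF t] case_prod_beta')
qed

lemma energy_\<xi>_bound:
  assumes t: "t \<in> {0..\<tau>}"
  shows "energy (\<xi> t) \<le> 256 * pi\<^sup>2 / of_nat n ^ 16 * exp (2 * \<tau>)"
proof -
  \<comment> \<open>Integrating factor for E' \<le> 2 E; Gronwall's inequality becomes the
    monotonicity of \<open>H\<close>.\<close>
  define H where "H s = energy (\<xi> s) * exp (- (2 * s))" for s
  have E': "((\<lambda>s. energy (\<xi> s)) has_real_derivative 2 * integral Q2 (\<lambda>p. \<xi> s p * \<theta>' s p)) (at s within {0..\<tau>})"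
    if "s \<in> {0..\<tau>}" for s
    using that by (intro energy_has_derivative[where \<psi>=\<psi>])
      (auto intro: smooth_\<xi> avg_\<xi> lap_\<xi> DERIV_\<psi> continuous_on_subset[OF cont_\<theta>'])
  have H': "(H has_real_derivative 2 * (integral Q2 (\<lambda>p. \<xi> s p * \<theta>' s p) - energy (\<xi> s)) * exp (- (2 * s))) (at s within {0..\<tau>})"
    if "s \<in> {0..\<tau>}" for s
    unfolding H_def by (auto intro!: derivative_eq_intros E' that simp: algebra_simps)
  have "H t \<le> H 0"
  proof (rule DERIV_nonpos_imp_decreasing_open[where f=H])
    show "0 \<le> t" using t by simp
    have "continuous_on {0..\<tau>} H" using H' by (rule DERIV_continuous_on)
    then show "continuous_on {0..t} H" by (rule continuous_on_subset) (use t in auto)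
    show "\<exists>y. (H has_real_derivative y) (at s) \<and> y \<le> 0" if "0 < s" "s < t" for s
    proof -
      have s: "s \<in> {0..\<tau>}" using that t by simp
      have "at s within {0..\<tau>} = at s" using that t by (intro at_within_Icc_at) auto
      moreover have "2 * (integral Q2 (\<lambda>p. \<xi> s p * \<theta>' s p) - energy (\<xi> s)) * exp (- (2 * s)) \<le> 0"
        using energy_\<xi>_rate[OF s] by (simp add: mult_le_0_iff)
      ultimately show ?thesis using H'[OF s] by metis
    qed
  qed
  then have "energy (\<xi> t) \<le> energy (\<xi> 0) * exp (2 * t)"
    by (simp add: H_def exp_minus field_simps)
  also have "\<dots> \<le> 256 * pi\<^sup>2 / of_nat n ^ 16 * exp (2 * \<tau>)"
    using t energy_\<xi>_initial energy_nonneg[of "\<xi> 0"] by (intro mult_mono) auto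
  finally show ?thesis .
qed

text \<open>Interpolation: as \<psi> is minus the Laplacian of \<xi>, one integration by parts
  leaves \<nabla>\<psi>, bounded by assumption, against \<nabla>\<xi>, small in energy. The weight
  is left free for the later balance.\<close>

lemma integral_\<psi>_square_le:
  assumes t: "t \<in> {0..\<tau>}" and \<mu>: "\<mu> > 0"
  shows "integral Q2 (\<lambda>p. (\<psi> t p)\<^sup>2) \<le> (M + 2) * (\<mu> / 2 * energy (\<xi> t) + 4 * pi\<^sup>2 / \<mu>)"
proof -
  note [simp] = smooth_torus_simps smooth_\<psi>[OF t] smooth_\<xi>[OF t]
  have "integral Q2 (\<lambda>p. (\<psi> t p)\<^sup>2) = - integral Q2 (\<lambda>p. \<psi> t p * laplacian (\<xi> t) p)"
    by (simp add: lap_\<xi>[OF t] power2_eq_square)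
  also have "\<dots> = integral Q2 (\<lambda>p. partial_x (\<psi> t) p * partial_x (\<xi> t) p + partial_y (\<psi> t) p * partial_y (\<xi> t) p)"
    by (simp add: green_identity)
  also have "\<dots> \<le> integral Q2 (\<lambda>p. (M + 2) * (\<bar>partial_x (\<xi> t) p\<bar> + \<bar>partial_y (\<xi> t) p\<bar>))"
  proof (rule integral_le_continuous)
    fix p
    have "partial_x (\<psi> t) p * partial_x (\<xi> t) p \<le> (M + 2) * \<bar>partial_x (\<xi> t) p\<bar>"
      using mult_right_mono[OF partial_\<psi>_bound(1)[OF t, of p], of "\<bar>partial_x (\<xi> t) p\<bar>"]
      by (intro order.trans[OF abs_ge_self[of "partial_x (\<psi> t) p * partial_x (\<xi> t) p"]]) (simp add: abs_mult)
    moreover have "partial_y (\<psi> t) p * partial_y (\<xi> t) p \<le> (M + 2) * \<bar>partial_y (\<xi> t) p\<bar>"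
      using mult_right_mono[OF partial_\<psi>_bound(2)[OF t, of p], of "\<bar>partial_y (\<xi> t) p\<bar>"]
      by (intro order.trans[OF abs_ge_self[of "partial_y (\<psi> t) p * partial_y (\<xi> t) p"]]) (simp add: abs_mult)
    ultimately show "partial_x (\<psi> t) p * partial_x (\<xi> t) p + partial_y (\<psi> t) p * partial_y (\<xi> t) p
        \<le> (M + 2) * (\<bar>partial_x (\<xi> t) p\<bar> + \<bar>partial_y (\<xi> t) p\<bar>)"
      by (simp add: distrib_left)
  qed (auto intro!: continuous_intros)
  also have "\<dots> = (M + 2) * integral Q2 (\<lambda>p. \<bar>partial_x (\<xi> t) p\<bar> + \<bar>partial_y (\<xi> t) p\<bar>)" by simp
  also have "\<dots> \<le> (M + 2) * (\<mu> / 2 * energy (\<xi> t) + 4 * pi\<^sup>2 / \<mu>)"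
    using M_nonneg \<mu> by (intro mult_left_mono integral_grad_L1_le_energy) auto
  finally show ?thesis .
qed

text \<open>The exact solution of the linearised transport: narrowing in x and widening in y at
  reciprocal rates, so the product of the two scales stays equal to n^6.\<close>

abbreviation \<phi> :: "real \<Rightarrow> real \<times> real \<Rightarrow> real" where
  "\<phi> t \<equiv> bump (of_nat n ^ 4 * exp t) (of_nat n ^ 2 * exp (- t))"

abbreviation \<phi>t :: "real \<Rightarrow> real \<times> real \<Rightarrow> real" where
  "\<phi>t t \<equiv> bump_t (of_nat n ^ 4 * exp t) (of_nat n ^ 2 * exp (- t))"

lemma DERIV_integral_\<psi>_bump:
  assumes t: "t \<in> {0..\<tau>}"
  shows "((\<lambda>s. integral Q2 (\<lambda>p. \<psi> s p * \<phi> s p)) has_real_derivative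
    integral Q2 (\<lambda>p. \<theta>' t p * \<phi> t p + \<psi> t p * \<phi>t t p)) (at t within {0..\<tau>})"
proof (rule leibniz_Q2[where F="\<lambda>s p. \<psi> s p * \<phi> s p" and F'="\<lambda>s p. \<theta>' s p * \<phi> s p + \<psi> s p * \<phi>t s p", OF _ _ _ t])
  show "((\<lambda>s. \<psi> s p * \<phi> s p) has_real_derivative \<theta>' s p * \<phi> s p + \<psi> s p * \<phi>t s p) (at s within {0..\<tau>})"
    if "s \<in> {0..\<tau>}" for s p
    by (rule DERIV_cong[OF DERIV_mult[OF DERIV_\<psi>[OF that] DERIV_subset[OF DERIV_bump_t subset_UNIV]]]) simp
  show "continuous_on Q2 (\<lambda>p. \<psi> s p * \<phi> s p)" if "s \<in> {0..\<tau>}" for s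
    by (intro continuous_intros smooth_torus_continuous smooth_\<psi> that)
  have "continuous_on ({0..\<tau>} \<times> Q2) (\<lambda>z. \<theta> (fst z) (snd z))" "continuous_on ({0..\<tau>} \<times> Q2) (\<lambda>z. \<theta>' (fst z) (snd z))"
    using continuous_on_subset[OF cont_\<theta>, of "{0..\<tau>} \<times> Q2"] continuous_on_subset[OF cont_\<theta>', of "{0..\<tau>} \<times> Q2"]
    by (auto simp: case_prod_beta')
  then show "continuous_on ({0..\<tau>} \<times> Q2) (\<lambda>(s, p). \<theta>' s p * \<phi> s p + \<psi> s p * \<phi>t s p)"
    unfolding case_prod_beta' \<psi>_def cell_def by (intro continuous_intros)
qed

text \<open>The integrand splits into \<open>T\<close>, transport by the steady flow with total
  integral 0; \<open>\<psi> t p * R p\<close>, the defect of the linearisation; and the bump times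
  \<open>V\<close>, advection by the perturbation velocity. \<open>\<alpha>\<close> and
  \<open>\<beta>\<close> are the Young weights for the last two.\<close>

lemma integral_\<psi>_bump_rate:
  fixes t \<alpha> \<beta> :: real
  defines "c \<equiv> of_nat n ^ 4 * exp t" and "d \<equiv> of_nat n ^ 2 * exp (- t)"
  assumes t: "t \<in> {0..\<tau>}" and \<alpha>: "\<alpha> > 0" and \<beta>: "\<beta> > 0" and cd: "c \<ge> 1" "d \<ge> 1"
  shows "\<bar>integral Q2 (\<lambda>p. \<theta>' t p * bump c d p + \<psi> t p * bump_t c d p)\<bar> \<le>
    \<alpha> / 2 * integral Q2 (\<lambda>p. (\<psi> t p)\<^sup>2)
    + ((4 * (1 / c\<^sup>2 + 1 / d\<^sup>2))\<^sup>2 / (2 * \<alpha>) + M * \<beta>) * (256 / (225 * (c * d))) + M / (2 * \<beta>) * energy (\<xi> t)"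
proof -
  note [simp] = smooth_torus_simps smooth_\<psi>[OF t] smooth_\<xi>[OF t] smooth_\<theta>[OF t]
  define \<kappa> where "\<kappa> = 4 * (1 / c\<^sup>2 + 1 / d\<^sup>2)"
  define H where "H p = hat (c * (fst p - pi)) * hat (d * (snd p - pi))" for p :: "real \<times> real"
  define wx wy where "wx p = cos (fst p) * sin (snd p)" and "wy p = sin (fst p) * cos (snd p)" for p :: "real \<times> real"
  define R where "R p = bump_t c d p - (bump_x c d p * wy p - bump_y c d p * wx p)" for p
  define V where "V p = partial_x (\<theta> t) p * partial_y (\<xi> t) p - partial_y (\<theta> t) p * partial_x (\<xi> t) p" for p
  define T where "T p = (partial_x (\<psi> t) p * wy p - partial_y (\<psi> t) p * wx p) * bump c d p
    + \<psi> t p * (bump_x c d p * wy p - bump_y c d p * wx p)" for p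
  have cont: "continuous_on Q2 T" "continuous_on Q2 R" "continuous_on Q2 V" "continuous_on Q2 H"
    unfolding T_def R_def V_def H_def wx_def wy_def by (intro continuous_intros; simp)+
  have T: "integral Q2 T = 0"
    using integral_bump_transport[OF smooth_\<psi>[OF t], of c d]
    unfolding T_def[abs_def] wx_def wy_def case_prod_beta' by simp
  \<comment> \<open>The steady vorticity and its stream function are proportional, so their bracket
    vanishes and \<theta> may be replaced by \<psi> in the steady transport term.\<close>
  have "\<theta>' t p * bump c d p + \<psi> t p * bump_t c d p = T p + (\<psi> t p * R p + bump c d p * V p)" for p
    unfolding \<theta>'_eq[OF t] partial_\<xi>[OF t] T_def R_def V_def partial_\<psi>[OF t] wx_def wy_def
    by (simp add: algebra_simps)
  then have "integral Q2 (\<lambda>p. \<theta>' t p * bump c d p + \<psi> t p * bump_t c d p)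
      = integral Q2 T + integral Q2 (\<lambda>p. \<psi> t p * R p + bump c d p * V p)"
    by (simp only:) (intro integral_add_continuous continuous_intros cont smooth_torus_continuous smooth_\<psi> t)
  then have "\<bar>integral Q2 (\<lambda>p. \<theta>' t p * bump c d p + \<psi> t p * bump_t c d p)\<bar>
      = norm (integral Q2 (\<lambda>p. \<psi> t p * R p + bump c d p * V p))" by (simp add: T)
  also have "\<dots> \<le> integral Q2 (\<lambda>p. \<alpha> / 2 * (\<psi> t p)\<^sup>2 + (\<kappa>\<^sup>2 / (2 * \<alpha>) + M * \<beta>) * (H p)\<^sup>2
      + M / (2 * \<beta>) * ((partial_x (\<xi> t) p)\<^sup>2 + (partial_y (\<xi> t) p)\<^sup>2))"
  proof (rule integral_norm_bound_integral)
    fix p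
    have young: "\<bar>u * v\<bar> \<le> r / 2 * u\<^sup>2 + v\<^sup>2 / (2 * r)" if "r > 0" for u v r :: real
    proof -
      have "0 \<le> (r * \<bar>u\<bar> - \<bar>v\<bar>)\<^sup>2 / (2 * r)" using that by simp
      also have "\<dots> = r / 2 * u\<^sup>2 + v\<^sup>2 / (2 * r) - \<bar>u * v\<bar>"
        using that by (simp add: power2_diff field_simps abs_mult power2_eq_square)
      finally show ?thesis by simp
    qed
    have "\<bar>R p\<bar> \<le> \<kappa> * H p"
      using bump_transport_residual[of c d "fst p" "snd p"] cd
      by (simp add: R_def \<kappa>_def H_def wx_def wy_def)
    moreover have "0 \<le> H p" by (simp add: H_def)
    ultimately have R2: "(R p)\<^sup>2 \<le> \<kappa>\<^sup>2 * (H p)\<^sup>2"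
      using power_mono[of "\<bar>R p\<bar>" "\<kappa> * H p" 2] by (simp add: power_mult_distrib)
    have B: "\<bar>bump c d p\<bar> \<le> H p" unfolding H_def by (rule abs_bump_le)
    have "\<bar>\<psi> t p * R p\<bar> \<le> \<alpha> / 2 * (\<psi> t p)\<^sup>2 + \<kappa>\<^sup>2 / (2 * \<alpha>) * (H p)\<^sup>2"
      using young[OF \<alpha>, of "\<psi> t p" "R p"] divide_right_mono[OF R2, of "2 * \<alpha>"] \<alpha> by simp
    moreover have "\<bar>bump c d p * V p\<bar> \<le> M * \<beta> * (H p)\<^sup>2 + M / (2 * \<beta>) * ((partial_x (\<xi> t) p)\<^sup>2 + (partial_y (\<xi> t) p)\<^sup>2)"
    proof -
      have "\<bar>V p\<bar> \<le> M * \<bar>partial_y (\<xi> t) p\<bar> + M * \<bar>partial_x (\<xi> t) p\<bar>"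
        unfolding V_def using M(1)[OF t, of p] M(2)[OF t, of p]
        by (intro order.trans[OF abs_triangle_ineq4] add_mono) (simp_all add: abs_mult mult_right_mono)
      then have "\<bar>bump c d p * V p\<bar> \<le> H p * (M * \<bar>partial_y (\<xi> t) p\<bar> + M * \<bar>partial_x (\<xi> t) p\<bar>)"
        unfolding abs_mult using B \<open>0 \<le> H p\<close> by (intro mult_mono) auto
      also have "\<dots> = M * (\<bar>H p * partial_y (\<xi> t) p\<bar> + \<bar>H p * partial_x (\<xi> t) p\<bar>)"
        using \<open>0 \<le> H p\<close> by (simp add: abs_mult algebra_simps)
      also have "\<dots> \<le> M * ((\<beta> / 2 * (H p)\<^sup>2 + (partial_y (\<xi> t) p)\<^sup>2 / (2 * \<beta>)) + (\<beta> / 2 * (H p)\<^sup>2 + (partial_x (\<xi> t) p)\<^sup>2 / (2 * \<beta>)))"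
        using M_nonneg by (intro mult_left_mono add_mono young \<beta>)
      finally show ?thesis by (simp add: algebra_simps add_divide_distrib)
    qed
    ultimately show "norm (\<psi> t p * R p + bump c d p * V p) \<le> \<alpha> / 2 * (\<psi> t p)\<^sup>2 + (\<kappa>\<^sup>2 / (2 * \<alpha>) + M * \<beta>) * (H p)\<^sup>2
      + M / (2 * \<beta>) * ((partial_x (\<xi> t) p)\<^sup>2 + (partial_y (\<xi> t) p)\<^sup>2)"
      unfolding real_norm_def distrib_right by linarith
  qed (intro integrable_continuous continuous_intros cont; simp)+
  also have "\<dots> = integral Q2 (\<lambda>p. \<alpha> / 2 * (\<psi> t p)\<^sup>2) + integral Q2 (\<lambda>p. (\<kappa>\<^sup>2 / (2 * \<alpha>) + M * \<beta>) * (H p)\<^sup>2)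
      + integral Q2 (\<lambda>p. M / (2 * \<beta>) * ((partial_x (\<xi> t) p)\<^sup>2 + (partial_y (\<xi> t) p)\<^sup>2))"
    by (subst integral_add_continuous, (intro continuous_intros cont; simp)+)+ simp
  also have "\<dots> = \<alpha> / 2 * integral Q2 (\<lambda>p. (\<psi> t p)\<^sup>2)
      + (\<kappa>\<^sup>2 / (2 * \<alpha>) + M * \<beta>) * integral Q2 (\<lambda>p. (H p)\<^sup>2) + M / (2 * \<beta>) * energy (\<xi> t)"
    by (simp only: integral_mult_right energy_def)
  finally show ?thesis
    unfolding \<kappa>_def H_def integral_hat_hat_square[OF cd] .
qed

lemma integral_\<psi>_bump_rate_le:
  assumes t: "t \<in> {0..\<tau>}" and S: "exp \<tau> \<le> of_nat n"
  shows "\<bar>integral Q2 (\<lambda>p. \<theta>' t p * \<phi> t p + \<psi> t p * \<phi>t t p)\<bar> \<le>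
    (66 * pi\<^sup>2 * (M + 2) * exp \<tau> ^ 2 + 2 * (32 * exp \<tau> ^ 4 + M) + 128 * pi\<^sup>2 * M * exp \<tau> ^ 2) / of_nat n ^ 11"
proof -
  define N :: real where "N = of_nat n"
  define S where "S = exp \<tau>"
  define c d where "c = N ^ 4 * exp t" and "d = N ^ 2 * exp (- t)"
  have N: "N \<ge> 1" "S \<le> N" using n S by (simp_all add: N_def S_def)
  have S1: "1 \<le> S" using \<tau> by (simp add: S_def)
  have et: "1 \<le> exp t" "exp t \<le> S" using t by (auto simp: S_def)
  have cd: "c * d = N ^ 6" by (simp add: c_def d_def exp_minus field_simps flip: power_add)
  have c1: "c \<ge> N ^ 4" using et N by (simp add: c_def)
  have d1: "d \<ge> N ^ 2 / S" using et S1 N by (simp add: d_def exp_minus divide_inverse le_imp_inverse_le)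
  \<comment> \<open>Here \<open>exp \<tau> \<le> of_nat n\<close> enters: the bump has widened by at
    most \<open>S\<close> in y and still fits into the square.\<close>
  have "N * N / S \<ge> N"  using N S1 by (simp add: field_simps)
  then have d2: "d \<ge> 1" using d1 N by (simp add: power2_eq_square)
  have c2: "c \<ge> 1" using c1 one_le_power[OF N(1), of 4] by linarith
  have E: "energy (\<xi> t) \<le> 256 * pi\<^sup>2 * S\<^sup>2 / N ^ 16"
    using energy_\<xi>_bound[OF t] by (simp add: N_def S_def exp_double)
  have "1 / c\<^sup>2 \<le> S\<^sup>2 / N ^ 4"
  proof -
    have "1 / c\<^sup>2 \<le> 1 / (N ^ 4)\<^sup>2" using c1 c2 N by (intro divide_left_mono power_mono mult_pos_pos zero_less_power) auto
    also have "\<dots> \<le> 1 / N ^ 4" using N by (simp add: power_increasing divide_left_mono flip: power_mult)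
    also have "\<dots> \<le> S\<^sup>2 / N ^ 4" using S1 N by (intro divide_right_mono) auto
    finally show ?thesis .
  qed
  moreover have "1 / d\<^sup>2 \<le> S\<^sup>2 / N ^ 4"
  proof -
    have "1 / d\<^sup>2 \<le> 1 / (N ^ 2 / S)\<^sup>2" using d1 N S1 d2
      by (intro divide_left_mono power_mono mult_pos_pos zero_less_power) auto
    also have "\<dots> = S\<^sup>2 / N ^ 4" by (simp add: power_divide flip: power_mult)
    finally show ?thesis .
  qed
  ultimately have "4 * (1 / c\<^sup>2 + 1 / d\<^sup>2) \<le> 8 * S\<^sup>2 / N ^ 4" by simp
  then have "(4 * (1 / c\<^sup>2 + 1 / d\<^sup>2))\<^sup>2 \<le> (8 * S\<^sup>2 / N ^ 4)\<^sup>2" by (intro power_mono) auto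
  also have "\<dots> = 64 * S ^ 4 / N ^ 8" by (simp add: power_divide power_mult_distrib flip: power_mult)
  finally have \<kappa>: "(4 * (1 / c\<^sup>2 + 1 / d\<^sup>2))\<^sup>2 \<le> 64 * S ^ 4 / N ^ 8" .
  have \<psi>2: "integral Q2 (\<lambda>p. (\<psi> t p)\<^sup>2) \<le> 132 * pi\<^sup>2 * (M + 2) * S\<^sup>2 / N ^ 8"
  proof -
    \<comment> \<open>The energy is of size N^(-16), so the weight N^8 balances both terms at
      N^(-8).\<close>
    have "integral Q2 (\<lambda>p. (\<psi> t p)\<^sup>2) \<le> (M + 2) * (N ^ 8 / 2 * energy (\<xi> t) + 4 * pi\<^sup>2 / N ^ 8)"
      using N by (intro integral_\<psi>_square_le t) auto
    also have "\<dots> \<le> (M + 2) * (N ^ 8 / 2 * (256 * pi\<^sup>2 * S\<^sup>2 / N ^ 16) + 4 * pi\<^sup>2 * S\<^sup>2 / N ^ 8)"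
      using N S1 M_nonneg E by (intro mult_left_mono add_mono divide_right_mono) auto
    also have "\<dots> = 132 * pi\<^sup>2 * (M + 2) * S\<^sup>2 / N ^ 8"
      using N by (simp add: field_simps flip: power_add)
    finally show ?thesis .
  qed
  \<comment> \<open>The weights are those that equalise each pair: \<alpha> N^(-8) with N^(-14) /
    \<alpha>, and \<beta> N^(-6) with N^(-16) / \<beta>. All terms become N^(-11).\<close>
  have "\<bar>integral Q2 (\<lambda>p. \<theta>' t p * \<phi> t p + \<psi> t p * \<phi>t t p)\<bar> \<le>
    1 / N ^ 3 / 2 * integral Q2 (\<lambda>p. (\<psi> t p)\<^sup>2)
    + ((4 * (1 / c\<^sup>2 + 1 / d\<^sup>2))\<^sup>2 / (2 * (1 / N ^ 3)) + M * (1 / N ^ 5)) * (256 / (225 * (c * d)))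
    + M / (2 * (1 / N ^ 5)) * energy (\<xi> t)"
    using integral_\<psi>_bump_rate[OF t, of "1 / N ^ 3" "1 / N ^ 5"] N c2 d2
    by (simp add: c_def d_def N_def)
  also have "\<dots> \<le> 1 / N ^ 3 / 2 * (132 * pi\<^sup>2 * (M + 2) * S\<^sup>2 / N ^ 8)
    + (64 * S ^ 4 / N ^ 8 / (2 * (1 / N ^ 3)) + M * (1 / N ^ 5)) * (2 / N ^ 6)
    + M / (2 * (1 / N ^ 5)) * (256 * pi\<^sup>2 * S\<^sup>2 / N ^ 16)"
  proof -
    have "256 / (225 * (c * d)) \<le> 2 / N ^ 6" using N unfolding cd by (simp add: field_simps)
    moreover have "0 \<le> c * d" using c2 d2 by simp
    moreover have "0 \<le> integral Q2 (\<lambda>p. (\<psi> t p)\<^sup>2)"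
      by (intro integral_nonneg integrable_continuous continuous_intros smooth_torus_continuous smooth_\<psi> t) simp
    ultimately show ?thesis
      using N M_nonneg \<kappa> \<psi>2 E energy_nonneg[of "\<xi> t"]
      by (intro add_mono mult_mono divide_right_mono order.refl) (auto intro!: add_nonneg_nonneg divide_nonneg_nonneg mult_nonneg_nonneg)
  qed
  also have "\<dots> = (66 * pi\<^sup>2 * (M + 2) * S ^ 2 + 2 * (32 * S ^ 4 + M) + 128 * pi\<^sup>2 * M * S ^ 2) / N ^ 11"
    using N by (simp add: field_simps flip: power_add)
  finally show ?thesis by (simp add: N_def S_def)
qed

text \<open>The initial pairing is at most the final one plus its total variation over time \<tau>.
  The first two are multiples of n^(-10) and the variation is O(n^(-11)), so after scaling only the
  variation still depends on n, through the factor 1/n. The left side is 8 times the constant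
  128/1575 of \<open>integral_sin_bump_ge\<close>.\<close>

lemma gradient_bound_lower:
  assumes S: "exp \<tau> \<le> of_nat n"
  shows "1024 / 1575 \<le> 256 / 1575 * (M + 2) / exp \<tau>
    + \<tau> * (66 * pi\<^sup>2 * (M + 2) * exp \<tau> ^ 2 + 2 * (32 * exp \<tau> ^ 4 + M) + 128 * pi\<^sup>2 * M * exp \<tau> ^ 2) / of_nat n"
    (is "_ \<le> _ + \<tau> * ?K / _")
proof -
  define N :: real where "N = of_nat n"
  define S where "S = exp \<tau>"
  define F where "F t = integral Q2 (\<lambda>p. \<psi> t p * \<phi> t p)" for t
  have S1: "1 \<le> S" using \<tau> by (simp add: S_def)
  have N: "N \<ge> 1" "S \<le> N" using n S by (simp_all add: N_def S_def)
  have "norm (F 0 - F \<tau>) \<le> ?K / N ^ 11 * norm (0 - \<tau>)"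
  proof (rule field_differentiable_bound[where S="{0..\<tau>}" and f=F and f'="\<lambda>t. integral Q2 (\<lambda>p. \<theta>' t p * \<phi> t p + \<psi> t p * \<phi>t t p)"])
    show "(F has_real_derivative integral Q2 (\<lambda>p. \<theta>' t p * \<phi> t p + \<psi> t p * \<phi>t t p)) (at t within {0..\<tau>})"
      if "t \<in> {0..\<tau>}" for t
      unfolding F_def using that by (rule DERIV_integral_\<psi>_bump)
    show "norm (integral Q2 (\<lambda>p. \<theta>' t p * \<phi> t p + \<psi> t p * \<phi>t t p)) \<le> ?K / N ^ 11" if "t \<in> {0..\<tau>}" for t
      using integral_\<psi>_bump_rate_le[OF that S] by (simp add: N_def)
  qed (use \<tau> in auto)
  then have 1: "F 0 \<le> \<bar>F \<tau>\<bar> + \<tau> * ?K / N ^ 11" using \<tau> by (simp add: mult.commute)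
  have 2: "F 0 \<ge> 1024 / (1575 * N ^ 10)"
  proof -
    have "\<psi> 0 p * \<phi> 0 p = 8 / N ^ 4 * (sin (N ^ 4 * (fst p - pi)) * bump (N ^ 4) (N ^ 2) p)" for p
      by (simp add: \<psi>_def init initial_vorticity_def ripple_def N_def)
    then have "F 0 = 8 / N ^ 4 * integral Q2 (\<lambda>p. sin (N ^ 4 * (fst p - pi)) * bump (N ^ 4) (N ^ 2) p)"
      by (simp only: F_def integral_mult_right)
    moreover have "integral Q2 (\<lambda>p. sin (N ^ 4 * (fst p - pi)) * bump (N ^ 4) (N ^ 2) p) \<ge> 128 / (1575 * (N ^ 4 * N ^ 2))"
      using N by (intro integral_sin_bump_ge) auto
    ultimately have "F 0 \<ge> 8 / N ^ 4 * (128 / (1575 * (N ^ 4 * N ^ 2)))"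
      using N by (simp only:) (intro mult_left_mono, auto)
    also have "8 / N ^ 4 * (128 / (1575 * (N ^ 4 * N ^ 2))) = 1024 / (1575 * N ^ 10)"
      by (simp flip: power_add)
    finally show ?thesis .
  qed
  have 3: "\<bar>F \<tau>\<bar> \<le> 256 / 1575 * (M + 2) / S / N ^ 10"
  proof -
    have \<tau>': "\<tau> \<in> {0..\<tau>}" using \<tau> by simp
    have "1 * 1 \<le> N ^ 4 * S" using N S1 by (intro mult_mono one_le_power) auto
    moreover have "1 \<le> N\<^sup>2 * exp (- \<tau>)"
      using N S1 mult_mono[of 1 N S N] by (simp add: S_def[symmetric] exp_minus field_simps power2_eq_square)
    ultimately have "\<bar>F \<tau>\<bar> \<le> (M + 2) * (256 / (1575 * ((N ^ 4 * exp \<tau>)\<^sup>2 * (N\<^sup>2 * exp (- \<tau>)))))"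
      unfolding F_def N_def[symmetric]
      by (intro integral_bump_le smooth_\<psi> partial_\<psi>_bound \<tau>') (simp_all add: S_def)
    also have "(N ^ 4 * exp \<tau>)\<^sup>2 * (N\<^sup>2 * exp (- \<tau>)) = N ^ 10 * S"
      using S1 by (simp add: S_def[symmetric] exp_minus power_mult_distrib power2_eq_square[of S] field_simps flip: power_add power_mult)
    finally show ?thesis by (simp add: algebra_simps)
  qed
  from 1 2 3 have "1024 / (1575 * N ^ 10) \<le> 256 / 1575 * (M + 2) / S / N ^ 10 + \<tau> * ?K / N ^ 11" by linarith
  then have "1024 / (1575 * N ^ 10) * N ^ 10 \<le> (256 / 1575 * (M + 2) / S / N ^ 10 + \<tau> * ?K / N ^ 11) * N ^ 10"
    using N by (intro mult_right_mono) auto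
  also have "\<dots> = 256 / 1575 * (M + 2) / S + \<tau> * ?K / N"
  proof -
    have "N ^ 11 = N * N ^ 10" by (simp add: power_Suc[symmetric] del: power_Suc)
    then have "(a / N ^ 10 + b / N ^ 11) * N ^ 10 = a + b / N" for a b
      using N by (simp add: distrib_right)
    then show ?thesis .
  qed
  also have "1024 / (1575 * N ^ 10) * N ^ 10 = 1024 / 1575" using N by simp
  finally show ?thesis by (simp only: N_def S_def)
qed

end

theorem theorem1p2:
  fixes T :: real
  assumes "T > 0"
  shows "\<exists>\<theta>0 :: real \<times> real \<Rightarrow> real.
           smooth_torus \<theta>0 \<and> zero_average \<theta>0 \<and> grad_sup_norm \<theta>0 \<le> 10 \<and>
           (\<forall>\<theta>. euler_solution \<theta>0 \<theta> \<longrightarrow>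
              (\<exists>t. 0 \<le> t \<and> t < T \<and> grad_sup_norm (\<theta> t) > 0.1 * exp (T / 2)))"
proof -
  \<comment> \<open>Half of the available time already produces the growth
    \<open>exp (T / 2)\<close>, and every time up to \<open>\<tau>\<close> is strictly below
    \<open>T\<close>. \<open>M\<close> is the target value itself, so \<open>K\<close> depends on
    \<open>T\<close> alone and \<open>n\<close> can be chosen afterwards.\<close>
  define \<tau> S M where "\<tau> = T / 2" and "S = exp \<tau>" and "M = 0.1 * exp (T / 2)"
  define K where "K = 66 * pi\<^sup>2 * (M + 2) * S ^ 2 + 2 * (32 * S ^ 4 + M) + 128 * pi\<^sup>2 * M * S ^ 2"
  have \<tau>: "\<tau> > 0" "\<tau> < T" using assms by (simp_all add: \<tau>_def)
  have S: "1 \<le> S" "M = 0.1 * S" using \<tau> by (simp_all add: S_def M_def \<tau>_def)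
  \<comment> \<open>Large enough for the widened bump to fit (\<open>S \<le> n\<close>) and for the
    variation term to stay below 1/4.\<close>
  obtain n :: nat where n: "S + \<tau> * \<bar>K\<bar> * 4 < of_nat n" using reals_Archimedean2 by blast
  have "0 \<le> \<tau> * \<bar>K\<bar> * 4" using \<tau> by simp
  then have n': "S \<le> of_nat n" "n > 0" "\<tau> * \<bar>K\<bar> * 4 < of_nat n"
    using n S by (linarith, auto intro: gr0I)
  show ?thesis
  proof (rule exI[of _ "initial_vorticity (n ^ 4)"], intro conjI allI impI)
    show "smooth_torus (initial_vorticity (n ^ 4))" "zero_average (initial_vorticity (n ^ 4))"
      "grad_sup_norm (initial_vorticity (n ^ 4)) \<le> 10"
      by (rule initial_vorticity)+
    fix \<theta> assume sol: "euler_solution (initial_vorticity (n ^ 4)) \<theta>"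
    show "\<exists>t. 0 \<le> t \<and> t < T \<and> grad_sup_norm (\<theta> t) > 0.1 * exp (T / 2)"
    proof (rule ccontr)
      assume "\<not> ?thesis"
      then have bound: "grad_sup_norm (\<theta> t) \<le> M" if "0 \<le> t" "t < T" for t
        using that unfolding M_def by force
      obtain \<zeta> \<theta>' where facts: "\<And>t. t \<ge> 0 \<Longrightarrow> smooth_torus (\<theta> t)"
        "continuous_on ({0..} \<times> UNIV) (\<lambda>(t, p). \<theta> t p)"
        "\<And>t. t \<ge> 0 \<Longrightarrow> smooth_torus (\<zeta> t)" "\<And>t. t \<ge> 0 \<Longrightarrow> zero_average (\<zeta> t)"
        "\<And>t p. t \<ge> 0 \<Longrightarrow> laplacian (\<zeta> t) p = - \<theta> t p"
        "\<And>t p. t \<ge> 0 \<Longrightarrow> ((\<lambda>s. \<theta> s p) has_real_derivative \<theta>' t p) (at t within {0..})"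
        "continuous_on ({0..} \<times> UNIV) (\<lambda>(t, p). \<theta>' t p)"
        "\<And>t p. t \<ge> 0 \<Longrightarrow> \<theta>' t p = partial_x (\<theta> t) p * partial_y (\<zeta> t) p - partial_y (\<theta> t) p * partial_x (\<zeta> t) p"
        using euler_solutionE[OF sol zero_average_initial_vorticity] by blast
      interpret perturbed_flow \<theta> \<zeta> \<theta>' \<tau> M n
      proof
        show "\<theta> 0 = initial_vorticity (n ^ 4)" using sol by (simp add: euler_solution_def)
        show "continuous_on ({0..\<tau>} \<times> UNIV) (\<lambda>(t, p). \<theta> t p)" "continuous_on ({0..\<tau>} \<times> UNIV) (\<lambda>(t, p). \<theta>' t p)"
          by (rule continuous_on_subset[OF facts(2)] continuous_on_subset[OF facts(7)]; auto)+
        show "((\<lambda>s. \<theta> s p) has_real_derivative \<theta>' t p) (at t within {0..\<tau>})" if "t \<in> {0..\<tau>}" for t p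
          using facts(6)[of t p] that by (auto intro: DERIV_subset)
        show "\<bar>partial_x (\<theta> t) p\<bar> \<le> M" "\<bar>partial_y (\<theta> t) p\<bar> \<le> M" if "t \<in> {0..\<tau>}" for t p
          using that \<tau> bound[of t] grad_sup_norm_bound[OF facts(1), of t p] by auto
      qed (use \<tau> n' facts in auto)
      define r where "r = (M + 2) / S"
      have "1024 / 1575 \<le> 256 / 1575 * r + \<tau> * K / of_nat n"
        using gradient_bound_lower n'(1) by (simp add: S_def K_def r_def)
      \<comment> \<open>Indeed \<open>r\<close> is 0.1 + 2 / S with \<open>S \<ge> 1\<close>. The
        right side above is then at most 256 * 2.1 / 1575 + 1/4 < 0.6, while 1024/1575 >
        0.65.\<close>
      moreover have "r \<le> 2.1" using S by (simp add: r_def field_simps)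
      moreover have "\<tau> * K / of_nat n \<le> 1 / 4"
      proof -
        have "\<tau> * K \<le> \<tau> * \<bar>K\<bar>" using \<tau> by simp
        then show ?thesis using n'(2,3) by (simp add: field_simps)
      qed
      ultimately show False by linarith
    qed
  qed
qed

end
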